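(* Let $i\in\mathbb S^2$ and $0<p\le1$, and let $n\in\mathbb N$ with $np>1$. Then $\rho_{p,n,i}(f)$ is finite for any $f\in\mathfrak B_{p,i}$. Furthermore, for all $f\in\mathfrak B_{p,i}$, $$\rho_{p,n,i}(f\circ_iT_a)=\rho_{p,n,i}(f)\qquad\text{for all }a\in\mathbb B_i.$$
   Context: $\mathbb H$ denotes the quaternions with real part coordinate $x_0$, $\mathbb S^2$ the sphere of purely imaginary unit quaternions, $\mathbb C(i)=\{x+iy:x,y\in\mathbb R\}$ for $i\in\mathbb S^2$, $\mathbb B$ the open unit ball of $\mathbb H$, $\mathbb B_i=\mathbb B\cap\mathbb C(i)$. A real differentiable function $f:\mathbb B\to\mathbb H$ is (left) slice regular if for every $i\in\mathbb S^2$, $\left(\frac{\partial}{\partial x}+i\frac{\partial}{\partial y}\right)f(x+iy)=0$ on $\mathbb B_i$; $\mathcal{SR}(\mathbb B)$ is the set of these functions. $dA_i=\frac1\pi dx\,dy$ on $\mathbb B_i$ and $d\lambda_i(z)=\frac{dA_i(z)}{(1-|z|^2)^2}$. For $p>0$, $\mathfrak B_{p,i}$ is the quaternionic right linear space of $f\in\mathcal{SR}(\mathbb B)$ such that $\int_{\mathbb B_i}|(1-|z|^2)^n\partial_{x_0}^nf(z)|^pd\lambda_i(z)<\infty$ for some $n\in\mathbb N$ with $np>1$ (this does not depend on the choice of $n$). $Q_i[f]=f|_{\mathbb B_i}$. For $j\in\mathbb S^2$ orthogonal to $i$, every $f\in\mathcal{SR}(\mathbb B)$ satisfies $Q_i[f]=f_1+f_2j$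 with $f_1,f_2:\mathbb B_i\to\mathbb C(i)$ holomorphic. For $g=g_1+g_2j$ with $g_1,g_2$ holomorphic $\mathbb B_i\to\mathbb C(i)$, $P_i[g]\in\mathcal{SR}(\mathbb B)$ is the slice regular extension $P_i[g](x+I_qy)=\frac12[(1+I_qi)g(x-yi)+(1-I_qi)g(x+yi)]$. $T_a(q)=(1-q\bar a)^{-\ast}\ast(a-q)$, where $\ast$ is the slice regular product (for power series, $(\sum q^na_n)\ast(\sum q^nb_n)=\sum_nq^n\sum_ka_kb_{n-k}$) and $(1-q\bar a)^{-\ast}=\sum_{n\ge0}q^n\bar a^n$; for $a\in\mathbb B_i$, on $\mathbb B_i$ it equals $\frac{a-z}{1-\bar az}$. The composition is $f\circ_iT_a:=P_i[f_1\circ Q_i[T_a]]+P_i[f_2\circ Q_i[T_a]]\,j$. For $0<p\le1$, $n\in\mathbb N$ with $np>1$, and $f\in\mathfrak B_{p,i}$, $$\rho_{p,n,i}(f)=\sup_{z\in\mathbb B_i}|f(z)|+\sup_{a\in\mathbb B_i}\left[\int_{\mathbb B_i}(1-|z|^2)^{np}|\partial_{x_0}^n(f\circ_iT_a)(z)|^pd\lambda_i(z)\right]^{1/p}.$$ *)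

theory Defs
  imports
    "HOL-Analysis.Analysis"
    "HOL-Computational_Algebra.Formal_Power_Series"
begin

section \<open>Quaternions\<close>

codatatype quat = Quat (qre: real) (qim1: real) (qim2: real) (qim3: real)

lemma quat_eqI [intro?]:
  "\<lbrakk>qre p = qre q; qim1 p = qim1 q; qim2 p = qim2 q; qim3 p = qim3 q\<rbrakk> \<Longrightarrow> p = q"
  by (rule quat.expand) simp

lemma quat_eq_iff:
  "p = q \<longleftrightarrow> qre p = qre q \<and> qim1 p = qim1 q \<and> qim2 p = qim2 q \<and> qim3 p = qim3 q"
  by (auto intro: quat_eqI)

instantiation quat :: ab_group_add
begin

primcorec zero_quat where
  "qre 0 = 0" | "qim1 0 = 0" | "qim2 0 = 0" | "qim3 0 = 0"

primcorec plus_quat where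
  "qre (p + q) = qre p + qre q"
| "qim1 (p + q) = qim1 p + qim1 q"
| "qim2 (p + q) = qim2 p + qim2 q"
| "qim3 (p + q) = qim3 p + qim3 q"

primcorec uminus_quat where
  "qre (- p) = - qre p"
| "qim1 (- p) = - qim1 p"
| "qim2 (- p) = - qim2 p"
| "qim3 (- p) = - qim3 p"

primcorec minus_quat where
  "qre (p - q) = qre p - qre q"
| "qim1 (p - q) = qim1 p - qim1 q"
| "qim2 (p - q) = qim2 p - qim2 q"
| "qim3 (p - q) = qim3 p - qim3 q"

instance
  by standard (simp_all add: quat_eq_iff)

end

instantiation quat :: ring_1
begin

primcorec one_quat where
  "qre 1 = 1" | "qim1 1 = 0" | "qim2 1 = 0" | "qim3 1 = 0"

primcorec times_quat where
  "qre (p * q) = qre p * qre q - qim1 p * qim1 q - qim2 p * qim2 q - qim3 p * qim3 q"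
| "qim1 (p * q) = qre p * qim1 q + qim1 p * qre q + qim2 p * qim3 q - qim3 p * qim2 q"
| "qim2 (p * q) = qre p * qim2 q - qim1 p * qim3 q + qim2 p * qre q + qim3 p * qim1 q"
| "qim3 (p * q) = qre p * qim3 q + qim1 p * qim2 q - qim2 p * qim1 q + qim3 p * qre q"

instance
  by standard (simp_all add: quat_eq_iff algebra_simps)

end

instantiation quat :: real_algebra_1
begin

primcorec scaleR_quat where
  "qre (scaleR r q) = r * qre q"
| "qim1 (scaleR r q) = r * qim1 q"
| "qim2 (scaleR r q) = r * qim2 q"
| "qim3 (scaleR r q) = r * qim3 q"

instance
  by standard (simp_all add: quat_eq_iff algebra_simps)

end

lemma of_real_quat_sel [simp]:
  "qre (of_real r) = r" "qim1 (of_real r) = 0" "qim2 (of_real r) = 0" "qim3 (of_real r) = 0"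
  by (simp_all add: of_real_def)

instantiation quat :: real_inner
begin

definition inner_quat :: "quat \<Rightarrow> quat \<Rightarrow> real" where
  "inner_quat p q = qre p * qre q + qim1 p * qim1 q + qim2 p * qim2 q + qim3 p * qim3 q"

definition norm_quat :: "quat \<Rightarrow> real" where
  "norm_quat q = sqrt ((qre q)\<^sup>2 + (qim1 q)\<^sup>2 + (qim2 q)\<^sup>2 + (qim3 q)\<^sup>2)"

definition sgn_quat :: "quat \<Rightarrow> quat" where
  "sgn_quat q = q /\<^sub>R norm q"

definition dist_quat :: "quat \<Rightarrow> quat \<Rightarrow> real" where
  "dist_quat p q = norm (p - q)"

definition uniformity_quat :: "(quat \<times> quat) filter" where
  "uniformity_quat = (INF e\<in>{0 <..}. principal {(x, y). dist x y < e})"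

definition open_quat :: "quat set \<Rightarrow> bool" where
  "open_quat U \<longleftrightarrow> (\<forall>x\<in>U. eventually (\<lambda>(x', y). x' = x \<longrightarrow> y \<in> U) uniformity)"

instance
proof
  fix p q s :: quat and r :: real and U :: "quat set"
  show "dist p q = norm (p - q)"
    by (rule dist_quat_def)
  show "sgn p = p /\<^sub>R norm p"
    by (rule sgn_quat_def)
  show "uniformity = (INF e\<in>{0 <..}. principal {(x, y :: quat). dist x y < e})"
    by (rule uniformity_quat_def)
  show "open U \<longleftrightarrow> (\<forall>x\<in>U. eventually (\<lambda>(x', y). x' = x \<longrightarrow> y \<in> U) uniformity)"
    by (rule open_quat_def)
  show "inner p q = inner q p"
    by (simp add: inner_quat_def mult.commute)
  show "inner (p + q) s = inner p s + inner q s"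
    by (simp add: inner_quat_def algebra_simps)
  show "inner (scaleR r p) q = r * inner p q"
    by (simp add: inner_quat_def algebra_simps)
  show "0 \<le> inner p p"
    by (simp add: inner_quat_def)
  show "inner p p = 0 \<longleftrightarrow> p = 0"
    by (auto simp: inner_quat_def quat_eq_iff add_nonneg_eq_0_iff)
  show "norm p = sqrt (inner p p)"
    by (simp add: norm_quat_def inner_quat_def power2_eq_square)
qed

end

lemma norm_quat_sq: "(norm q)\<^sup>2 = (qre q)\<^sup>2 + (qim1 q)\<^sup>2 + (qim2 q)\<^sup>2 + (qim3 q)\<^sup>2"
  by (simp add: norm_quat_def)

primcorec qcnj :: "quat \<Rightarrow> quat" where
  "qre (qcnj q) = qre q"
| "qim1 (qcnj q) = - qim1 q"
| "qim2 (qcnj q) = - qim2 q"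
| "qim3 (qcnj q) = - qim3 q"

lemma qcnj_mult_self: "qcnj q * q = of_real ((norm q)\<^sup>2)" "q * qcnj q = of_real ((norm q)\<^sup>2)"
  by (simp_all add: quat_eq_iff norm_quat_sq, simp_all add: power2_eq_square)

instantiation quat :: real_normed_div_algebra
begin

definition inverse_quat :: "quat \<Rightarrow> quat" where
  "inverse_quat q = qcnj q /\<^sub>R (norm q)\<^sup>2"

definition divide_quat :: "quat \<Rightarrow> quat \<Rightarrow> quat" where
  "divide_quat p q = p * inverse q"

instance
proof
  fix p q :: quat
  show "p \<noteq> 0 \<Longrightarrow> inverse p * p = 1" "p \<noteq> 0 \<Longrightarrow> p * inverse p = 1"
    by (simp_all add: inverse_quat_def qcnj_mult_self of_real_def del: of_real_power)
  show "inverse (0 :: quat) = 0"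
    by (simp add: inverse_quat_def)
  show "p div q = p * inverse q"
    by (rule divide_quat_def)
  have "(norm (p * q))\<^sup>2 = (norm p * norm q)\<^sup>2"
    unfolding power_mult_distrib norm_quat_sq times_quat.simps
    by (simp add: power2_eq_square algebra_simps)
  then show "norm (p * q) = norm p * norm q"
    by (simp add: power2_eq_iff_nonneg)
qed

end


section \<open>Slices\<close>

definition imag_units :: "quat set" where
  "imag_units = {q. qre q = 0 \<and> norm q = 1}"

definition slice_emb :: "quat \<Rightarrow> complex \<Rightarrow> quat" where
  "slice_emb i z = of_real (Re z) + i * of_real (Im z)"

definition slice :: "quat \<Rightarrow> quat set" where
  "slice i = range (slice_emb i)"

definition slice_ball :: "quat \<Rightarrow> quat set" where
  "slice_ball i = ball 0 1 \<inter> slice i"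

text \<open>
  Functions on the unit ball, or on a slice of it, are total functions whose values elsewhere are
  irrelevant; in particular the restriction \<open>Q\<^sub>i\<close> of a function to a slice of the ball
  is the function itself.
\<close>

definition slice_regular :: "(quat \<Rightarrow> quat) set" where
  "slice_regular = {f. (\<forall>q\<in>ball 0 1. f differentiable (at q)) \<and>
     (\<forall>i\<in>imag_units. \<forall>x y. of_real x + i * of_real y \<in> ball 0 1 \<longrightarrow>
        vector_derivative (\<lambda>s. f (of_real s + i * of_real y)) (at x)
        + i * vector_derivative (\<lambda>t. f (of_real x + i * of_real t)) (at y) = 0)}"

definition real_partial :: "(quat \<Rightarrow> quat) \<Rightarrow> quat \<Rightarrow> quat" where
  "real_partial f q = vector_derivative (\<lambda>t. f (q + of_real t)) (at 0)"


section \<open>The slice Besov spaces\<close>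

text \<open>
  The measures on the slice of the ball are carried over to the unit disc of the complex plane
  along \<^const>\<open>slice_emb\<close>.
\<close>

definition disc_area :: "complex measure" where
  "disc_area = density (restrict_space lborel (ball 0 1)) (\<lambda>_. ennreal (1 / pi))"

definition disc_lambda :: "complex measure" where
  "disc_lambda = density disc_area (\<lambda>z. ennreal (1 / (1 - (norm z)\<^sup>2)\<^sup>2))"

definition slice_lambda_integral :: "quat \<Rightarrow> (quat \<Rightarrow> ennreal) \<Rightarrow> ennreal" where
  "slice_lambda_integral i F = (\<integral>\<^sup>+ z. F (slice_emb i z) \<partial>disc_lambda)"

definition besov :: "real \<Rightarrow> quat \<Rightarrow> (quat \<Rightarrow> quat) set" where
  "besov p i = {f \<in> slice_regular. \<exists>n::nat. real n * p > 1 \<and>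
     slice_lambda_integral i
       (\<lambda>q. ennreal (norm ((1 - (norm q)\<^sup>2) ^ n *\<^sub>R (real_partial ^^ n) f q) powr p)) < \<infinity>}"


section \<open>Splitting and extension\<close>

text \<open>The coordinates \<open>(a, b)\<close> of \<open>q = a + b j\<close> over the slice of \<open>i\<close>.\<close>

definition slice_split :: "quat \<Rightarrow> quat \<Rightarrow> quat \<Rightarrow> quat \<times> quat" where
  "slice_split i j q = (THE (a, b). a \<in> slice i \<and> b \<in> slice i \<and> q = a + b * j)"

lemma imag_units_sq:
  assumes "i \<in> imag_units"
  shows "i * i = -1"
  using assms norm_quat_sq[of i]
  by (auto simp: imag_units_def quat_eq_iff power2_eq_square)

lemma imag_units_anticommute:
  assumes "i \<in> imag_units" "j \<in> imag_units" "inner i j = 0"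
  shows "j * i = - (i * j)"
  using assms by (simp add: imag_units_def quat_eq_iff inner_quat_def algebra_simps)

lemma of_real_quat_commute: "of_real r * (q :: quat) = q * of_real r"
  by (simp add: quat_eq_iff)

lemma slice_iff_commute:
  assumes i: "i \<in> imag_units"
  shows "q \<in> slice i \<longleftrightarrow> q * i = i * q"
proof
  assume "q \<in> slice i"
  then show "q * i = i * q"
    by (auto simp: slice_def slice_emb_def distrib_left distrib_right mult.assoc
        of_real_quat_commute)
next
  assume c: "q * i = i * q"
  have re: "qre i = 0" and n: "(qim1 i)\<^sup>2 + (qim2 i)\<^sup>2 + (qim3 i)\<^sup>2 = 1"
    using i norm_quat_sq[of i] by (simp_all add: imag_units_def)
  have "qim2 q * qim3 i = qim3 q * qim2 i" "qim3 q * qim1 i = qim1 q * qim3 i"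
    "qim1 q * qim2 i = qim2 q * qim1 i"
    using arg_cong[OF c, of qim1] arg_cong[OF c, of qim2] arg_cong[OF c, of qim3] re
    unfolding times_quat.simps by algebra+
  then have "q = slice_emb i (Complex (qre q) (inner q i))"
    unfolding slice_emb_def using n re
    by (intro quat_eqI; simp add: inner_quat_def; algebra)
  then show "q \<in> slice i"
    unfolding slice_def by blast
qed

lemma slice_split_ex1:
  assumes i: "i \<in> imag_units" and j: "j \<in> imag_units" and ij: "inner i j = 0"
  shows "\<exists>!(a, b). a \<in> slice i \<and> b \<in> slice i \<and> q = a + b * j"
proof -
  note ii = imag_units_sq[OF i] and jj = imag_units_sq[OF j]
    and ji = imag_units_anticommute[OF i j ij]
  have ii': "i * (i * x) = - x" and jj': "j * (j * x) = - x"
    and ji': "j * (i * x) = - (i * (j * x))" for x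
    using ii jj ji by (simp_all flip: mult.assoc)
  define a where "a = (1/2) *\<^sub>R (q - i * q * i)"
  define b where "b = (1/2) *\<^sub>R (- ((q + i * q * i) * j))"
  have "a \<in> slice i" "b \<in> slice i"
    unfolding slice_iff_commute[OF i] a_def b_def
    by (simp_all add: algebra_simps ii ii' ji ji')
  moreover have "q = a + b * j"
    unfolding a_def b_def by (simp add: algebra_simps jj flip: scaleR_add_left)
  moreover have "a' = a \<and> b' = b" if "a' \<in> slice i" "b' \<in> slice i" "q = a' + b' * j" for a' b'
  proof -
    have com: "a' * i = i * a'" "b' * i = i * b'"
      using that by (simp_all add: slice_iff_commute[OF i])
    have "i * q * i = i * (a' * i) - i * (b' * i) * j"
      using that(3) by (simp add: algebra_simps ji)
    also have "\<dots> = - a' + b' * j"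
      by (simp add: com ii' mult.assoc)
    finally have "i * q * i = - a' + b' * j" .
    then have "q - i * q * i = 2 *\<^sub>R a'" "q + i * q * i = 2 *\<^sub>R (b' * j)"
      using that(3) by (simp_all add: scaleR_2)
    then show ?thesis
      unfolding a_def b_def by (simp add: mult.assoc jj)
  qed
  ultimately have "\<exists>!ab. fst ab \<in> slice i \<and> snd ab \<in> slice i \<and> q = fst ab + snd ab * j"
    by (metis prod.collapse fst_conv snd_conv)
  then show ?thesis
    by (simp only: case_prod_unfold)
qed

definition qimag_dir :: "quat \<Rightarrow> quat" where
  "qimag_dir q = sgn (q - of_real (qre q))"

text \<open>
  With \<open>q = x + I\<^sub>q y\<close> and \<open>y = |q - x| \<ge> 0\<close>. For real \<open>q\<close> the unit \<open>I\<^sub>q\<close> is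
  arbitrary in the formula below, its coefficients cancelling since \<open>y = 0\<close>; here \<open>sgn 0 = 0\<close>.
\<close>

definition slice_extension :: "quat \<Rightarrow> (quat \<Rightarrow> quat) \<Rightarrow> quat \<Rightarrow> quat" where
  "slice_extension i g q =
     (let x = of_real (qre q); y = of_real (norm (q - x)); I = qimag_dir q
      in (1/2) *\<^sub>R ((1 + I * i) * g (x - y * i) + (1 - I * i) * g (x + y * i)))"


section \<open>Slice regular Moebius transformations and composition\<close>

text \<open>
  Slice regular power series have their coefficients on the right, so the product of formal power
  series (which does not commute coefficients) is the slice regular product.
\<close>

definition slice_series :: "quat fps \<Rightarrow> quat \<Rightarrow> quat" where
  "slice_series F q = (\<Sum>n. q ^ n * fps_nth F n)"

definition slice_moebius :: "quat \<Rightarrow> quat \<Rightarrow> quat" where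
  "slice_moebius a = slice_series (Abs_fps (\<lambda>n. qcnj a ^ n) * (fps_const a - fps_X))"

definition moebius_comp :: "quat \<Rightarrow> quat \<Rightarrow> (quat \<Rightarrow> quat) \<Rightarrow> quat \<Rightarrow> quat \<Rightarrow> quat" where
  "moebius_comp i j f a =
     (let f1 = (\<lambda>z. fst (slice_split i j (f z)));
          f2 = (\<lambda>z. snd (slice_split i j (f z)))
      in (\<lambda>q. slice_extension i (f1 \<circ> slice_moebius a) q
             + slice_extension i (f2 \<circ> slice_moebius a) q * j))"


section \<open>The functional rho\<close>

definition ennreal_powr :: "ennreal \<Rightarrow> real \<Rightarrow> ennreal" where
  "ennreal_powr x r = (if x = \<infinity> then \<infinity> else ennreal (enn2real x powr r))"

definition besov_rho :: "real \<Rightarrow> nat \<Rightarrow> quat \<Rightarrow> quat \<Rightarrow> (quat \<Rightarrow> quat) \<Rightarrow> ennreal" where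
  "besov_rho p n i j f =
     (SUP z\<in>slice_ball i. ennreal (norm (f z)))
     + (SUP a\<in>slice_ball i. ennreal_powr
          (slice_lambda_integral i (\<lambda>z. ennreal ((1 - (norm z)\<^sup>2) powr (real n * p)
             * norm ((real_partial ^^ n) (moebius_comp i j f a) z) powr p)))
          (1 / p))"

end

theory Submission
  imports Defs "HOL-Complex_Analysis.Complex_Analysis"
begin

text \<open>
  On the slice of \<open>i\<close> a slice regular \<open>f\<close> is a pair of holomorphic functions on the disc, the real
  partial derivative is the complex derivative of the pair and \<open>f \<circ>\<^sub>i T\<^sub>a\<close> is composition with the
  disc automorphism \<open>\<phi>\<^sub>a(z) = (a - z) / (1 - cnj a z)\<close>. The invariance follows from
  \<open>\<phi>\<^sub>a \<circ> \<phi>\<^sub>b = \<phi>\<^sub>c \<circ> u\<close> with \<open>c = \<phi>\<^sub>a(b)\<close> and a rotation \<open>u\<close>.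

  Finiteness rests on the formula
  \<open>f(z) = T(z) + z\<^sup>m / (m - 1)! \<integral> g(w) (1 - |w|\<^sup>2)\<^bsup>m+1\<^esup> / (1 - cnj w z) d\<lambda>(w)\<close>,
  where \<open>g\<close> is the derivative of \<open>f\<close> of order \<open>m\<close> and \<open>T\<close> its Taylor polynomial of degree less than \<open>m\<close>.
  The atoms \<open>(1 - |w|\<^sup>2) / (1 - cnj w z) = 1 - cnj w \<phi>\<^sub>w(z)\<close> turn under composition with \<open>\<phi>\<^sub>a\<close> into the
  same kind of function for \<open>\<phi>\<^sub>a(w)\<close>, so their Besov seminorms are bounded uniformly in \<open>a\<close> and \<open>w\<close>.
  For \<open>p \<le> 1\<close> and \<open>H\<close> holomorphic, \<open>(\<integral> (1 - |w|\<^sup>2)\<^sup>k |H| d\<lambda>)\<^sup>p\<close> is at most a constant times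
  \<open>\<integral> ((1 - |w|\<^sup>2)\<^sup>k |H|)\<^sup>p d\<lambda>\<close>; the integrand of the formula has, apart from its
  weight, the modulus of a holomorphic function of \<open>w\<close>. This brings the exponent inside the
  integral, and Tonelli's theorem concludes.
\<close>

section \<open>Integration over the unit disc\<close>

text \<open>For n = 1 the quantity (1 - |z|^2) |f'(z)| is conformally invariant, and composition
  with phi_a would be a mere change of variables. But n p > 1 with p <= 1 forces n >= 2, where the
  derivative of the composition mixes derivatives of f of all orders up to n; the reproducing
  formula avoids this by putting the composition on explicit kernels. Its exponents are dictated by
  the moments: the integral of |w|^(2k) (1 - |w|^2)^(m+1) with respect to \<lambda> is k! (m-1)! /
  (k+m)!, exactly the factor that turns the Taylor coefficient f^(k+m)(0) / k! of g into (m-1)!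
  times a Taylor coefficient of f. Of the m + 1 powers of the weight, m go with g, as in the
  seminorm, and one normalises the atom. The order m through which f lies in the space and the order
  n of the functional stay unrelated throughout, so nothing about the choice of the order is
  presupposed.\<close>

abbreviation disc_borel :: "complex measure" where
  "disc_borel \<equiv> restrict_space borel (ball 0 1)"

abbreviation dw :: "complex \<Rightarrow> real" where
  "dw z \<equiv> 1 - (norm z)\<^sup>2"

abbreviation weighted_integral :: "nat \<Rightarrow> (complex \<Rightarrow> complex) \<Rightarrow> ennreal" where
  "weighted_integral k H \<equiv> (\<integral>\<^sup>+z. ennreal (dw z ^ k * norm (H z)) \<partial>disc_lambda)"

abbreviation besov_integral :: "real \<Rightarrow> nat \<Rightarrow> (complex \<Rightarrow> complex) \<Rightarrow> ennreal" where
  "besov_integral p k H \<equiv> (\<integral>\<^sup>+z. ennreal ((dw z ^ k * norm (H z)) powr p) \<partial>disc_lambda)"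

section \<open>Translations, reflections and rotations of Lebesgue measure\<close>

lemma nn_integral_lborel_translation:
  fixes f :: "'a::euclidean_space \<Rightarrow> ennreal"
  assumes [measurable]: "f \<in> borel_measurable borel"
  shows "(\<integral>\<^sup>+x. f (c + x) \<partial>lborel) = (\<integral>\<^sup>+x. f x \<partial>lborel)"
proof -
  have "(\<integral>\<^sup>+x. f x \<partial>lborel) = (\<integral>\<^sup>+x. f x \<partial>distr lborel borel ((+) c))"
    by (simp add: lborel_distr_plus)
  also have "\<dots> = (\<integral>\<^sup>+x. f (c + x) \<partial>lborel)"
    by (subst nn_integral_distr) auto
  finally show ?thesis by simp
qed

lemma nn_integral_lborel_reflection:
  fixes f :: "'a::euclidean_space \<Rightarrow> ennreal"
  assumes [measurable]: "f \<in> borel_measurable borel"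
  shows "(\<integral>\<^sup>+x. f (c - x) \<partial>lborel) = (\<integral>\<^sup>+x. f x \<partial>lborel)"
proof -
  have "lborel = density (distr lborel borel (\<lambda>x::'a. c + (-1) *\<^sub>R x)) (\<lambda>_. ennreal (\<bar>-1\<bar> ^ DIM('a)))"
    by (rule lborel_affine) auto
  also have "(\<lambda>_::'a. ennreal (\<bar>-1\<bar> ^ DIM('a))) = (\<lambda>_. 1)"
    by simp
  finally have "lborel = distr lborel borel (\<lambda>x::'a. c - x)"
    by (simp add: density_1)
  then have "(\<integral>\<^sup>+x. f x \<partial>lborel) = (\<integral>\<^sup>+x. f x \<partial>distr lborel borel (\<lambda>x. c - x))"
    by simp
  also have "\<dots> = (\<integral>\<^sup>+x. f (c - x) \<partial>lborel)"
    by (subst nn_integral_distr) auto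
  finally show ?thesis by simp
qed

text \<open>Both sides are translation invariant in \<open>f\<close>, so the proof compares them on the unit ball,
  as in the uniqueness of Haar measure.\<close>

lemma nn_integral_lborel_rotation:
  fixes f :: "complex \<Rightarrow> ennreal" and u :: complex
  assumes f [measurable]: "f \<in> borel_measurable borel" and u: "norm u = 1"
  shows "(\<integral>\<^sup>+x. f (u * x) \<partial>lborel) = (\<integral>\<^sup>+x. f x \<partial>lborel)"
proof -
  define g :: "complex \<Rightarrow> ennreal" where "g = indicator (ball 0 1)"
  have [measurable]: "g \<in> borel_measurable borel" by (simp add: g_def borel_measurable_indicator)
  have u0: "u \<noteq> 0" using u by auto
  have gu: "g (u * x) = g x" for x
    using u by (simp add: g_def norm_mult indicator_def)
  have "(\<integral>\<^sup>+x. f (u * x) \<partial>lborel) * (\<integral>\<^sup>+y. g y \<partial>lborel)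
      = (\<integral>\<^sup>+x. f (u * x) * (\<integral>\<^sup>+y. g (u * x + y) \<partial>lborel) \<partial>lborel)"
    by (simp add: nn_integral_lborel_translation nn_integral_multc)
  also have "\<dots> = (\<integral>\<^sup>+x. \<integral>\<^sup>+y. f (u * x) * g (u * x + y) \<partial>lborel \<partial>lborel)"
    by (simp add: nn_integral_cmult)
  also have "\<dots> = (\<integral>\<^sup>+y. \<integral>\<^sup>+x. f (u * x) * g (u * x + y) \<partial>lborel \<partial>lborel)"
    by (rule lborel_pair.Fubini') simp
  also have "\<dots> = (\<integral>\<^sup>+y. \<integral>\<^sup>+x. f (u * x - y) * g (u * x) \<partial>lborel \<partial>lborel)"
  proof (rule nn_integral_cong)
    \<comment> \<open>The substitution x -> x - y / u moves the shift by y from \<open>g\<close> to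
      \<open>f\<close>. What remains of \<open>g\<close> is rotation invariant, and the shift in
      \<open>f\<close> disappears by reflection.\<close>
    fix y
    show "(\<integral>\<^sup>+x. f (u * x) * g (u * x + y) \<partial>lborel) = (\<integral>\<^sup>+x. f (u * x - y) * g (u * x) \<partial>lborel)"
      using nn_integral_lborel_translation[of "\<lambda>x. f (u * x) * g (u * x + y)" "- y / u"] u0
      by (simp add: ring_distribs)
  qed
  also have "\<dots> = (\<integral>\<^sup>+x. \<integral>\<^sup>+y. f (u * x - y) * g (u * x) \<partial>lborel \<partial>lborel)"
    by (rule lborel_pair.Fubini') simp
  also have "\<dots> = (\<integral>\<^sup>+x. f x \<partial>lborel) * (\<integral>\<^sup>+x. g x \<partial>lborel)"
    by (simp add: nn_integral_multc nn_integral_cmult gu nn_integral_lborel_reflection)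
  finally have eq: "(\<integral>\<^sup>+x. f (u * x) \<partial>lborel) * (\<integral>\<^sup>+x. g x \<partial>lborel)
      = (\<integral>\<^sup>+x. f x \<partial>lborel) * (\<integral>\<^sup>+x. g x \<partial>lborel)" .
  have g: "(\<integral>\<^sup>+x. g x \<partial>lborel) = ennreal pi"
    by (simp add: g_def emeasure_ball unit_ball_vol_2)
  \<comment> \<open>Cancelling is legitimate because the area pi of the unit disc is neither 0 nor
    infinite.\<close>
  show ?thesis
    using eq unfolding g
    by (metis ennreal_mult_cancel_left ennreal_neq_top ennreal_eq_0_iff mult.commute not_le pi_gt_zero)
qed

section \<open>The normalised area and the measure \<lambda> on the disc\<close>

lemma space_disc [simp]: "space disc_area = ball 0 1" "space disc_lambda = ball 0 1"
  by (simp_all add: disc_area_def disc_lambda_def space_restrict_space)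

lemma sets_disc [simp, measurable_cong]:
  "sets disc_area = sets (disc_borel)"
  "sets disc_lambda = sets (disc_borel)"
  by (simp_all add: disc_area_def disc_lambda_def cong: sets_restrict_space_cong)

lemma measurable_disc [simp]:
  "measurable disc_area N = measurable (disc_borel) N"
  "measurable disc_lambda N = measurable (disc_borel) N"
  by (auto intro!: measurable_cong_sets)

lemma measurable_disc_indicator:
  fixes f :: "complex \<Rightarrow> ennreal"
  assumes "f \<in> borel_measurable (disc_borel)"
  shows "(\<lambda>z. f z * indicator (ball 0 1) z) \<in> borel_measurable borel"
  using assms by (subst (asm) borel_measurable_restrict_space_iff_ennreal) auto

lemma measurable_ennreal_times_indicator:
  fixes f :: "complex \<Rightarrow> real"
  assumes "A \<in> sets borel" "f \<in> borel_measurable (restrict_space borel A)"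
  shows "(\<lambda>z. ennreal (f z) * indicator A z) \<in> borel_measurable borel"
  using measurable_compose[OF assms(2) measurable_ennreal] assms(1)
  by (subst (asm) borel_measurable_restrict_space_iff_ennreal) auto

lemma borel_measurable_discI:
  "f \<in> borel_measurable borel \<Longrightarrow> f \<in> borel_measurable (disc_borel)"
  by (rule measurable_restrict_space1)

lemma nn_integral_disc_area:
  assumes f: "f \<in> borel_measurable (disc_borel)"
  shows "(\<integral>\<^sup>+z. f z \<partial>disc_area)
    = (\<integral>\<^sup>+z. ennreal (1 / pi) * (f z * indicator (ball 0 1) z) \<partial>lborel)"
proof -
  have f': "f \<in> borel_measurable (restrict_space lborel (ball 0 1))"
    using f by (simp cong: measurable_cong_sets sets_restrict_space_cong)
  show ?thesis
    using f' measurable_disc_indicator[OF f] unfolding disc_area_def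
    by (subst nn_integral_density)
      (auto simp: nn_integral_restrict_space mult.assoc intro!: nn_integral_cong)
qed

lemma nn_integral_disc_lambda:
  assumes f: "f \<in> borel_measurable (disc_borel)"
  shows "(\<integral>\<^sup>+z. f z \<partial>disc_lambda)
    = (\<integral>\<^sup>+z. ennreal (1 / (dw z)\<^sup>2) * f z \<partial>disc_area)"
  using f unfolding disc_lambda_def
  by (subst nn_integral_density)
    (auto intro!: borel_measurable_discI)

lemma measurable_disc_rotation:
  assumes f: "f \<in> borel_measurable (disc_borel)" and u: "norm (u :: complex) = 1"
  shows "(\<lambda>z. f (u * z)) \<in> borel_measurable (disc_borel)"
  by (rule measurable_compose[OF _ f], rule measurable_restrict_space3) (use u in \<open>auto simp: norm_mult\<close>)

lemma nn_integral_disc_area_rotation: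
  assumes f: "f \<in> borel_measurable (disc_borel)" and u: "norm u = 1"
  shows "(\<integral>\<^sup>+z. f (u * z) \<partial>disc_area) = (\<integral>\<^sup>+z. f z \<partial>disc_area)"
proof -
  define F where "F = (\<lambda>z. ennreal (1 / pi) * (f z * indicator (ball 0 1) z))"
  have F: "F \<in> borel_measurable borel"
    unfolding F_def using measurable_disc_indicator[OF f] by simp
  have ind: "indicator (ball 0 1) (u * z) = (indicator (ball 0 1) z :: ennreal)" for z
    using u by (simp add: norm_mult indicator_def)
  have "(\<integral>\<^sup>+z. f (u * z) \<partial>disc_area) = (\<integral>\<^sup>+z. F (u * z) \<partial>lborel)"
    by (simp add: nn_integral_disc_area measurable_disc_rotation[OF f u] F_def ind)
  also have "\<dots> = (\<integral>\<^sup>+z. F z \<partial>lborel)"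
    using F u by (rule nn_integral_lborel_rotation)
  finally show ?thesis
    using f by (simp add: nn_integral_disc_area F_def)
qed

lemma nn_integral_disc_lambda_rotation:
  assumes f: "f \<in> borel_measurable (disc_borel)" and u: "norm u = 1"
  shows "(\<integral>\<^sup>+z. f (u * z) \<partial>disc_lambda) = (\<integral>\<^sup>+z. f z \<partial>disc_lambda)"
proof -
  define F where "F = (\<lambda>z. ennreal (1 / (dw z)\<^sup>2) * f z)"
  have F: "F \<in> borel_measurable (disc_borel)"
    unfolding F_def by (intro borel_measurable_times_ennreal f borel_measurable_discI) simp
  have "(\<integral>\<^sup>+z. f (u * z) \<partial>disc_lambda) = (\<integral>\<^sup>+z. F (u * z) \<partial>disc_area)"
    using u by (simp add: nn_integral_disc_lambda measurable_disc_rotation[OF f u] F_def norm_mult)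
  also have "\<dots> = (\<integral>\<^sup>+z. F z \<partial>disc_area)"
    by (rule nn_integral_disc_area_rotation[OF F u])
  finally show ?thesis
    using f by (simp add: nn_integral_disc_lambda F_def)
qed

lemma emeasure_disc_area:
  assumes "A \<in> sets borel"
  shows "emeasure disc_area (A \<inter> ball 0 1) = emeasure lborel (A \<inter> ball 0 1) / ennreal pi"
proof -
  have s: "A \<inter> ball 0 1 \<in> sets disc_area"
    using assms by (auto simp: sets_restrict_space)
  have "emeasure disc_area (A \<inter> ball 0 1) = (\<integral>\<^sup>+z. indicator (A \<inter> ball 0 1) z \<partial>disc_area)"
    using s by simp
  also have "\<dots> = (\<integral>\<^sup>+z. ennreal (1 / pi) * indicator (A \<inter> ball 0 1) z \<partial>lborel)"
    using assms s by (subst nn_integral_disc_area)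
      (auto intro!: borel_measurable_discI borel_measurable_indicator nn_integral_cong
        split: split_indicator)
  also have "\<dots> = ennreal (1 / pi) * emeasure lborel (A \<inter> ball 0 1)"
    using assms by (subst nn_integral_cmult_indicator) auto
  finally show ?thesis
    by (simp add: divide_ennreal_def inverse_ennreal divide_inverse mult.commute)
qed

text \<open>The area of the disc of radius \<open>\<surd>t\<close> is proportional to \<open>t\<close>.\<close>

lemma nn_integral_disc_area_radial:
  fixes h :: "real \<Rightarrow> ennreal"
  assumes h [measurable]: "h \<in> borel_measurable borel"
  shows "(\<integral>\<^sup>+z. h ((norm z)\<^sup>2) \<partial>disc_area) = (\<integral>\<^sup>+t. h t * indicator {0..<1} t \<partial>lborel)"
proof -
  define M where "M = distr disc_area borel (\<lambda>z::complex. (norm z)\<^sup>2)"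
  define N where "N = density lborel (indicator {0..<1::real} :: real \<Rightarrow> ennreal)"
  have meas [measurable]: "(\<lambda>z::complex. (norm z)\<^sup>2) \<in> disc_area \<rightarrow>\<^sub>M borel"
    by (simp, intro borel_measurable_discI) simp
  \<comment> \<open>For x < 0 the minimum is 1, and for x > 1 the negative value 1 - x is truncated
    to 0 by \<open>ennreal\<close>, so one formula describes every half line.\<close>
  have M: "emeasure M {x<..} = ennreal (min 1 (1 - x)) " for x
  proof -
    have "emeasure M {x<..} = emeasure disc_area ({z. x < (norm z)\<^sup>2} \<inter> ball 0 1)"
      unfolding M_def by (subst emeasure_distr) (auto intro!: arg_cong[of _ _ "emeasure _"])
    also have "\<dots> = emeasure lborel ({z::complex. x < (norm z)\<^sup>2} \<inter> ball 0 1) / ennreal pi"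
      by (rule emeasure_disc_area) simp
    also have "emeasure lborel ({z::complex. x < (norm z)\<^sup>2} \<inter> ball 0 1) = ennreal (pi * min 1 (1 - x))"
    proof -
      consider "x < 0" | "0 \<le> x" "x < 1" | "1 \<le> x" by linarith
      then show ?thesis
      proof cases
        case 1
        then have "{z::complex. x < (norm z)\<^sup>2} \<inter> ball 0 1 = ball 0 1"
          by (auto intro: less_le_trans)
        then show ?thesis
          using 1 by (simp add: emeasure_ball unit_ball_vol_2 min_def)
      next
        case 2
        have "{z::complex. x < (norm z)\<^sup>2} = - cball 0 (sqrt x)"
          by (auto simp: not_le real_less_lsqrt real_sqrt_less_iff dest: real_less_rsqrt)
             (metis norm_ge_zero not_le real_le_rsqrt real_sqrt_abs abs_norm_cancel real_sqrt_le_iff)+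
        then have "{z::complex. x < (norm z)\<^sup>2} \<inter> ball 0 1 = ball 0 1 - cball 0 (sqrt x)"
          by auto
        moreover have "emeasure lborel (ball 0 1 - cball (0::complex) (sqrt x)) = ennreal pi - ennreal (pi * x)"
          using 2 by (subst emeasure_Diff)
            (auto simp: emeasure_ball emeasure_cball unit_ball_vol_2 subset_iff real_less_lsqrt
              intro: le_less_trans[of _ "sqrt x"])
        ultimately show ?thesis
          using 2 by (simp add: ennreal_minus algebra_simps)
      next
        case 3
        have "(norm z)\<^sup>2 < 1" if "norm z < 1" for z :: complex
          using that by (simp add: abs_square_less_1)
        then have "{z::complex. x < (norm z)\<^sup>2} \<inter> ball 0 1 = {}"
          using 3 by force
        then show ?thesis
          using 3 by (simp add: ennreal_neg mult_nonneg_nonpos)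
      qed
    qed
    also have "ennreal (pi * min 1 (1 - x)) / ennreal pi = ennreal (min 1 (1 - x))"
    proof (cases "x \<le> 1")
      case True
      then show ?thesis by (subst divide_ennreal) auto
    next
      case False
      then show ?thesis by (simp add: ennreal_neg mult_nonneg_nonpos)
    qed
    finally show ?thesis .
  qed
  have N: "emeasure N {x<..} = ennreal (min 1 (1 - x))" for x
  proof -
    have "emeasure N {x<..} = emeasure lborel ({0..<1} \<inter> {x<..})"
      unfolding N_def by (subst emeasure_density) (auto simp: indicator_inter_arith[symmetric])
    also have "{0..<1} \<inter> {x<..} = (if x < 0 then {0..<1} else {x<..<1})"
      by auto
    finally show ?thesis
      by (cases "x \<le> 1") (auto simp: min_def ennreal_neg)
  qed
  have "M = N"
  proof (rule measure_eqI_lessThan)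
    show "sets M = sets borel" "sets N = sets borel"
      by (simp_all add: M_def N_def)
  qed (simp_all add: M N)
  then have "(\<integral>\<^sup>+t. h t \<partial>M) = (\<integral>\<^sup>+t. h t \<partial>N)" by simp
  then show ?thesis
    unfolding M_def N_def by (simp add: nn_integral_distr nn_integral_density mult.commute)
qed

section \<open>Mean values\<close>

text \<open>Passes from nonnegative integrals to an equality of measures, which also covers
  complex-valued Bochner integrals.\<close>

lemma distr_lborel_rotation:
  assumes u: "norm (u::complex) = 1"
  shows "distr lborel borel ((*) u) = lborel"
proof (rule measure_eqI)
  fix A assume "A \<in> sets (distr lborel borel ((*) u))"
  then have A: "A \<in> sets borel" by simp
  have "emeasure (distr lborel borel ((*) u)) A = (\<integral>\<^sup>+x. indicator A x \<partial>distr lborel borel ((*) u))"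
    using A by simp
  also have "\<dots> = (\<integral>\<^sup>+x. indicator A (u * x) \<partial>lborel)"
    using A by (subst nn_integral_distr) auto
  also have "\<dots> = (\<integral>\<^sup>+x. indicator A x \<partial>lborel)"
    using A u by (intro nn_integral_lborel_rotation) auto
  finally show "emeasure (distr lborel borel ((*) u)) A = emeasure lborel A"
    using A by simp
qed simp

lemma integral_lborel_rotation:
  fixes f :: "complex \<Rightarrow> complex"
  assumes "f \<in> borel_measurable borel" and u: "norm u = 1"
  shows "(\<integral>x. f (u * x) \<partial>lborel) = (\<integral>x. f x \<partial>lborel)"
proof -
  have "(\<integral>x. f x \<partial>lborel) = (\<integral>x. f x \<partial>distr lborel borel ((*) u))"
    by (simp add: distr_lborel_rotation[OF u])
  also have "\<dots> = (\<integral>x. f (u * x) \<partial>lborel)"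
    using assms by (subst integral_distr) auto
  finally show ?thesis by simp
qed

lemma integrable_bounded_ball:
  fixes f :: "complex \<Rightarrow> complex"
  assumes [measurable]: "f \<in> borel_measurable borel"
    and B: "\<And>w. norm w < R \<Longrightarrow> norm (f w) \<le> B" and 0: "\<And>w. norm w \<ge> R \<Longrightarrow> f w = 0"
  shows "integrable lborel f"
proof (rule Bochner_Integration.integrable_bound)
  show "integrable lborel (\<lambda>w::complex. B * indicator (ball 0 R) w :: real)"
    using emeasure_bounded_finite[of "ball (0::complex) R"]
    by (intro integrable_mult_right integrable_real_indicator) auto
  show "AE w in lborel. norm (f w) \<le> norm (B * indicator (ball 0 R) w)"
  proof (rule AE_I2)
    fix w
    show "norm (f w) \<le> norm (B * indicator (ball 0 R) w)"
      using B[of w] 0[of w] by (cases "norm w < R") (auto simp: indicator_def)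
  qed
qed simp

text \<open>Rotation by \<open>u\<close> multiplies the integrand by u^n (cnj u)^k, which is -1 for
  the angle pi / (n - k); the integral equals its own negative. This orthogonality replaces
  integration in polar coordinates.\<close>

lemma radial_monomial_integral:
  fixes h :: "real \<Rightarrow> real"
  assumes [measurable]: "h \<in> borel_measurable borel" and "n \<noteq> k"
  shows "(\<integral>w. w ^ n * cnj w ^ k * of_real (h (norm w)) \<partial>lborel) = 0"
proof -
  define f where "f = (\<lambda>w. w ^ n * cnj w ^ k * of_real (h (norm w)) :: complex)"
  define t where "t = pi / (real n - real k)"
  define u where "u = cis t"
  have [measurable]: "cnj \<in> borel_measurable borel"
    by (intro borel_measurable_continuous_onI continuous_intros)
  have meas: "f \<in> borel_measurable borel"
    unfolding f_def by measurable
  have u: "norm u = 1" by (simp add: u_def)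
  have "u ^ n * cnj u ^ k = cis (real n * t - real k * t)"
    unfolding u_def cis_cnj Complex.DeMoivre cis_mult by simp
  also have "real n * t - real k * t = pi"
    using \<open>n \<noteq> k\<close> by (simp add: t_def divide_simps flip: left_diff_distrib)
  finally have eq: "u ^ n * cnj u ^ k = - 1" by simp
  have "(\<integral>w. f w \<partial>lborel) = (\<integral>w. f (u * w) \<partial>lborel)"
    using meas u by (simp add: integral_lborel_rotation)
  also have "(\<lambda>w. f (u * w)) = (\<lambda>w. (u ^ n * cnj u ^ k) * f w)"
    using u by (auto simp: f_def norm_mult power_mult_distrib)
  also have "(\<integral>w. (u ^ n * cnj u ^ k) * f w \<partial>lborel) = - (\<integral>w. f w \<partial>lborel)"
    by (simp add: eq)
  finally show ?thesis by (simp add: f_def)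
qed

text \<open>Expanding \<open>G\<close> in powers of w, orthogonality leaves only the term of order
  k. The cutoff \<open>h\<close> confines the integral to radius R < r, where the series converges
  absolutely and uniformly, so that sum and integral may be interchanged.\<close>

lemma radial_moment_integral:
  fixes h :: "real \<Rightarrow> real"
  assumes G: "G holomorphic_on ball 0 r" and R: "0 < R" "R < r"
    and h [measurable]: "h \<in> borel_measurable borel"
    and B: "\<And>t. \<bar>h t\<bar> \<le> B" and h0: "\<And>t. t \<ge> R \<Longrightarrow> h t = 0"
  shows "(\<integral>w. G w * cnj w ^ k * of_real (h (norm w)) \<partial>lborel)
    = (deriv ^^ k) G 0 / fact k * of_real (integral\<^sup>L lborel (\<lambda>w::complex. norm w ^ (2 * k) * h (norm w)))"
proof -
  define c where "c n = (deriv ^^ n) G 0 / fact n" for n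
  define f where "f n w = c n * (w ^ n * cnj w ^ k * of_real (h (norm w)))" for n w
  have B0: "0 \<le> B" using B[of 0] by linarith
  have [measurable]: "cnj \<in> borel_measurable borel"
    by (intro borel_measurable_continuous_onI continuous_intros)
  have G_sums: "(\<lambda>n. c n * w ^ n) sums G w" if "norm w < r" for w
    using holomorphic_power_series[OF G, of w] that by (simp add: c_def)
  \<comment> \<open>The midpoint of R and r is still inside the disc of convergence; convergence
    there gives absolute convergence at radius R.\<close>
  have rho: "norm (of_real ((R + r) / 2) :: complex) = (R + r) / 2"
    using R unfolding norm_of_real by simp
  have sm: "summable (\<lambda>n. norm (c n * of_real R ^ n))"
  proof (rule powser_insidea)
    show "summable (\<lambda>n. c n * of_real ((R + r) / 2) ^ n)"
      using G_sums[of "of_real ((R + r) / 2)"] R rho by (auto dest: sums_summable)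
    show "norm (of_real R :: complex) < norm (of_real ((R + r) / 2) :: complex)"
      using R unfolding rho by simp
  qed
  have bound: "norm (f n w) \<le> norm (c n * of_real R ^ n) * R ^ k * B * indicator (ball 0 R) w" for n w
  proof (cases "norm w < R")
    case True
    have "norm (f n w) = norm (c n) * norm w ^ n * norm w ^ k * \<bar>h (norm w)\<bar>"
      by (simp add: f_def norm_mult norm_power)
    also have "\<dots> \<le> norm (c n) * R ^ n * R ^ k * B"
      using True B R B0 by (intro mult_mono power_mono mult_nonneg_nonneg) auto
    finally show ?thesis using R True by (simp add: norm_mult norm_power)
  next
    case False
    then show ?thesis using h0[of "norm w"] by (simp add: f_def)
  qed
  have int_f: "integrable lborel (f n)" for n
  proof (rule integrable_bounded_ball)
    show "f n \<in> borel_measurable borel" unfolding f_def by measurable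
    fix w :: complex
    assume "norm w < R"
    then show "norm (f n w) \<le> norm (c n * of_real R ^ n) * R ^ k * B"
      using bound[of n w] by simp
  next
    fix w :: complex
    assume "norm w \<ge> R"
    then show "f n w = 0" using h0[of "norm w"] by (simp add: f_def)
  qed
  have fin: "emeasure lborel (ball (0::complex) R) < \<infinity>"
    by (rule emeasure_bounded_finite) auto
  have "summable (\<lambda>n. \<integral>w. norm (f n w) \<partial>lborel)"
  proof (rule summable_comparison_test_ev)
    show "summable (\<lambda>n. norm (c n * of_real R ^ n) * (R ^ k * B * measure lborel (ball (0::complex) R)))"
      by (intro summable_mult2 sm)
    have le: "(\<integral>w. norm (f n w) \<partial>lborel)
        \<le> (\<integral>w. norm (c n * of_real R ^ n) * R ^ k * B * indicator (ball (0::complex) R) w \<partial>lborel)" for n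
      by (rule integral_mono)
        (use fin bound in \<open>auto intro!: integrable_norm int_f integrable_mult_right\<close>)
    have "norm (\<integral>w. norm (f n w) \<partial>lborel)
        \<le> norm (c n * of_real R ^ n) * (R ^ k * B * measure lborel (ball (0::complex) R))" for n
    proof -
      have "norm (\<integral>w. norm (f n w) \<partial>lborel) = (\<integral>w. norm (f n w) \<partial>lborel)"
        by (simp del: integral_norm_bound)
      also note le
      also have "(\<integral>w. norm (c n * of_real R ^ n) * R ^ k * B * indicator (ball (0::complex) R) w \<partial>lborel)
        = norm (c n * of_real R ^ n) * R ^ k * B * (\<integral>w. indicator (ball (0::complex) R) w \<partial>lborel)"
        by (rule integral_mult_right_zero)
      also have "(\<integral>w. indicator (ball (0::complex) R) w \<partial>lborel) = measure lborel (ball (0::complex) R)"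
        by simp
      finally show ?thesis by (simp only: mult.assoc)
    qed
    then show "\<forall>\<^sub>F n in sequentially. norm (\<integral>w. norm (f n w) \<partial>lborel)
        \<le> norm (c n * of_real R ^ n) * (R ^ k * B * measure lborel (ball (0::complex) R))"
      by simp
  qed
  moreover have "AE w in lborel. summable (\<lambda>n. norm (f n w))"
  proof (rule AE_I2)
    fix w
    show "summable (\<lambda>n. norm (f n w))"
    proof (rule summable_comparison_test')
      show "summable (\<lambda>n. norm (c n * of_real R ^ n) * R ^ k * B * indicator (ball 0 R) w)"
        by (intro summable_mult2 sm)
      show "norm (norm (f n w)) \<le> norm (c n * of_real R ^ n) * R ^ k * B * indicator (ball 0 R) w" for n
        using bound[of n w] by (simp only: real_norm_def abs_norm_cancel)
    qed
  qed
  ultimately have s1: "(\<lambda>n. \<integral>w. f n w \<partial>lborel) sums (\<integral>w. (\<Sum>n. f n w) \<partial>lborel)"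
    using int_f by (intro sums_integral)
  have Gf: "(\<Sum>n. f n w) = G w * cnj w ^ k * of_real (h (norm w))" for w
  proof (cases "norm w < R")
    case True
    then have "(\<lambda>n. c n * w ^ n * (cnj w ^ k * of_real (h (norm w))))
        sums (G w * (cnj w ^ k * of_real (h (norm w))))"
      using R by (intro sums_mult2 G_sums) auto
    then show ?thesis by (simp add: f_def sums_iff mult.assoc)
  next
    case False
    then show ?thesis using h0[of "norm w"] by (simp add: f_def)
  qed
  have "(\<integral>w. f n w \<partial>lborel) = 0" if "n \<noteq> k" for n
    using radial_monomial_integral[OF h that] by (simp add: f_def)
  then have s2: "(\<lambda>n. \<integral>w. f n w \<partial>lborel) sums (\<integral>w. f k w \<partial>lborel)"
    using sums_finite[of "{k}" "\<lambda>n. \<integral>w. f n w \<partial>lborel"] by simp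
  have "w ^ k * cnj w ^ k = of_real (norm w ^ (2 * k))" for w
    by (metis complex_norm_square of_real_power power_mult power_mult_distrib)
  then have "f k w = c k * of_real (norm w ^ (2 * k) * h (norm w))" for w
    by (simp add: f_def)
  then have "(\<integral>w. f k w \<partial>lborel) = c k * of_real (integral\<^sup>L lborel (\<lambda>w::complex. norm w ^ (2 * k) * h (norm w)))"
    by (simp del: of_real_mult of_real_power)
  with sums_unique2[OF s1 s2] show ?thesis
    by (simp only: Gf c_def)
qed

text \<open>The case k = 0 of the moment formula, with \<open>h\<close> the indicator of t < s, is
  the area mean value property on the disc of radius s around w.\<close>

lemma norm_le_area_integral:
  assumes H: "H holomorphic_on ball w r" and s: "0 < s" "s < r"
  shows "ennreal (norm (H w) * (pi * s\<^sup>2)) \<le> (\<integral>\<^sup>+z. ennreal (norm (H z)) * indicator (ball w s) z \<partial>lborel)"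
proof -
  define G where "G z = H (w + z)" for z
  define h :: "real \<Rightarrow> real" where "h = indicator {..<s}"
  have G: "G holomorphic_on ball 0 r"
    unfolding G_def using H
    by (intro holomorphic_on_compose_gen[of "\<lambda>z. w + z" _ H "ball w r", unfolded o_def])
       (auto intro!: holomorphic_intros simp: dist_norm)
  have "(\<integral>z. G z * cnj z ^ 0 * of_real (h (norm z)) \<partial>lborel)
    = (deriv ^^ 0) G 0 / fact 0 * of_real (integral\<^sup>L lborel (\<lambda>z::complex. norm z ^ (2 * 0) * h (norm z)))"
    by (rule radial_moment_integral[OF G s, of h 1]) (auto simp: h_def indicator_def)
  moreover have "integral\<^sup>L lborel (\<lambda>z::complex. h (norm z)) = pi * s\<^sup>2"
  proof -
    have "(\<lambda>z::complex. h (norm z)) = indicator (ball 0 s)"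
      by (auto simp: h_def indicator_def)
    then show ?thesis using s by (simp add: content_ball unit_ball_vol_2)
  qed
  ultimately have eq: "(\<integral>z. G z * of_real (h (norm z)) \<partial>lborel) = H w * of_real (pi * s\<^sup>2)"
    by (simp add: G_def)
  have "ennreal (norm (H w) * (pi * s\<^sup>2)) = ennreal (norm (\<integral>z. G z * of_real (h (norm z)) \<partial>lborel))"
    unfolding eq by (simp add: norm_mult norm_power)
  \<comment> \<open>A non-integrable function has Bochner integral 0, which makes the bound trivial
    in that case.\<close>
  also have "\<dots> \<le> (\<integral>\<^sup>+z. ennreal (norm (G z * of_real (h (norm z)))) \<partial>lborel)"
    by (cases "integrable lborel (\<lambda>z. G z * of_real (h (norm z)))")
      (auto intro: integral_norm_bound_ennreal simp: not_integrable_integral_eq)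
  also have "\<dots> = (\<integral>\<^sup>+z. ennreal (norm (H (w + z))) * indicator (ball w s) (w + z) \<partial>lborel)"
    by (intro nn_integral_cong) (auto simp: G_def h_def norm_mult indicator_def dist_norm)
  also have "\<dots> = (\<integral>\<^sup>+z. ennreal (norm (H z)) * indicator (ball w s) z \<partial>lborel)"
  proof (rule nn_integral_lborel_translation)
    have "continuous_on (ball w s) (\<lambda>z. norm (H z))"
      using s by (intro continuous_on_norm holomorphic_on_imp_continuous_on holomorphic_on_subset[OF H]) auto
    then show "(\<lambda>z. ennreal (norm (H z)) * indicator (ball w s) z) \<in> borel_measurable borel"
      by (intro measurable_ennreal_times_indicator borel_measurable_continuous_on_restrict) auto
  qed
  finally show ?thesis .
qed

section \<open>Sub-mean value estimates for exponents below one\<close>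

text \<open>For \<open>p < 1\<close> the mean value inequality for \<open>|H|\<close> is applied at a maximum point of
  \<open>(r - |z - w|)\<^bsup>2/p\<^esup> |H z|\<close>, around which \<open>|H|\<close> is controlled by its value at that point.\<close>

lemma powr_norm_le_area_integral:
  assumes p: "0 < p" "p \<le> 1" and S: "open S" and H: "H holomorphic_on S"
    and r: "0 < r" and sub: "cball w r \<subseteq> S"
  shows "ennreal (r\<^sup>2 * norm (H w) powr p) \<le> ennreal (16 / pi * 2 powr (2 * (1 - p) / p))
    * (\<integral>\<^sup>+z. ennreal (norm (H z) powr p) * indicator (ball w r) z \<partial>lborel)"
proof -
  \<comment> \<open>The exponent 2/p is chosen so that the p-th power of the first factor is the
    square of the distance to the circle, which matches the area of a disc around the maximum
    point.\<close>
  define u where "u z = (r - dist w z) powr (2 / p) * norm (H z)" for z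
  have contH: "continuous_on (cball w r) H"
    using holomorphic_on_imp_continuous_on[OF H] sub continuous_on_subset by blast
  have "continuous_on (cball w r) u"
    unfolding u_def using p by (intro continuous_intros continuous_on_powr' contH) auto
  then obtain z0 where z0: "z0 \<in> cball w r" and max: "\<And>z. z \<in> cball w r \<Longrightarrow> u z \<le> u z0"
    using continuous_attains_sup[of "cball w r" u] r by auto
  define d where "d = r - dist w z0"
  define M where "M = norm (H z0)"
  have uw: "r powr (2 / p) * norm (H w) \<le> d powr (2 / p) * M"
    using max[of w] r by (simp add: u_def d_def M_def)
  have "(r powr (2 / p) * norm (H w)) powr p \<le> (d powr (2 / p) * M) powr p"
    using uw p by (intro powr_mono2) auto
  then have key: "r\<^sup>2 * norm (H w) powr p \<le> d\<^sup>2 * M powr p"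
    using p r z0 by (simp add: powr_mult powr_powr powr_numeral d_def M_def)
  show ?thesis
  proof (cases "d * M = 0")
    case True
    then have "r\<^sup>2 * norm (H w) powr p \<le> 0" using key p by auto
    then show ?thesis by (simp add: ennreal_neg)
  next
    case False
    then have d: "d > 0" and M: "M > 0" using z0 by (auto simp: d_def M_def)
    \<comment> \<open>On the disc of radius d/4 around \<open>z0\<close> the factor r - |z - w| is
      at least d/2, so maximality gives |H| <= (d / (d/2))^(2/p) M = K there.\<close>
    define K where "K = M * 2 powr (2 / p)"
    have K: "K > 0" using M by (simp add: K_def)
    have HK: "norm (H z) \<le> norm (H z) powr p * K powr (1 - p)"
      and near: "z \<in> ball w r" if z: "z \<in> ball z0 (d / 4)" for z
    proof -
      have tri: "dist w z \<le> dist w z0 + dist z0 z" by (rule dist_triangle)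
      then have dz: "r - dist w z \<ge> d / 2" using z d by (simp add: d_def)
      then show "z \<in> ball w r" using d by simp
      then have "(d / 2) powr (2 / p) * norm (H z) \<le> (r - dist w z) powr (2 / p) * norm (H z)"
        using dz d p by (intro mult_right_mono powr_mono2) auto
      also have "\<dots> \<le> d powr (2 / p) * M"
        using max[of z] \<open>z \<in> ball w r\<close> by (simp add: u_def d_def M_def)
      finally have le: "norm (H z) \<le> K"
        using d by (simp add: powr_divide K_def field_simps)
      show "norm (H z) \<le> norm (H z) powr p * K powr (1 - p)"
      proof (cases "H z = 0")
        case False
        have "norm (H z) = norm (H z) powr p * norm (H z) powr (1 - p)"
          using False by (simp flip: powr_add)
        also have "\<dots> \<le> norm (H z) powr p * K powr (1 - p)"
          using p le by (intro mult_left_mono powr_mono2) auto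
        finally show ?thesis .
      qed simp
    qed
    define I where "I = (\<integral>\<^sup>+z. ennreal (norm (H z) powr p) * indicator (ball w r) z \<partial>lborel)"
    have meas: "(\<lambda>z. ennreal (norm (H z) powr p) * indicator (ball w r) z) \<in> borel_measurable borel"
    proof -
      have "(\<lambda>z. norm (H z)) \<in> borel_measurable (restrict_space borel (ball w r))"
        using continuous_on_subset[OF contH, of "ball w r"]
        by (intro borel_measurable_continuous_on_restrict continuous_intros) auto
      then show ?thesis
        by (intro measurable_ennreal_times_indicator) auto
    qed
    have holo: "H holomorphic_on ball z0 d"
    proof (rule holomorphic_on_subset[OF H])
      have "ball z0 d \<subseteq> cball w r"
      proof
        fix z assume "z \<in> ball z0 d"
        then show "z \<in> cball w r" using dist_triangle[of w z z0] by (simp add: d_def)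
      qed
      then show "ball z0 d \<subseteq> S" using sub by blast
    qed
    have "ennreal (M * (pi * (d / 4)\<^sup>2))
        \<le> (\<integral>\<^sup>+z. ennreal (norm (H z)) * indicator (ball z0 (d / 4)) z \<partial>lborel)"
      unfolding M_def using d by (intro norm_le_area_integral[OF holo]) auto
    also have "\<dots> \<le> (\<integral>\<^sup>+z. ennreal (K powr (1 - p)) *
        (ennreal (norm (H z) powr p) * indicator (ball w r) z) \<partial>lborel)"
    proof (rule nn_integral_mono)
      fix z
      show "ennreal (norm (H z)) * indicator (ball z0 (d / 4)) z \<le> ennreal (K powr (1 - p)) *
        (ennreal (norm (H z) powr p) * indicator (ball w r) z)"
      proof (cases "z \<in> ball z0 (d / 4)")
        case True
        then show ?thesis using HK[OF True] near[OF True]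
          by (simp add: ennreal_mult'[symmetric] mult.commute ennreal_leI)
      qed simp
    qed
    also have "\<dots> = ennreal (K powr (1 - p)) * I"
      unfolding I_def using meas by (intro nn_integral_cmult) simp
    finally have "ennreal (M * (pi * (d / 4)\<^sup>2)) \<le> ennreal (K powr (1 - p)) * I" .
    \<comment> \<open>Multiplication by 16 / (pi M^(1-p)) turns the left side into d^2 M^p, and
      M^(1-p) cancels against K^(1-p), leaving a constant that depends on p only.\<close>
    then have "ennreal (16 / pi / M powr (1 - p)) * ennreal (M * (pi * (d / 4)\<^sup>2))
        \<le> ennreal (16 / pi / M powr (1 - p)) * (ennreal (K powr (1 - p)) * I)"
      by (intro mult_left_mono) auto
    moreover have "16 / pi / M powr (1 - p) * (M * (pi * (d / 4)\<^sup>2)) = d\<^sup>2 * M powr p"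
    proof -
      have "M = M powr (1 - p) * M powr p" using M by (simp flip: powr_add)
      then show ?thesis using M by (simp add: field_simps power2_eq_square)
    qed
    moreover have "16 / pi / M powr (1 - p) * K powr (1 - p) = 16 / pi * 2 powr (2 * (1 - p) / p)"
      using M by (simp add: K_def powr_mult powr_powr)
    ultimately have "ennreal (d\<^sup>2 * M powr p) \<le> ennreal (16 / pi * 2 powr (2 * (1 - p) / p)) * I"
      using M by (simp flip: ennreal_mult' mult.assoc)
    then show ?thesis
      unfolding I_def[symmetric] using key by (meson ennreal_leI order_trans)
  qed
qed

lemma holomorphic_norm_measurable_disc:
  assumes "H holomorphic_on ball 0 1"
  shows "(\<lambda>z. norm (H z)) \<in> borel_measurable (disc_borel)"
  using holomorphic_on_imp_continuous_on[OF assms]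
  by (intro borel_measurable_continuous_on_restrict continuous_intros) auto

lemma measurable_norm_disc [measurable]:
  "norm \<in> borel_measurable (restrict_space borel (ball (0::complex) 1))"
  by (rule measurable_restrict_space1) simp

text \<open>Within half the distance to the boundary, 1 - |z| and 1 - |w| agree up to a factor 2;
  the factors 1 + |z| and 1 + |w| lie between 1 and 2 and cost another 2.\<close>

lemma one_minus_norm_sq_comparable:
  fixes w z :: complex
  assumes w: "norm w < 1" and z: "dist w z < (1 - norm w) / 2"
  shows "norm z < 1" and "(dw w) / 4 \<le> 1 - (norm z)\<^sup>2" and "1 - (norm z)\<^sup>2 \<le> 4 * (dw w)"
proof -
  have d: "\<bar>norm w - norm z\<bar> < (1 - norm w) / 2"
    using z norm_triangle_ineq3[of w z] by (simp add: dist_norm)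
  then have d: "norm w - norm z < (1 - norm w) / 2" "norm z - norm w < (1 - norm w) / 2"
    by (simp_all only: abs_less_iff minus_diff_eq)
  then have d: "2 * norm w - 2 * norm z < 1 - norm w" "2 * norm z - 2 * norm w < 1 - norm w"
    by (simp_all add: field_simps)
  then show n: "norm z < 1" using w by linarith
  have fw: "1 - (norm w)\<^sup>2 = (1 - norm w) * (1 + norm w)" and fz: "1 - (norm z)\<^sup>2 = (1 - norm z) * (1 + norm z)"
    by (simp_all add: power2_eq_square algebra_simps)
  have "(1 - norm w) * (1 + norm w) \<le> (2 * (1 - norm z)) * (2 * (1 + norm z))"
    using d w n norm_ge_zero[of z] norm_ge_zero[of w] by (intro mult_mono) argo+
  then show "(dw w) / 4 \<le> 1 - (norm z)\<^sup>2"
    unfolding fw fz by argo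
  have "(1 - norm z) * (1 + norm z) \<le> (2 * (1 - norm w)) * (2 * (1 + norm w))"
    using d w n norm_ge_zero[of z] norm_ge_zero[of w] by (intro mult_mono) argo+
  then show "1 - (norm z)\<^sup>2 \<le> 4 * (dw w)"
    unfolding fw fz by argo
qed

text \<open>The sub-mean value inequality is used on the disc of radius (1 - |w|) / 2, on which the
  weight is comparable with its value at w. The powers of 1 - |w|^2 cancel because such discs have
  \<lambda>-measure between two positive constants.\<close>

lemma weighted_powr_le_integral:
  assumes p: "0 < p" "p \<le> 1"
  shows "\<exists>C>0. \<forall>H w. H holomorphic_on ball 0 1 \<longrightarrow> norm w < 1 \<longrightarrow>
    ennreal ((dw w ^ k * norm (H w)) powr p)
    \<le> ennreal C * besov_integral p k H"
proof -
  define c1 where "c1 = 16 / pi * 2 powr (2 * (1 - p) / p)"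
  \<comment> \<open>The exponent of the weight once the density (1 - |z|^2)^(-2) of \<lambda> is
    included. Its sign is not known, and 4^|e| serves both signs.\<close>
  define e where "e = real k * p - 2"
  define c2 where "c2 = 4 powr \<bar>e\<bar>"
  have c: "c1 > 0" "c2 > 0" by (simp_all add: c1_def c2_def)
  show ?thesis
  proof (intro exI[of _ "16 * c1 * (pi * c2)"] conjI allI impI)
    show "16 * c1 * (pi * c2) > 0" using c by simp
    fix H :: "complex \<Rightarrow> complex" and w :: complex
    assume H: "H holomorphic_on ball 0 1" and w: "norm w < 1"
    define U where "U z = (dw z ^ k * norm (H z)) powr p" for z
    define A where "A = dw w"
    define r where "r = (1 - norm w) / 2"
    have A: "A > 0" using w by (simp add: A_def abs_square_less_1)
    have r: "r > 0" using w by (simp add: r_def)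
    have U: "U z = dw z powr (real k * p) * norm (H z) powr p" if "norm z < 1" for z
    proof -
      have "dw z > 0" using that by (simp add: abs_square_less_1)
      then show ?thesis by (simp add: U_def powr_mult powr_powr flip: powr_realpow)
    qed
    note [measurable] = holomorphic_norm_measurable_disc[OF H]
    have measU: "(\<lambda>z. ennreal (U z)) \<in> borel_measurable (disc_borel)"
      unfolding U_def by measurable
    define F where "F z = ennreal (1 / pi) * (ennreal (1 / (dw z)\<^sup>2) * ennreal (U z) * indicator (ball 0 1) z)"
      for z
    have F: "F \<in> borel_measurable borel"
      using measU unfolding F_def
      by (intro borel_measurable_times_ennreal measurable_disc_indicator) (auto intro: borel_measurable_discI)
    have int_F: "(\<integral>\<^sup>+z. ennreal (U z) \<partial>disc_lambda) = (\<integral>\<^sup>+z. F z \<partial>lborel)"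
      using measU unfolding F_def
      by (subst nn_integral_disc_lambda, simp, subst nn_integral_disc_area)
        (auto intro!: borel_measurable_times_ennreal borel_measurable_discI)
    have pt: "ennreal (norm (H z) powr p) * indicator (ball w r) z \<le> ennreal (pi * c2 * A powr - e) * F z" for z
    proof (cases "z \<in> ball w r")
      case True
      define a where "a = dw z"
      have z: "norm z < 1" and a: "A / 4 \<le> a" "a \<le> 4 * A"
        using one_minus_norm_sq_comparable[OF w, of z] True by (auto simp: r_def A_def a_def)
      have a0: "a > 0" using a A by simp
      have "A powr e \<le> c2 * a powr e"
      proof (cases "e \<ge> 0")
        case True
        have "A powr e \<le> (4 * a) powr e" using a A True by (intro powr_mono2) auto
        then show ?thesis using True a0 by (simp add: powr_mult c2_def)
      next
        case False
        have "A powr e \<le> (a / 4) powr e" using a a0 False by (intro powr_mono2') auto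
        also have "\<dots> = c2 * a powr e" using False a0 by (simp add: powr_divide c2_def powr_minus_divide)
        finally show ?thesis .
      qed
      then have "1 \<le> c2 * A powr - e * a powr e"
        using A by (simp add: powr_minus field_simps)
      also have "a powr e = a powr (real k * p) / a\<^sup>2"
        using a0 by (simp add: e_def powr_diff powr_numeral)
      finally have "1 * norm (H z) powr p \<le> c2 * A powr - e * (a powr (real k * p) / a\<^sup>2) * norm (H z) powr p"
        by (intro mult_right_mono) auto
      also have "\<dots> = pi * c2 * A powr - e * (1 / pi * (1 / a\<^sup>2 * U z))"
        using U[OF z] by (simp add: a_def)
      finally have "norm (H z) powr p \<le> pi * c2 * A powr - e * (1 / pi * (1 / a\<^sup>2 * U z))" by simp
      then have "ennreal (norm (H z) powr p) \<le> ennreal (pi * c2 * A powr - e * (1 / pi * (1 / a\<^sup>2 * U z)))"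
        by (rule ennreal_leI)
      also have "\<dots> = ennreal (pi * c2 * A powr - e) * F z"
      proof -
        have "0 \<le> U z" by (simp add: U_def)
        then show ?thesis
          using z c A by (simp add: F_def a_def ennreal_mult' del: times_divide_eq_right times_divide_eq_left mult_1)
      qed
      finally show ?thesis using True by simp
    qed simp
    have "ennreal (r\<^sup>2 * norm (H w) powr p)
        \<le> ennreal c1 * (\<integral>\<^sup>+z. ennreal (norm (H z) powr p) * indicator (ball w r) z \<partial>lborel)"
      unfolding c1_def
    proof (rule powr_norm_le_area_integral[OF p open_ball H r])
      show "cball w r \<subseteq> ball 0 1"
      proof
        fix z assume "z \<in> cball w r"
        then show "z \<in> ball 0 1"
          using w norm_triangle_ineq2[of z w] by (simp add: r_def dist_norm norm_minus_commute)
      qed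
    qed
    also have "\<dots> \<le> ennreal c1 * (\<integral>\<^sup>+z. ennreal (pi * c2 * A powr - e) * F z \<partial>lborel)"
      by (intro mult_left_mono nn_integral_mono pt) auto
    also have "\<dots> = ennreal c1 * (ennreal (pi * c2 * A powr - e) * (\<integral>\<^sup>+z. ennreal (U z) \<partial>disc_lambda))"
      using F by (simp add: int_F nn_integral_cmult)
    finally have "ennreal (16 * A powr e) * ennreal (r\<^sup>2 * norm (H w) powr p)
      \<le> ennreal (16 * A powr e) * (ennreal c1 * (ennreal (pi * c2 * A powr - e) * (\<integral>\<^sup>+z. ennreal (U z) \<partial>disc_lambda)))"
      by (intro mult_left_mono) auto
    also have "\<dots> = ennreal (16 * A powr e * c1 * (pi * c2 * A powr - e)) * (\<integral>\<^sup>+z. ennreal (U z) \<partial>disc_lambda)"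
      using c by (simp add: ennreal_mult' mult.assoc)
    also have "16 * A powr e * c1 * (pi * c2 * A powr - e) = 16 * c1 * (pi * c2)"
      using A by (simp add: powr_minus field_simps)
    finally have fin: "ennreal (16 * A powr e * (r\<^sup>2 * norm (H w) powr p)) \<le> ennreal (16 * c1 * (pi * c2)) * (\<integral>\<^sup>+z. ennreal (U z) \<partial>disc_lambda)"
      by (simp add: ennreal_mult')
    \<comment> \<open>Hence r^2 >= A^2 / 16, the origin of the factor 16; the product of A^e and A^2
      is the weight A^(k p) of the conclusion.\<close>
    have "A / 4 \<le> r"
    proof -
      have "A = (1 - norm w) * (1 + norm w)" by (simp add: A_def power2_eq_square algebra_simps)
      also have "\<dots> \<le> (1 - norm w) * 2" using w by (intro mult_left_mono) auto
      finally show ?thesis by (simp add: r_def)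
    qed
    then have "(A / 4)\<^sup>2 \<le> r\<^sup>2" using A by (intro power_mono) auto
    then have "A powr e * A\<^sup>2 * norm (H w) powr p \<le> A powr e * (16 * r\<^sup>2) * norm (H w) powr p"
      by (intro mult_right_mono mult_left_mono) (auto simp: power_divide)
    moreover have "A powr e * A\<^sup>2 = A powr (real k * p)"
      using A by (simp add: e_def powr_diff powr_numeral)
    ultimately have "U w \<le> 16 * A powr e * (r\<^sup>2 * norm (H w) powr p)"
      using U[OF w] by (simp add: A_def mult_ac)
    then have "ennreal (U w) \<le> ennreal (16 * A powr e * (r\<^sup>2 * norm (H w) powr p))"
      by (rule ennreal_leI)
    also note fin
    finally show "ennreal ((dw w ^ k * norm (H w)) powr p)
      \<le> ennreal (16 * c1 * (pi * c2)) * besov_integral p k H"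
      unfolding U_def .
  qed
qed

text \<open>With U the weighted modulus and N the integral of U^p, the pointwise bound U^p <= c N
  gives U = U^(1-p) U^p <= (c N)^((1-p)/p) U^p; integrating and raising to the power p yields
  c^(1-p) N. Stating it for every real x below the integral of U avoids powers of infinite values
  and also lets an infinite integral be refuted.\<close>

lemma powr_integral_le_integral_powr:
  assumes p: "0 < p" "p \<le> 1"
  shows "\<exists>C>0. \<forall>H x. H holomorphic_on ball 0 1 \<longrightarrow> 0 \<le> x \<longrightarrow>
    ennreal x \<le> weighted_integral k H \<longrightarrow>
    ennreal (x powr p)
    \<le> ennreal C * besov_integral p k H"
proof -
  from weighted_powr_le_integral[OF p, of k]
  obtain c where c: "c > 0" and sup: "\<forall>H w. H holomorphic_on ball 0 1 \<longrightarrow> norm w < 1 \<longrightarrow>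
    ennreal ((dw w ^ k * norm (H w)) powr p)
    \<le> ennreal c * besov_integral p k H"
    by (elim exE conjE) (rule that)
  show ?thesis
  proof (intro exI[of _ "c powr (1 - p)"] conjI allI impI)
    show "c powr (1 - p) > 0" using c by simp
    fix H :: "complex \<Rightarrow> complex" and x :: real
    define U where "U z = dw z ^ k * norm (H z)" for z
    assume H: "H holomorphic_on ball 0 1" and x: "0 \<le> x"
      and le: "ennreal x \<le> weighted_integral k H"
    define N where "N = (\<integral>\<^sup>+z. ennreal (U z powr p) \<partial>disc_lambda)"
    note [measurable] = holomorphic_norm_measurable_disc[OF H]
    have measU: "U \<in> borel_measurable (disc_borel)"
      unfolding U_def by measurable
    have "ennreal (x powr p) \<le> ennreal (c powr (1 - p)) * N"
    proof (cases N)
      case top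
      then show ?thesis using c by (simp add: ennreal_mult_top)
    next
      case (real X)
      have UX: "U z \<le> (c * X) powr ((1 - p) / p) * U z powr p" if z: "norm z < 1" for z
      proof (cases "U z = 0")
        case False
        have "(norm z)\<^sup>2 < 1" using z by (simp add: abs_square_less_1)
        then have U0: "U z > 0" using False by (simp add: U_def)
        have "ennreal (U z powr p) \<le> ennreal (c * X)"
          using sup[rule_format, OF H z] c real by (simp add: U_def N_def ennreal_mult)
        then have "U z powr p \<le> c * X"
          using c real by (subst (asm) ennreal_le_iff) auto
        then have "(U z powr p) powr ((1 - p) / p) \<le> (c * X) powr ((1 - p) / p)"
          using p by (intro powr_mono2) auto
        then have "U z powr (1 - p) \<le> (c * X) powr ((1 - p) / p)"
          using p by (simp add: powr_powr)
        then have "U z powr (1 - p) * U z powr p \<le> (c * X) powr ((1 - p) / p) * U z powr p"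
          by (intro mult_right_mono) auto
        then show ?thesis using U0 by (simp flip: powr_add)
      qed simp
      have "ennreal x \<le> (\<integral>\<^sup>+z. ennreal (U z) \<partial>disc_lambda)"
        using le by (simp add: U_def)
      also have "\<dots> \<le> (\<integral>\<^sup>+z. ennreal ((c * X) powr ((1 - p) / p)) * ennreal (U z powr p) \<partial>disc_lambda)"
        using UX by (intro nn_integral_mono) (auto simp flip: ennreal_mult' intro!: ennreal_leI)
      also have "\<dots> = ennreal ((c * X) powr ((1 - p) / p)) * N"
        unfolding N_def using measU by (intro nn_integral_cmult) simp
      also have "\<dots> = ennreal ((c * X) powr ((1 - p) / p) * X)"
        using real by (simp add: ennreal_mult')
      finally have "x \<le> (c * X) powr ((1 - p) / p) * X"
        using real by (subst (asm) ennreal_le_iff) auto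
      then have "x powr p \<le> ((c * X) powr ((1 - p) / p) * X) powr p"
        using x p by (intro powr_mono2) auto
      also have "\<dots> = c powr (1 - p) * X"
      proof (cases "X = 0")
        case False
        then have "X > 0" using real by simp
        then have "X powr (1 - p) * X powr p = X" by (simp flip: powr_add)
        then show ?thesis using p c \<open>X > 0\<close> by (simp add: powr_mult powr_powr mult.assoc)
      qed simp
      finally show ?thesis
        using real c by (simp add: ennreal_leI flip: ennreal_mult')
    qed
    then show "ennreal (x powr p) \<le> ennreal (c powr (1 - p)) *
        besov_integral p k H"
      by (simp add: N_def U_def)
  qed
qed

section \<open>Reproducing formula\<close>

lemma integral_disc_lambda:
  fixes F :: "complex \<Rightarrow> 'a::{banach, second_countable_topology}"
  assumes F: "F \<in> borel_measurable (disc_borel)"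
  shows "(\<integral>w. F w \<partial>disc_lambda)
    = (\<integral>w. indicator (ball 0 1) w *\<^sub>R (1 / pi) *\<^sub>R (1 / (dw w)\<^sup>2) *\<^sub>R F w \<partial>lborel)"
proof -
  have 1: "F \<in> borel_measurable disc_area" using F by simp
  have 2: "(\<lambda>w. (1 / (dw w)\<^sup>2) *\<^sub>R F w) \<in> borel_measurable (restrict_space lborel (ball 0 1))"
    using F by (simp cong: measurable_cong_sets sets_restrict_space_cong)
  have "(\<integral>w. F w \<partial>disc_lambda) = (\<integral>w. (1 / (dw w)\<^sup>2) *\<^sub>R F w \<partial>disc_area)"
    unfolding disc_lambda_def using 1 by (intro integral_density) auto
  also have "\<dots> = (\<integral>w. (1 / pi) *\<^sub>R (1 / (dw w)\<^sup>2) *\<^sub>R F w \<partial>restrict_space lborel (ball 0 1))"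
    unfolding disc_area_def using 2 by (intro integral_density) auto
  also have "\<dots> = (\<integral>w. indicator (ball 0 1) w *\<^sub>R (1 / pi) *\<^sub>R (1 / (dw w)\<^sup>2) *\<^sub>R F w \<partial>lborel)"
    by (rule integral_restrict_space) simp
  finally show ?thesis .
qed

lemma weight_cancel: "(A::real) \<noteq> 0 \<Longrightarrow> 1 / A\<^sup>2 * (x * A ^ (q + 2)) = x * A ^ q"
  by (simp add: power_add power2_eq_square)

text \<open>The substitution t = |w|^2 leads to the Beta integral B(k + 1, q + 1); two of the q + 2
  powers of the weight cancel the density of \<lambda>.\<close>

lemma has_bochner_integral_radial_weight:
  "has_bochner_integral disc_lambda (\<lambda>w::complex. norm w ^ (2 * k) * dw w ^ (q + 2))
    (fact k * fact q / fact (Suc (k + q)))"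
proof (rule has_bochner_integral_nn_integral)
  let ?f = "\<lambda>w::complex. norm w ^ (2 * k) * dw w ^ (q + 2)"
  show "?f \<in> borel_measurable disc_lambda"
    by simp
  show "AE w in disc_lambda. 0 \<le> ?f w"
  proof (rule AE_I2)
    fix w :: complex assume "w \<in> space disc_lambda"
    then have "(norm w)\<^sup>2 < 1" by (simp add: abs_square_less_1)
    then show "0 \<le> ?f w" by simp
  qed
  show "(0::real) \<le> fact k * fact q / fact (Suc (k + q))" by simp
  have hint: "((\<lambda>t. t ^ k * (1 - t) ^ q) has_integral Beta (real k + 1) (real q + 1)) {0<..<1}"
  proof -
    have "((\<lambda>t. t powr (real k + 1 - 1) * (1 - t) powr (real q + 1 - 1)) has_integral
        Beta (real k + 1) (real q + 1)) {0..1}"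
      by (rule has_integral_Beta_real) auto
    \<comment> \<open>The endpoints are removed because \<open>0 powr 0\<close> is 0 whereas
      \<open>0 ^ 0\<close> is 1.\<close>
    then have "((\<lambda>t. t powr (real k + 1 - 1) * (1 - t) powr (real q + 1 - 1)) has_integral
        Beta (real k + 1) (real q + 1)) {0<..<1}"
      by (simp add: has_integral_Icc_iff_Ioo)
    then show ?thesis
      by (rule has_integral_eq[rotated]) (auto simp: powr_realpow)
  qed
  have "(\<integral>\<^sup>+w. ennreal (?f w) \<partial>disc_lambda)
      = (\<integral>\<^sup>+w. ennreal (1 / (dw w)\<^sup>2) * ennreal (?f w) \<partial>disc_area)"
    by (subst nn_integral_disc_lambda) simp_all
  also have "\<dots> = (\<integral>\<^sup>+w. ennreal (((norm w)\<^sup>2) ^ k * dw w ^ q) \<partial>disc_area)"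
  proof (rule nn_integral_cong)
    fix w :: complex assume "w \<in> space disc_area"
    then have "(norm w)\<^sup>2 < 1" by (simp add: abs_square_less_1)
    then show "ennreal (1 / (dw w)\<^sup>2) * ennreal (?f w) = ennreal (((norm w)\<^sup>2) ^ k * dw w ^ q)"
      using weight_cancel[of "1 - (norm w)\<^sup>2" "((norm w)\<^sup>2) ^ k" q]
      by (simp only: power_mult flip: ennreal_mult')
        (simp del: power_Suc add: ennreal_mult'[symmetric])
  qed
  also have "\<dots> = (\<integral>\<^sup>+t. ennreal (t ^ k * (1 - t) ^ q) * indicator {0..<1} t \<partial>lborel)"
    by (rule nn_integral_disc_area_radial) simp
  also have "\<dots> = (\<integral>\<^sup>+t. ennreal (t ^ k * (1 - t) ^ q) * indicator {0<..<1} t \<partial>lborel)"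
    by (rule nn_integral_cong_AE, rule AE_I[where N = "{0}"]) (auto simp: indicator_def)
  also have "\<dots> = ennreal (Beta (real k + 1) (real q + 1))"
    by (rule nn_integral_has_integral_lebesgue'[OF _ hint]) simp
  also have "Beta (real k + 1) (real q + 1) = fact k * fact q / fact (Suc (k + q))"
    using Gamma_fact[of k, where 'a = real] Gamma_fact[of q, where 'a = real]
      Gamma_fact[of "Suc (k + q)", where 'a = real]
    by (simp add: Beta_def add_ac)
  finally show "(\<integral>\<^sup>+w. ennreal (?f w) \<partial>disc_lambda) = ennreal (fact k * fact q / fact (Suc (k + q)))" .
qed

text \<open>The moment formula above requires a weight that vanishes near the circle. The weight is
  therefore cut off at radii tending to 1, with dominated convergence for the integral itself and
  for the Beta integral.\<close>

lemma disc_lambda_moment: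
  assumes G: "G holomorphic_on ball 0 1"
    and int: "integrable disc_lambda (\<lambda>w. G w * cnj w ^ k * of_real (dw w ^ (q + 2)))"
  shows "(\<integral>w. G w * cnj w ^ k * of_real (dw w ^ (q + 2)) \<partial>disc_lambda)
    = (deriv ^^ k) G 0 / fact k * of_real (fact k * fact q / fact (Suc (k + q)))"
proof -
  define R where "R N = 1 - 1 / real (N + 2)" for N
  define s where "s N t = (indicator {0..<R N} t :: real)" for N and t :: real
  define a where "a N = integral\<^sup>L disc_lambda (\<lambda>w::complex. s N (norm w) * (norm w ^ (2 * k) * dw w ^ (q + 2)))" for N
  define F where "F w = G w * cnj w ^ k * of_real (dw w ^ (q + 2))" for w
  have R: "0 < R N" "R N < 1" for N by (auto simp: R_def)
  have s_le: "\<bar>s N t\<bar> \<le> 1" for N t by (simp add: s_def indicator_def)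
  have s_lim: "(\<lambda>N. s N t) \<longlonglongrightarrow> 1" if t: "0 \<le> t" "t < 1" for t
  proof (rule tendsto_eventually)
    have "R \<longlonglongrightarrow> 1" unfolding R_def by real_asymp
    then have "\<forall>\<^sub>F N in sequentially. t < R N" using t by (intro order_tendstoD)
    then show "\<forall>\<^sub>F N in sequentially. s N t = 1"
      by eventually_elim (use t in \<open>simp add: s_def\<close>)
  qed
  have s_meas [measurable]: "s N \<in> borel_measurable borel" for N
    unfolding s_def by simp
  have [measurable]: "cnj \<in> borel_measurable borel"
    by (intro borel_measurable_continuous_onI continuous_intros)
  have F_meas: "F \<in> borel_measurable disc_lambda"
    using int unfolding F_def by (rule borel_measurable_integrable)
  have lim1: "(\<lambda>N. \<integral>w. of_real (s N (norm w)) * F w \<partial>disc_lambda) \<longlonglongrightarrow> (\<integral>w. F w \<partial>disc_lambda)"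
  proof (rule integral_dominated_convergence)
    show "F \<in> borel_measurable disc_lambda" by (rule F_meas)
    show "(\<lambda>w. of_real (s N (norm w)) * F w) \<in> borel_measurable disc_lambda" for N
      using F_meas by simp
    show "integrable disc_lambda (\<lambda>w. norm (F w))"
      using int unfolding F_def by (rule integrable_norm)
    show "AE w in disc_lambda. norm (of_real (s N (norm w)) * F w) \<le> norm (F w)" for N
      using s_le by (intro AE_I2) (auto simp: norm_mult intro: mult_left_le_one_le)
    show "AE w in disc_lambda. (\<lambda>N. of_real (s N (norm w)) * F w) \<longlonglongrightarrow> F w"
    proof (rule AE_I2)
      fix w :: complex assume "w \<in> space disc_lambda"
      then have "(\<lambda>N. of_real (s N (norm w)) * F w) \<longlonglongrightarrow> of_real 1 * F w"
        by (intro tendsto_intros s_lim) auto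
      then show "(\<lambda>N. of_real (s N (norm w)) * F w) \<longlonglongrightarrow> F w" by simp
    qed
  qed
  have lim2: "a \<longlonglongrightarrow> fact k * fact q / fact (Suc (k + q))"
  proof -
    let ?f = "\<lambda>w::complex. norm w ^ (2 * k) * dw w ^ (q + 2)"
    note hb = has_bochner_integral_radial_weight[of k q]
    have "(\<lambda>N. \<integral>w. s N (norm w) * ?f w \<partial>disc_lambda) \<longlonglongrightarrow> (\<integral>w. ?f w \<partial>disc_lambda)"
    proof (rule integral_dominated_convergence)
      show "integrable disc_lambda (\<lambda>w. norm (?f w))"
        using hb by (intro integrable_norm) (rule integrable.intros)
      show "AE w in disc_lambda. norm (s N (norm w) * ?f w) \<le> norm (?f w)" for N
        using s_le by (intro AE_I2) (auto simp: norm_mult abs_mult intro: mult_left_le_one_le)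
      show "AE w in disc_lambda. (\<lambda>N. s N (norm w) * ?f w) \<longlonglongrightarrow> ?f w"
      proof (rule AE_I2)
        fix w :: complex assume "w \<in> space disc_lambda"
        then have "(\<lambda>N. s N (norm w) * ?f w) \<longlonglongrightarrow> 1 * ?f w"
          by (intro tendsto_intros s_lim) auto
        then show "(\<lambda>N. s N (norm w) * ?f w) \<longlonglongrightarrow> ?f w" by simp
      qed
    qed simp_all
    then show ?thesis
      unfolding a_def using hb by (simp add: has_bochner_integral_integral_eq)
  qed
  have eq: "(\<integral>w. of_real (s N (norm w)) * F w \<partial>disc_lambda) = (deriv ^^ k) G 0 / fact k * of_real (a N)" for N
  proof -
    \<comment> \<open>Includes the density 1 / pi of the area; the density of \<lambda> has lowered
      the exponent from q + 2 to q.\<close>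
    define h where "h t = 1 / pi * (s N t * (1 - t\<^sup>2) ^ q)" for t
    have h_meas: "h \<in> borel_measurable borel" unfolding h_def by measurable
    have h0: "h t = 0" if "t \<ge> R N" for t using that by (simp add: h_def s_def)
    have hB: "\<bar>h t\<bar> \<le> 1" for t
    proof (cases "t \<in> {0..<R N}")
      case True
      then have "t\<^sup>2 \<le> 1" using R[of N] by (simp add: abs_square_le_1)
      then have "(1 - t\<^sup>2) ^ q \<le> 1" "0 \<le> (1 - t\<^sup>2) ^ q" by (auto intro: power_le_one)
      then have "\<bar>h t\<bar> \<le> 1 / pi * 1" using True by (simp add: h_def s_def divide_right_mono)
      also have "\<dots> \<le> 1" using pi_gt3 by simp
      finally show ?thesis .
    qed (simp add: h_def s_def)
    have mom: "(\<integral>w. G w * cnj w ^ k * of_real (h (norm w)) \<partial>lborel)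
      = (deriv ^^ k) G 0 / fact k * of_real (integral\<^sup>L lborel (\<lambda>w::complex. norm w ^ (2 * k) * h (norm w)))"
      by (rule radial_moment_integral[OF G R h_meas hB h0])
    have h_eq: "indicator (ball 0 1) w * (1 / pi * (1 / (dw w)\<^sup>2 * (s N (norm w) * dw w ^ (q + 2)))) = h (norm w)"
      for w :: complex
    proof (cases "norm w < 1")
      case True
      then have "(norm w)\<^sup>2 < 1" by (simp add: abs_square_less_1)
      then show ?thesis
        using True weight_cancel[of "1 - (norm w)\<^sup>2" "s N (norm w)" q]
        by (simp del: power_Suc add: h_def)
    next
      case False
      then show ?thesis using R[of N] by (simp add: h_def s_def)
    qed
    have "(\<integral>w. of_real (s N (norm w)) * F w \<partial>disc_lambda)
      = (\<integral>w. indicator (ball 0 1) w *\<^sub>R (1 / pi) *\<^sub>R (1 / (dw w)\<^sup>2) *\<^sub>R (of_real (s N (norm w)) * F w) \<partial>lborel)"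
      using F_meas by (intro integral_disc_lambda) simp
    also have "\<dots> = (\<integral>w. G w * cnj w ^ k * of_real (h (norm w)) \<partial>lborel)"
      by (intro Bochner_Integration.integral_cong refl, subst h_eq[symmetric])
         (simp add: F_def scaleR_conv_of_real mult_ac)
    finally have A: "(\<integral>w. of_real (s N (norm w)) * F w \<partial>disc_lambda) = (\<integral>w. G w * cnj w ^ k * of_real (h (norm w)) \<partial>lborel)" .
    have "a N = (\<integral>w. indicator (ball 0 1) w *\<^sub>R (1 / pi) *\<^sub>R (1 / (dw w)\<^sup>2) *\<^sub>R
        (s N (norm w) * (norm w ^ (2 * k) * dw w ^ (q + 2))) \<partial>(lborel :: complex measure))"
      unfolding a_def by (intro integral_disc_lambda) simp
    also have "\<dots> = integral\<^sup>L lborel (\<lambda>w::complex. norm w ^ (2 * k) * h (norm w))"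
      by (intro Bochner_Integration.integral_cong refl, subst h_eq[symmetric]) (simp add: mult_ac)
    finally show ?thesis using A mom by simp
  qed
  have "(\<lambda>N. (deriv ^^ k) G 0 / fact k * of_real (a N)) \<longlonglongrightarrow>
      (deriv ^^ k) G 0 / fact k * of_real (fact k * fact q / fact (Suc (k + q)))"
    by (intro tendsto_intros lim2)
  then have "(\<lambda>N. \<integral>w. of_real (s N (norm w)) * F w \<partial>disc_lambda) \<longlonglongrightarrow>
      (deriv ^^ k) G 0 / fact k * of_real (fact k * fact q / fact (Suc (k + q)))"
    by (simp only: eq)
  then show ?thesis
    using lim1 LIMSEQ_unique unfolding F_def by blast
qed

text \<open>The functional \<open>F \<mapsto> (F \<circ> \<phi>)\<^sup>(\<^sup>n\<^sup>)(z)\<close> is continuous for uniform convergence on a compact disc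
  containing \<open>\<phi>\<close> of a neighbourhood of \<open>z\<close>, so it may be applied termwise to power series.\<close>

lemma higher_deriv_comp_power_series:
  assumes phi: "\<phi> holomorphic_on ball 0 1" "\<phi> ` ball 0 1 \<subseteq> ball 0 1" and z: "z \<in> ball 0 1"
  shows "\<exists>C \<rho>. 0 < \<rho> \<and> \<rho> < 1 \<and> 0 \<le> C \<and> (\<forall>k. norm ((deriv ^^ n) (\<lambda>x. \<phi> x ^ k) z) \<le> C * \<rho> ^ k) \<and>
    (\<forall>(F :: complex \<Rightarrow> complex) c. (\<forall>x\<in>ball 0 1. (\<lambda>k. c k * x ^ k) sums F x) \<longrightarrow>
      (\<lambda>k. c k * (deriv ^^ n) (\<lambda>x. \<phi> x ^ k) z) sums (deriv ^^ n) (\<lambda>x. F (\<phi> x)) z)"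
proof -
  define s where "s = (1 - norm z) / 2"
  have s: "s > 0" and sub: "cball z s \<subseteq> ball 0 1"
  proof -
    show "s > 0" using z by (simp add: s_def)
    show "cball z s \<subseteq> ball 0 1"
    proof
      fix x assume "x \<in> cball z s"
      then have "norm x \<le> norm z + s"
        using norm_triangle_ineq2[of x z] by (simp add: dist_norm norm_minus_commute)
      then show "x \<in> ball 0 1" using z by (simp add: s_def field_simps)
    qed
  qed
  have cont: "continuous_on (cball z s) \<phi>"
    using holomorphic_on_imp_continuous_on[OF phi(1)] sub continuous_on_subset by blast
  then obtain x0 where x0: "x0 \<in> cball z s" "\<And>x. x \<in> cball z s \<Longrightarrow> norm (\<phi> x) \<le> norm (\<phi> x0)"
    using continuous_attains_sup[of "cball z s" "\<lambda>x. norm (\<phi> x)"] s continuous_on_norm[OF cont]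
    by auto
  \<comment> \<open>Halfway between the maximum of |\<phi>| on the closed disc and 1, so that \<rho>
    is positive even when \<phi> vanishes there.\<close>
  define \<rho> where "\<rho> = (1 + norm (\<phi> x0)) / 2"
  have "\<phi> x0 \<in> ball 0 1" using phi(2) x0(1) sub by blast
  then have rho: "0 < \<rho>" "\<rho> < 1" and le0: "norm (\<phi> x0) \<le> \<rho>"
    by (auto simp: \<rho>_def add_pos_nonneg)
  have le: "norm (\<phi> x) \<le> \<rho>" if "x \<in> cball z s" for x
    using x0(2)[OF that] le0 by linarith
  have holo: "\<phi> holomorphic_on ball z s"
    using sub by (intro holomorphic_on_subset[OF phi(1)]) auto
  show ?thesis
  proof (rule exI[of _ "fact n / s ^ n"], rule exI[of _ \<rho>], intro conjI allI impI rho)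
    show "0 \<le> fact n / s ^ n" using s by simp
    show "norm ((deriv ^^ n) (\<lambda>x. \<phi> x ^ k) z) \<le> fact n / s ^ n * \<rho> ^ k" for k
    proof -
      have "norm ((deriv ^^ n) (\<lambda>x. \<phi> x ^ k) z) \<le> fact n * \<rho> ^ k / s ^ n"
        by (rule Cauchy_inequality)
          (use s in \<open>auto intro!: holomorphic_intros holo continuous_intros cont power_mono le
            simp: norm_power dist_norm\<close>)
      then show ?thesis by simp
    qed
    fix F :: "complex \<Rightarrow> complex" and c
    assume F': "\<forall>x\<in>ball 0 1. (\<lambda>k. c k * x ^ k) sums F x"
    have F: "(\<lambda>k. c k * x ^ k) sums F x" if "x \<in> ball 0 1" for x
      using F' that by blast
    have crad: "ereal \<rho> < conv_radius c"
    proof -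
      \<comment> \<open>Convergence at a point of modulus strictly between \<rho> and 1 puts the
        radius of convergence above \<rho>, as uniform convergence on the closed disc of radius
        \<rho> requires.\<close>
      have "(1 + \<rho>) / 2 < 1" using rho by simp
      then have "summable (\<lambda>k. c k * (of_real ((1 + \<rho>) / 2)) ^ k)"
        using F[of "of_real ((1 + \<rho>) / 2)"] rho by (auto simp: sums_iff norm_divide simp del: of_real_add of_real_divide)
      then have "conv_radius c \<ge> norm (of_real ((1 + \<rho>) / 2) :: complex)"
        by (rule conv_radius_geI)
      also have "norm (of_real ((1 + \<rho>) / 2) :: complex) = (1 + \<rho>) / 2"
        using rho unfolding norm_of_real by simp
      finally have "ereal ((1 + \<rho>) / 2) \<le> conv_radius c" .
      moreover have "ereal \<rho> < ereal ((1 + \<rho>) / 2)" using rho by simp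
      ultimately show ?thesis by (rule less_le_trans[rotated])
    qed
    have U: "uniform_limit (cball 0 \<rho>) (\<lambda>N x. \<Sum>k<N. c k * (x - 0) ^ k) (\<lambda>x. \<Sum>k. c k * (x - 0) ^ k) sequentially"
      by (rule powser_uniform_limit[OF crad])
    have "uniform_limit (ball z s) (\<lambda>N x. \<Sum>k<N. c k * \<phi> x ^ k) (\<lambda>x. \<Sum>k. c k * \<phi> x ^ k) sequentially"
      unfolding uniform_limit_iff
    proof (intro allI impI)
      fix e :: real assume "e > 0"
      with U have "\<forall>\<^sub>F N in sequentially. \<forall>x\<in>cball 0 \<rho>. dist (\<Sum>k<N. c k * x ^ k) (\<Sum>k. c k * x ^ k) < e"
        unfolding uniform_limit_iff by simp
      then show "\<forall>\<^sub>F N in sequentially. \<forall>x\<in>ball z s. dist (\<Sum>k<N. c k * \<phi> x ^ k) (\<Sum>k. c k * \<phi> x ^ k) < e"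
        by eventually_elim (use le in auto)
    qed
    moreover have "(\<Sum>k. c k * \<phi> x ^ k) = F (\<phi> x)" if "x \<in> ball z s" for x
    proof -
      have "x \<in> cball z s" using that by simp
      then have "x \<in> ball 0 1" using sub by blast
      then have "\<phi> x \<in> ball 0 1" using phi(2) by blast
      then show ?thesis using F[of "\<phi> x"] by (simp add: sums_iff)
    qed
    ultimately have "uniform_limit (ball z s) (\<lambda>N x. \<Sum>k<N. c k * \<phi> x ^ k) (\<lambda>x. F (\<phi> x)) sequentially"
      by (subst uniform_limit_cong'[where i = "\<lambda>x. \<Sum>k. c k * \<phi> x ^ k"]) auto
    then have "(\<lambda>N. (deriv ^^ n) (\<lambda>x. \<Sum>k<N. c k * \<phi> x ^ k) z) \<longlonglongrightarrow> (deriv ^^ n) (\<lambda>x. F (\<phi> x)) z"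
      by (rule higher_deriv_complex_uniform_limit)
        (use s in \<open>auto intro!: holomorphic_intros holo always_eventually\<close>)
    moreover have "(deriv ^^ n) (\<lambda>x. \<Sum>k<N. c k * \<phi> x ^ k) z = (\<Sum>k<N. c k * (deriv ^^ n) (\<lambda>x. \<phi> x ^ k) z)" for N
    proof (induction N)
      case (Suc N)
      have "(deriv ^^ n) (\<lambda>x. (\<Sum>k<N. c k * \<phi> x ^ k) + c N * \<phi> x ^ N) z
        = (deriv ^^ n) (\<lambda>x. \<Sum>k<N. c k * \<phi> x ^ k) z + (deriv ^^ n) (\<lambda>x. c N * \<phi> x ^ N) z"
        by (rule higher_deriv_add[of _ "ball z s"]) (use s in \<open>auto intro!: holomorphic_intros holo\<close>)
      also have "(deriv ^^ n) (\<lambda>x. c N * \<phi> x ^ N) z = c N * (deriv ^^ n) (\<lambda>x. \<phi> x ^ N) z"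
        by (rule higher_deriv_cmult[of _ "ball z s"]) (use s in \<open>auto intro!: holomorphic_intros holo\<close>)
      finally show ?case using Suc by simp
    qed simp
    ultimately show "(\<lambda>k. c k * (deriv ^^ n) (\<lambda>x. \<phi> x ^ k) z) sums (deriv ^^ n) (\<lambda>x. F (\<phi> x)) z"
      by (simp add: sums_def)
  qed
qed

text \<open>Let c_k be the Taylor coefficients of f and b_k the n-th derivative of \<phi>^k at z;
  the n-th derivative of the composition at z is the sum of c_k b_k. With m = q + 1, the moments of
  the m-th derivative of f are q! c_(m+k), and exchanging sum and integral assembles the terms of
  order at least m into one integral whose kernel is the n-th derivative of \<phi>^m / (1 - cnj w
  \<phi>). This kernel is antiholomorphic in w; \<open>E\<close> is its conjugate, of the same
  modulus, and \<open>x\<close> is the modulus of the integral.\<close>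

lemma higher_deriv_comp_reproducing:
  assumes f: "f holomorphic_on ball 0 1"
    and int: "weighted_integral (q + 2) ((deriv ^^ Suc q) f) < \<infinity>"
    and phi: "\<phi> holomorphic_on ball 0 1" "\<phi> ` ball 0 1 \<subseteq> ball 0 1" and z: "z \<in> ball 0 1"
  shows "\<exists>E x. E holomorphic_on ball 0 1 \<and> 0 \<le> x \<and>
    (\<forall>w\<in>ball 0 1. norm (E w) = norm ((deriv ^^ n) (\<lambda>x. \<phi> x ^ Suc q / (1 - cnj w * \<phi> x)) z)) \<and>
    ennreal x \<le> weighted_integral (q + 2) (\<lambda>w. (deriv ^^ Suc q) f w * E w) \<and>
    norm ((deriv ^^ n) (\<lambda>x. f (\<phi> x)) z)
      \<le> (\<Sum>k<Suc q. norm ((deriv ^^ k) f 0 / fact k) * norm ((deriv ^^ n) (\<lambda>x. \<phi> x ^ k) z)) + x"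
proof -
  define g where "g = (deriv ^^ Suc q) f"
  define W where "W w = dw w ^ (q + 2)" for w :: complex
  define c where "c k = (deriv ^^ k) f 0 / fact k" for k
  define b where "b k = (deriv ^^ n) (\<lambda>x. \<phi> x ^ k) z" for k
  from higher_deriv_comp_power_series[OF phi z, of n, folded b_def]
  obtain C \<rho> where rho: "0 < \<rho>" "\<rho> < 1" and C: "0 \<le> C" and b_le': "\<forall>k. norm (b k) \<le> C * \<rho> ^ k"
    and L': "\<forall>(F :: complex \<Rightarrow> complex) c. (\<forall>x\<in>ball 0 1. (\<lambda>k. c k * x ^ k) sums F x) \<longrightarrow>
      (\<lambda>k. c k * b k) sums (deriv ^^ n) (\<lambda>x. F (\<phi> x)) z"
    by (elim exE conjE) (rule that)
  have b_le: "norm (b k) \<le> C * \<rho> ^ k" for k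
    using b_le' by blast
  have L: "(\<lambda>k. c k * b k) sums (deriv ^^ n) (\<lambda>x. F (\<phi> x)) z"
    if "\<And>x. x \<in> ball 0 1 \<Longrightarrow> (\<lambda>k. c k * x ^ k) sums F x" for F :: "complex \<Rightarrow> complex" and c
    using L' that by blast
  have g: "g holomorphic_on ball 0 1"
    unfolding g_def by (intro holomorphic_higher_deriv f) auto
  have W0: "0 \<le> W w" if "norm w < 1" for w
  proof -
    have "(norm w)\<^sup>2 < 1" using that by (simp add: abs_square_less_1)
    then show ?thesis by (simp add: W_def)
  qed
  have nW: "norm (y * of_real (W w)) = dw w ^ (q + 2) * norm y" if "norm w < 1" for y w :: complex
    using W0[OF that] unfolding W_def[symmetric] by (simp add: norm_mult)
  have [measurable]: "g \<in> borel_measurable (disc_borel)"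
    by (intro borel_measurable_continuous_on_restrict holomorphic_on_imp_continuous_on g)
  have [measurable]: "(\<lambda>w. cnj w) \<in> borel_measurable (disc_borel)"
    by (intro borel_measurable_continuous_on_restrict continuous_intros)
  have [measurable]: "W \<in> borel_measurable (disc_borel)"
    unfolding W_def by measurable
  have gW: "integrable disc_lambda (\<lambda>w. g w * of_real (W w))"
  proof (rule integrableI_bounded)
    have "(\<integral>\<^sup>+w. ennreal (norm (g w * of_real (W w))) \<partial>disc_lambda)
      = weighted_integral (q + 2) ((deriv ^^ Suc q) f)"
      by (intro nn_integral_cong, subst nW) (simp_all add: g_def)
    then show "(\<integral>\<^sup>+w. ennreal (norm (g w * of_real (W w))) \<partial>disc_lambda) < \<infinity>"
      using int by simp
  qed simp
  define I where "I = (\<integral>w. norm (g w * of_real (W w)) \<partial>disc_lambda)"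
  define t where "t k w = (g w * of_real (W w)) * (cnj w ^ k * b (Suc q + k))" for k w
  have t_le: "norm (t k w) \<le> norm (g w * of_real (W w)) * (C * \<rho> ^ (Suc q + k))" if "norm w < 1" for k w
  proof -
    have "norm (cnj w ^ k * b (Suc q + k)) \<le> 1 * (C * \<rho> ^ (Suc q + k))"
      unfolding norm_mult using that b_le[of "Suc q + k"]
      by (intro mult_mono) (auto simp: norm_power power_le_one)
    then show ?thesis
      unfolding t_def norm_mult[of "g w * of_real (W w)"] by (intro mult_left_mono) auto
  qed
  have t_int: "integrable disc_lambda (t k)" for k
  proof (rule Bochner_Integration.integrable_bound)
    show "integrable disc_lambda (\<lambda>w. norm (g w * of_real (W w)) * (C * \<rho> ^ (Suc q + k)))"
      using gW by (intro integrable_mult_left integrable_norm)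
    show "t k \<in> borel_measurable disc_lambda"
      unfolding t_def by simp
    show "AE w in disc_lambda. norm (t k w) \<le> norm (norm (g w * of_real (W w)) * (C * \<rho> ^ (Suc q + k)))"
      using t_le C rho by (intro AE_I2) auto
  qed
  have rho_sum: "summable (\<lambda>k. C * \<rho> ^ (Suc q + k))"
    unfolding power_add using rho by (intro summable_mult summable_geometric) auto
  have AE_sum: "AE w in disc_lambda. summable (\<lambda>k. norm (t k w))"
  proof (rule AE_I2)
    fix w :: complex assume "w \<in> space disc_lambda"
    then have w: "norm w < 1" by simp
    show "summable (\<lambda>k. norm (t k w))"
    proof (rule summable_comparison_test')
      show "summable (\<lambda>k. norm (g w * of_real (W w)) * (C * \<rho> ^ (Suc q + k)))"
        by (intro summable_mult rho_sum)
      show "norm (norm (t k w)) \<le> norm (g w * of_real (W w)) * (C * \<rho> ^ (Suc q + k))" for k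
        using t_le[OF w, of k] by (simp only: real_norm_def abs_norm_cancel)
    qed
  qed
  have int_sum: "summable (\<lambda>k. \<integral>w. norm (t k w) \<partial>disc_lambda)"
  proof (rule summable_comparison_test')
    show "summable (\<lambda>k. I * (C * \<rho> ^ (Suc q + k)))"
      by (intro summable_mult rho_sum)
    show "norm (\<integral>w. norm (t k w) \<partial>disc_lambda) \<le> I * (C * \<rho> ^ (Suc q + k))" for k
    proof -
      have "norm (\<integral>w. norm (t k w) \<partial>disc_lambda) = (\<integral>w. norm (t k w) \<partial>disc_lambda)"
        by simp
      also have "\<dots> \<le> (\<integral>w. norm (g w * of_real (W w)) * (C * \<rho> ^ (Suc q + k)) \<partial>disc_lambda)"
      proof (rule integral_mono)
        show "integrable disc_lambda (\<lambda>w. norm (t k w))"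
          by (intro integrable_norm t_int)
        show "integrable disc_lambda (\<lambda>w. norm (g w * of_real (W w)) * (C * \<rho> ^ (Suc q + k)))"
          using gW by (intro integrable_mult_left integrable_norm)
      qed (use t_le in auto)
      also have "\<dots> = I * (C * \<rho> ^ (Suc q + k))"
        unfolding I_def by (rule integral_mult_left_zero)
      finally show ?thesis .
    qed
  qed
  define E where "E w = (\<Sum>k. cnj (b (Suc q + k)) * w ^ k)" for w
  have E_sums: "(\<lambda>k. cnj (b (Suc q + k)) * w ^ k) sums E w" if w: "norm w < 1" for w
    unfolding E_def
  proof (intro summable_sums summable_comparison_test'[OF rho_sum])
    show "norm (cnj (b (Suc q + k)) * w ^ k) \<le> C * \<rho> ^ (Suc q + k)" for k
    proof -
      have "norm (cnj (b (Suc q + k)) * w ^ k) \<le> (C * \<rho> ^ (Suc q + k)) * 1"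
        unfolding norm_mult using w b_le[of "Suc q + k"] C rho
        by (intro mult_mono) (auto simp: norm_power power_le_one)
      then show ?thesis by simp
    qed
  qed
  have E_holo: "E holomorphic_on ball 0 1"
    by (rule power_series_holomorphic[where a = "\<lambda>k. cnj (b (Suc q + k))"]) (use E_sums in auto)
  have cnj_E: "cnj (E w) = (deriv ^^ n) (\<lambda>x. \<phi> x ^ Suc q / (1 - cnj w * \<phi> x)) z" if w: "norm w < 1" for w
  proof -
    \<comment> \<open>The Taylor coefficients of x^(q+1) / (1 - cnj w x): a geometric series shifted
      by q + 1.\<close>
    define d where "d k = (if k < Suc q then 0 else cnj w ^ (k - Suc q))" for k
    have shift: "(\<lambda>k. d k * y k) sums S \<longleftrightarrow> (\<lambda>k. cnj w ^ k * y (Suc q + k)) sums S" for y :: "nat \<Rightarrow> complex" and S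
      using sums_iff_shift'[of "\<lambda>k. d k * y k" "Suc q" S] by (simp add: d_def add.commute)
    have "(\<lambda>k. d k * x ^ k) sums (x ^ Suc q / (1 - cnj w * x))" if "x \<in> ball 0 1" for x
    proof -
      have "norm (cnj w * x) < 1" using w that by (simp add: norm_mult) (metis mult_le_one norm_ge_zero mult_left_le_one_le order_less_imp_le le_less_trans)
      then have "(\<lambda>k. x ^ Suc q * (cnj w * x) ^ k) sums (x ^ Suc q * (1 / (1 - cnj w * x)))"
        by (intro sums_mult geometric_sums)
      then show ?thesis unfolding shift by (simp add: power_mult_distrib power_add mult_ac)
    qed
    then have "(\<lambda>k. d k * b k) sums (deriv ^^ n) (\<lambda>x. \<phi> x ^ Suc q / (1 - cnj w * \<phi> x)) z"
      by (rule L)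
    moreover have "(\<lambda>k. cnj (cnj (b (Suc q + k)) * w ^ k)) sums cnj (E w)"
      using E_sums[OF w] by (simp only: sums_cnj)
    then have "(\<lambda>k. d k * b k) sums cnj (E w)"
      unfolding shift by (simp add: mult.commute)
    ultimately show ?thesis by (metis sums_unique2)
  qed
  define J where "J = (\<integral>w. g w * of_real (W w) * cnj (E w) \<partial>disc_lambda)"
  have t_sums: "(\<lambda>k. \<integral>w. t k w \<partial>disc_lambda) sums J"
  proof -
    have "(\<lambda>k. \<integral>w. t k w \<partial>disc_lambda) sums (\<integral>w. (\<Sum>k. t k w) \<partial>disc_lambda)"
      by (rule sums_integral[OF t_int AE_sum int_sum])
    also have "(\<integral>w. (\<Sum>k. t k w) \<partial>disc_lambda) = J"
      unfolding J_def
    proof (rule Bochner_Integration.integral_cong[OF refl])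
      fix w :: complex assume "w \<in> space disc_lambda"
      then have w: "norm w < 1" by simp
      have "(\<lambda>k. cnj (cnj (b (Suc q + k)) * w ^ k)) sums cnj (E w)"
        using E_sums[OF w] by (simp only: sums_cnj)
      then have "(\<lambda>k. g w * of_real (W w) * cnj (cnj (b (Suc q + k)) * w ^ k)) sums (g w * of_real (W w) * cnj (E w))"
        by (rule sums_mult)
      then show "(\<Sum>k. t k w) = g w * of_real (W w) * cnj (E w)"
        by (simp add: t_def sums_iff mult_ac)
    qed
    finally show ?thesis .
  qed
  \<comment> \<open>With m = q + 1, the product of f^(m+k)(0) / k! and k! q! / (k + m)! is q!
    c_(m+k), so the sum over k recovers the Taylor tail up to the factor q!.\<close>
  have t_val: "(\<integral>w. t k w \<partial>disc_lambda) = fact q * (c (Suc q + k) * b (Suc q + k))" for k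
  proof -
    have int_k: "integrable disc_lambda (\<lambda>w. g w * cnj w ^ k * of_real (dw w ^ (q + 2)))"
    proof (rule Bochner_Integration.integrable_bound[OF gW])
      show "(\<lambda>w. g w * cnj w ^ k * of_real (dw w ^ (q + 2))) \<in> borel_measurable disc_lambda"
        by simp
      show "AE w in disc_lambda. norm (g w * cnj w ^ k * of_real (dw w ^ (q + 2)))
          \<le> norm (g w * of_real (W w))"
      proof (rule AE_I2)
        fix w :: complex assume "w \<in> space disc_lambda"
        then have "norm w ^ k \<le> 1" by (simp add: power_le_one)
        then have "norm (g w) * norm w ^ k * \<bar>W w\<bar> \<le> norm (g w) * 1 * \<bar>W w\<bar>"
          by (intro mult_right_mono mult_left_mono) auto
        then show "norm (g w * cnj w ^ k * of_real (dw w ^ (q + 2))) \<le> norm (g w * of_real (W w))"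
          unfolding W_def[symmetric] by (simp add: norm_mult norm_power)
      qed
    qed
    have "(\<integral>w. t k w \<partial>disc_lambda)
        = (\<integral>w. b (Suc q + k) * (g w * cnj w ^ k * of_real (dw w ^ (q + 2))) \<partial>disc_lambda)"
      by (intro Bochner_Integration.integral_cong refl) (simp add: t_def W_def mult_ac)
    also have "\<dots> = b (Suc q + k) * ((deriv ^^ k) g 0 / fact k * of_real (fact k * fact q / fact (Suc (k + q))))"
      by (simp only: integral_mult_right_zero disc_lambda_moment[OF g int_k])
    also have "(deriv ^^ k) g 0 = (deriv ^^ (Suc q + k)) f 0"
      unfolding g_def add.commute[of "Suc q"] funpow_add by simp
    finally show ?thesis by (simp add: c_def add_ac)
  qed
  have "(\<lambda>k. c k * b k) sums (deriv ^^ n) (\<lambda>x. f (\<phi> x)) z"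
    using holomorphic_power_series[OF f] by (intro L) (simp add: c_def)
  then have "(\<lambda>k. c (k + Suc q) * b (k + Suc q)) sums ((deriv ^^ n) (\<lambda>x. f (\<phi> x)) z - (\<Sum>k<Suc q. c k * b k))"
    by (rule sums_split_initial_segment)
  then have "(\<lambda>k. fact q * (c (Suc q + k) * b (Suc q + k))) sums
      (fact q * ((deriv ^^ n) (\<lambda>x. f (\<phi> x)) z - (\<Sum>k<Suc q. c k * b k)))"
    by (intro sums_mult) (simp only: add.commute)
  with t_sums have "J = fact q * ((deriv ^^ n) (\<lambda>x. f (\<phi> x)) z - (\<Sum>k<Suc q. c k * b k))"
    unfolding t_val by (rule sums_unique2)
  then have main: "(deriv ^^ n) (\<lambda>x. f (\<phi> x)) z = (\<Sum>k<Suc q. c k * b k) + J / fact q"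
    by (simp add: field_simps)
  show ?thesis
  proof (rule exI[of _ E], rule exI[of _ "norm J"], intro conjI ballI E_holo norm_ge_zero)
    show "norm (E w) = norm ((deriv ^^ n) (\<lambda>x. \<phi> x ^ Suc q / (1 - cnj w * \<phi> x)) z)" if "w \<in> ball 0 1" for w
      using that by (subst cnj_E[symmetric]) auto
    have "ennreal (norm J) \<le> (\<integral>\<^sup>+w. ennreal (norm (g w * of_real (W w) * cnj (E w))) \<partial>disc_lambda)"
      unfolding J_def
      by (cases "integrable disc_lambda (\<lambda>w. g w * of_real (W w) * cnj (E w))")
        (auto intro: integral_norm_bound_ennreal simp: not_integrable_integral_eq)
    also have "\<dots> = weighted_integral (q + 2) (\<lambda>w. (deriv ^^ Suc q) f w * E w)"
    proof (rule nn_integral_cong)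
      fix w :: complex assume "w \<in> space disc_lambda"
      then have "norm (g w * E w * of_real (W w)) = dw w ^ (q + 2) * norm (g w * E w)"
        by (intro nW) simp
      then show "ennreal (norm (g w * of_real (W w) * cnj (E w)))
          = ennreal (dw w ^ (q + 2) * norm ((deriv ^^ Suc q) f w * E w))"
        unfolding g_def[symmetric] by (simp only: norm_mult complex_mod_cnj mult_ac)
    qed
    finally show "ennreal (norm J) \<le> \<dots>" .
    have "norm ((deriv ^^ n) (\<lambda>x. f (\<phi> x)) z) \<le> norm (\<Sum>k<Suc q. c k * b k) + norm (J / fact q)"
      unfolding main by (rule norm_triangle_ineq)
    also have "norm (\<Sum>k<Suc q. c k * b k) \<le> (\<Sum>k<Suc q. norm (c k) * norm (b k))"
      by (rule order_trans[OF norm_sum]) (simp add: norm_mult)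
    also have "norm (J / fact q) \<le> norm J"
      by (simp add: norm_divide divide_le_eq mult_le_cancel_left1 fact_ge_1)
    finally show "norm ((deriv ^^ n) (\<lambda>x. f (\<phi> x)) z)
      \<le> (\<Sum>k<Suc q. norm ((deriv ^^ k) f 0 / fact k) * norm ((deriv ^^ n) (\<lambda>x. \<phi> x ^ k) z)) + norm J"
      by (simp add: c_def b_def)
  qed
qed

section \<open>Moebius transformations and kernels\<close>

definition mob :: "complex \<Rightarrow> complex \<Rightarrow> complex" where
  "mob a z = (a - z) / (1 - cnj a * z)"

lemma one_minus_cnj_mult_bounds:
  fixes c z :: complex
  assumes "norm c < 1" "norm z < 1"
  shows "1 - norm z \<le> norm (1 - cnj c * z)" and "1 - norm c \<le> norm (1 - cnj c * z)"
    and "1 - cnj c * z \<noteq> 0"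
proof -
  have le: "norm (cnj c * z) \<le> norm z" "norm (cnj c * z) \<le> norm c"
    using assms by (auto simp: norm_mult intro: mult_left_le_one_le mult_right_le_one_le)
  have "1 - norm (cnj c * z) \<le> norm (1 - cnj c * z)"
    using norm_triangle_ineq2[of 1 "cnj c * z"] by simp
  with le show "1 - norm z \<le> norm (1 - cnj c * z)" "1 - norm c \<le> norm (1 - cnj c * z)" by linarith+
  then show "1 - cnj c * z \<noteq> 0" using assms by force
qed

lemma mob_norm_less_one:
  assumes "norm a < 1" "norm z < 1" shows "norm (mob a z) < 1"
  using Moebius_function_norm_lt_1[OF assms, of 0]
  by (simp add: mob_def Moebius_function_def norm_divide norm_minus_commute)

lemma mob_holomorphic: "norm a < 1 \<Longrightarrow> mob a holomorphic_on ball 0 1"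
  unfolding mob_def using one_minus_cnj_mult_bounds(3)
  by (intro holomorphic_intros) auto

text \<open>Comes from |1 - cnj a w|^2 - |a - w|^2 = (1 - |a|^2) (1 - |w|^2). It identifies the
  coefficient in the derivatives of a transformed atom with 1 - |c|^2 for c = phi_a(w).\<close>

lemma one_minus_mob_sq:
  assumes "norm a < 1" "norm w < 1"
  shows "1 - (norm (mob a w))\<^sup>2 = (dw a) * (dw w) / (norm (1 - cnj a * w))\<^sup>2"
proof -
  have nz: "1 - cnj a * w \<noteq> 0" by (rule one_minus_cnj_mult_bounds(3)[OF assms])
  have "complex_of_real ((norm (1 - cnj a * w))\<^sup>2 - (norm (a - w))\<^sup>2)
      = complex_of_real ((dw a) * (dw w))"
    by (simp only: of_real_diff of_real_mult of_real_1 complex_norm_square complex_cnj_diff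
      complex_cnj_mult complex_cnj_cnj complex_cnj_one) (simp add: algebra_simps)
  then have "(norm (1 - cnj a * w))\<^sup>2 - (norm (a - w))\<^sup>2 = (dw a) * (dw w)"
    by (simp only: of_real_eq_iff)
  then show ?thesis
    using nz by (simp add: mob_def norm_divide power_divide field_simps)
qed

text \<open>Both phi_a and the atom composed with phi_a are linear fractional, so one formula covers
  the two; \<open>\<beta> + \<alpha> * \<gamma>\<close> is the determinant of the map.\<close>

lemma higher_deriv_linear_fractional:
  fixes \<alpha> \<beta> \<gamma> :: complex
  assumes g: "norm \<gamma> < 1" and z: "z \<in> ball 0 1"
  shows "(deriv ^^ Suc k) (\<lambda>x. (\<alpha> + \<beta> * x) / (1 - \<gamma> * x)) z
    = (\<beta> + \<alpha> * \<gamma>) * fact (Suc k) * \<gamma> ^ k / (1 - \<gamma> * z) ^ (k + 2)"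
  using z
proof (induction k arbitrary: z)
  case 0
  have nz: "1 - \<gamma> * z \<noteq> 0"
    using one_minus_cnj_mult_bounds(3)[of "cnj \<gamma>" z] g 0 by simp
  have "((\<lambda>x. (\<alpha> + \<beta> * x) / (1 - \<gamma> * x)) has_field_derivative
      (\<beta> * (1 - \<gamma> * z) - (\<alpha> + \<beta> * z) * (- \<gamma>)) / ((1 - \<gamma> * z) * (1 - \<gamma> * z))) (at z)"
    using nz by (auto intro!: derivative_eq_intros)
  then show ?case
    by (simp add: DERIV_imp_deriv power2_eq_square algebra_simps)
next
  case (Suc k)
  define K where "K = (\<beta> + \<alpha> * \<gamma>) * fact (Suc k) * \<gamma> ^ k"
  have nz: "1 - \<gamma> * z \<noteq> 0"
    using one_minus_cnj_mult_bounds(3)[of "cnj \<gamma>" z] g Suc.prems by simp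
  have "deriv ((deriv ^^ Suc k) (\<lambda>x. (\<alpha> + \<beta> * x) / (1 - \<gamma> * x))) z = deriv (\<lambda>z. K / (1 - \<gamma> * z) ^ (k + 2)) z"
  proof (rule deriv_cong_ev[OF _ refl])
    have "\<forall>\<^sub>F x in nhds z. x \<in> ball 0 1" using Suc.prems by (intro eventually_nhds_in_open) auto
    then show "\<forall>\<^sub>F x in nhds z. (deriv ^^ Suc k) (\<lambda>x. (\<alpha> + \<beta> * x) / (1 - \<gamma> * x)) x = K / (1 - \<gamma> * x) ^ (k + 2)"
      unfolding K_def by eventually_elim (rule Suc.IH)
  qed
  also have "\<dots> = K * (of_nat (k + 2) * \<gamma>) / (1 - \<gamma> * z) ^ (k + 3)"
  proof (rule DERIV_imp_deriv)
    have d1: "((\<lambda>z. 1 - \<gamma> * z) has_field_derivative - \<gamma>) (at z)"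
      by (auto intro!: derivative_eq_intros)
    have d2: "((\<lambda>z. (1 - \<gamma> * z) ^ (k + 2)) has_field_derivative
        of_nat (k + 2) * (1 - \<gamma> * z) ^ (k + 1) * (- \<gamma>)) (at z)"
      by (rule DERIV_cong[OF DERIV_power[OF d1]]) simp
    have "((\<lambda>z. K / (1 - \<gamma> * z) ^ (k + 2)) has_field_derivative
      (0 * (1 - \<gamma> * z) ^ (k + 2) - K * (of_nat (k + 2) * (1 - \<gamma> * z) ^ (k + 1) * (- \<gamma>)))
        / ((1 - \<gamma> * z) ^ (k + 2) * (1 - \<gamma> * z) ^ (k + 2))) (at z)"
      by (rule DERIV_divide[OF DERIV_const d2]) (use nz in simp)
    moreover have "(0 * (1 - \<gamma> * z) ^ (k + 2) - K * (of_nat (k + 2) * (1 - \<gamma> * z) ^ (k + 1) * (- \<gamma>)))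
        / ((1 - \<gamma> * z) ^ (k + 2) * (1 - \<gamma> * z) ^ (k + 2)) = K * (of_nat (k + 2) * \<gamma>) / (1 - \<gamma> * z) ^ (k + 3)"
      using nz by (simp add: divide_simps power_add power2_eq_square power3_eq_cube)
    ultimately show "((\<lambda>z. K / (1 - \<gamma> * z) ^ (k + 2)) has_field_derivative
      K * (of_nat (k + 2) * \<gamma>) / (1 - \<gamma> * z) ^ (k + 3)) (at z)" by simp
  qed
  finally show ?case
    by (simp add: K_def mult_ac numeral_3_eq_3)
qed

text \<open>For \<open>k \<ge> 1\<close> the derivative of order \<open>k\<close> of \<open>\<phi>\<^sub>c\<close> at \<open>z\<close>, multiplied by \<open>(1 - |z|\<^sup>2)\<^sup>k\<close>, has
  absolute value \<open>k! |c|\<^bsup>k-1\<^esup> X\<^sup>k e\<close>, where \<open>X\<close> and \<open>e\<close> are the following quotients.\<close>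

definition mob_X :: "complex \<Rightarrow> complex \<Rightarrow> real" where
  "mob_X c z = (dw z) / norm (1 - cnj c * z)"

definition mob_e :: "complex \<Rightarrow> complex \<Rightarrow> real" where
  "mob_e c z = (dw c) / norm (1 - cnj c * z)"

lemma mob_X_e_bounds:
  assumes "norm c < 1" "norm z < 1"
  shows "0 \<le> mob_X c z" "mob_X c z \<le> 2" "0 \<le> mob_e c z" "mob_e c z \<le> 2"
proof -
  have "(norm z)\<^sup>2 < 1" "(norm c)\<^sup>2 < 1" using assms by (simp_all add: abs_square_less_1)
  then show "0 \<le> mob_X c z" "0 \<le> mob_e c z" by (simp_all add: mob_X_def mob_e_def)
  have *: "1 - (norm x)\<^sup>2 \<le> 2 * (1 - norm x)" if "norm x < 1" for x :: complex
  proof -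
    have "1 - (norm x)\<^sup>2 = (1 + norm x) * (1 - norm x)" by (simp add: power2_eq_square algebra_simps)
    also have "\<dots> \<le> 2 * (1 - norm x)" using that by (intro mult_right_mono) auto
    finally show ?thesis .
  qed
  have "norm (1 - cnj c * z) > 0" using one_minus_cnj_mult_bounds(3)[OF assms] by simp
  then show "mob_X c z \<le> 2" "mob_e c z \<le> 2"
    using *[OF assms(1)] *[OF assms(2)] one_minus_cnj_mult_bounds[OF assms]
    by (auto simp: mob_X_def mob_e_def divide_le_eq)
qed

text \<open>Two points enter because a power of phi_a times a transformed atom has poles governed by
  a and by c = phi_a(w). The factor \<open>mob_e\<close> makes the p-th power integrable with a
  bound uniform in the point; at order 0 only boundedness is asked.\<close>

definition mob_B :: "complex \<Rightarrow> complex \<Rightarrow> complex \<Rightarrow> nat \<Rightarrow> real" where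
  "mob_B a c z k = (if k = 0 then 1 else mob_X a z ^ k * mob_e a z + mob_X c z ^ k * mob_e c z)"

text \<open>Stated at a single point z with the constant as an argument, so that uniformity in a, c
  and z is expressed by choosing \<open>C\<close> before them. Holomorphy is included for the
  Leibniz rule.\<close>

definition mob_bounded :: "nat \<Rightarrow> complex \<Rightarrow> complex \<Rightarrow> complex \<Rightarrow> real \<Rightarrow> (complex \<Rightarrow> complex) \<Rightarrow> bool" where
  "mob_bounded n a c z C F \<longleftrightarrow> F holomorphic_on ball 0 1 \<and>
    (\<forall>k\<le>n. dw z ^ k * norm ((deriv ^^ k) F z) \<le> C * mob_B a c z k)"

lemma mob_B_nonneg: "norm a < 1 \<Longrightarrow> norm c < 1 \<Longrightarrow> norm z < 1 \<Longrightarrow> 0 \<le> mob_B a c z k"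
  by (simp add: mob_B_def mob_X_e_bounds)

lemma mob_B_0 [simp]: "mob_B a c z 0 = 1"
  by (simp add: mob_B_def)

lemma power_mult_power_le_sum:
  fixes x y :: real
  assumes "0 \<le> x" "0 \<le> y" "i \<le> k"
  shows "x ^ i * y ^ (k - i) \<le> x ^ k + y ^ k"
proof (cases "x \<le> y")
  case True
  then have "x ^ i * y ^ (k - i) \<le> y ^ i * y ^ (k - i)"
    using assms by (intro mult_right_mono power_mono) auto
  also have "\<dots> = y ^ k" using assms by (simp flip: power_add)
  finally show ?thesis using assms by (simp add: add_increasing)
next
  case False
  then have "x ^ i * y ^ (k - i) \<le> x ^ i * x ^ (k - i)"
    using assms by (intro mult_left_mono power_mono) auto
  also have "\<dots> = x ^ k" using assms by (simp flip: power_add)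
  finally show ?thesis using assms by (simp add: add_increasing2)
qed

text \<open>A mixed product x^i y^(k-i) is at most x^k + y^k. Every term carries two factors
  \<open>mob_e\<close>, and since these are at most 2 one of them is given up: the pure terms
  contribute 2 and the mixed ones 4 to the constant 6.\<close>

lemma mob_B_mult_le:
  assumes a: "norm a < 1" and c: "norm c < 1" and z: "norm z < 1" and ik: "i \<le> k"
  shows "mob_B a c z i * mob_B a c z (k - i) \<le> 6 * mob_B a c z k"
proof (cases "i = 0 \<or> i = k")
  case True
  then show ?thesis using mob_B_nonneg[OF a c z, of k] by (auto simp: mob_B_0)
next
  case False
  define x y e d where "x = mob_X a z" and "y = mob_X c z" and "e = mob_e a z" and "d = mob_e c z"
  have xy: "0 \<le> x" "0 \<le> y" "0 \<le> e" "e \<le> 2" "0 \<le> d" "d \<le> 2"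
    using mob_X_e_bounds[OF a z] mob_X_e_bounds[OF c z] by (auto simp: x_def y_def e_def d_def)
  have xk: "x ^ i * x ^ (k - i) = x ^ k" "y ^ i * y ^ (k - i) = y ^ k"
    using ik by (simp_all flip: power_add)
  have "(x ^ i * e + y ^ i * d) * (x ^ (k - i) * e + y ^ (k - i) * d)
    = (x ^ i * x ^ (k - i)) * (e * e) + (y ^ i * y ^ (k - i)) * (d * d) + (x ^ i * y ^ (k - i) + y ^ i * x ^ (k - i)) * (e * d)"
    by (simp add: algebra_simps)
  also have "\<dots> \<le> x ^ k * (2 * e) + y ^ k * (2 * d) + ((x ^ k + y ^ k) + (x ^ k + y ^ k)) * (e * d)"
    unfolding xk using xy power_mult_power_le_sum[of x y i k] power_mult_power_le_sum[of y x i k] ik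
    by (intro add_mono mult_left_mono mult_right_mono mult_mono) auto
  also have "((x ^ k + y ^ k) + (x ^ k + y ^ k)) * (e * d) = 2 * (x ^ k * e * d + y ^ k * d * e)"
    by (simp add: algebra_simps)
  also have "\<dots> \<le> 2 * (x ^ k * e * 2 + y ^ k * d * 2)"
    using xy by (intro mult_left_mono add_mono) auto
  finally have "(x ^ i * e + y ^ i * d) * (x ^ (k - i) * e + y ^ (k - i) * d) \<le> 6 * (x ^ k * e + y ^ k * d)"
    by (simp add: algebra_simps)
  then show ?thesis
    using False ik by (auto simp: mob_B_def x_def y_def e_def d_def)
qed

text \<open>Leibniz rule with the weight split as A^i A^(k-i); the binomial coefficients sum to
  2^k.\<close>

lemma mob_bounded_mult:
  assumes a: "norm a < 1" and c: "norm c < 1" and z: "norm z < 1"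
    and F: "mob_bounded n a c z C F" and G: "mob_bounded n a c z D G" and CD: "0 \<le> C" "0 \<le> D"
  shows "mob_bounded n a c z (6 * 2 ^ n * C * D) (\<lambda>x. F x * G x)"
  unfolding mob_bounded_def
proof (intro conjI allI impI)
  have holo: "F holomorphic_on ball 0 1" "G holomorphic_on ball 0 1"
    using F G by (auto simp: mob_bounded_def)
  then show "(\<lambda>x. F x * G x) holomorphic_on ball 0 1" by (rule holomorphic_on_mult)
  fix k assume k: "k \<le> n"
  define A where "A = dw z"
  have A: "0 \<le> A" using z by (simp add: A_def abs_square_le_1)
  have "A ^ k * norm ((deriv ^^ k) (\<lambda>x. F x * G x) z)
    = A ^ k * norm (\<Sum>i=0..k. of_nat (k choose i) * (deriv ^^ i) F z * (deriv ^^ (k - i)) G z)"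
    using z by (subst higher_deriv_mult[OF holo]) auto
  also have "\<dots> \<le> A ^ k * (\<Sum>i=0..k. of_nat (k choose i) * norm ((deriv ^^ i) F z) * norm ((deriv ^^ (k - i)) G z))"
    using A by (intro mult_left_mono order_trans[OF norm_sum] sum_mono) (auto simp: norm_mult)
  also have "\<dots> = (\<Sum>i=0..k. of_nat (k choose i) * ((A ^ i * norm ((deriv ^^ i) F z)) * (A ^ (k - i) * norm ((deriv ^^ (k - i)) G z))))"
    unfolding sum_distrib_left
  proof (rule sum.cong[OF refl])
    fix i assume "i \<in> {0..k}"
    then have "A ^ k = A ^ i * A ^ (k - i)" by (simp flip: power_add)
    then show "A ^ k * (of_nat (k choose i) * norm ((deriv ^^ i) F z) * norm ((deriv ^^ (k - i)) G z))
      = of_nat (k choose i) * ((A ^ i * norm ((deriv ^^ i) F z)) * (A ^ (k - i) * norm ((deriv ^^ (k - i)) G z)))"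
      by (simp add: mult_ac)
  qed
  also have "\<dots> \<le> (\<Sum>i=0..k. of_nat (k choose i) * (C * D * (6 * mob_B a c z k)))"
  proof (intro sum_mono mult_left_mono)
    fix i assume i: "i \<in> {0..k}"
    have "(A ^ i * norm ((deriv ^^ i) F z)) * (A ^ (k - i) * norm ((deriv ^^ (k - i)) G z))
      \<le> (C * mob_B a c z i) * (D * mob_B a c z (k - i))"
    proof (rule mult_mono)
      show "A ^ i * norm ((deriv ^^ i) F z) \<le> C * mob_B a c z i"
        "A ^ (k - i) * norm ((deriv ^^ (k - i)) G z) \<le> D * mob_B a c z (k - i)"
        using F G i k unfolding A_def by (auto simp: mob_bounded_def)
    qed (use A CD mob_B_nonneg[OF a c z] in auto)
    also have "\<dots> = C * D * (mob_B a c z i * mob_B a c z (k - i))" by (simp add: mult_ac)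
    also have "\<dots> \<le> C * D * (6 * mob_B a c z k)"
      using CD i by (intro mult_left_mono mob_B_mult_le[OF a c z]) auto
    finally show "(A ^ i * norm ((deriv ^^ i) F z)) * (A ^ (k - i) * norm ((deriv ^^ (k - i)) G z)) \<le> C * D * (6 * mob_B a c z k)" .
  qed auto
  also have "\<dots> = 2 ^ k * (C * D * (6 * mob_B a c z k))"
  proof -
    have "(\<Sum>i=0..k. of_nat (k choose i)) = (2::real) ^ k"
      using choose_row_sum[of k] by (simp flip: of_nat_sum atLeast0AtMost)
    then show ?thesis by (simp flip: sum_distrib_right)
  qed
  also have "\<dots> \<le> 2 ^ n * (C * D * (6 * mob_B a c z k))"
    using k CD mob_B_nonneg[OF a c z] by (intro mult_right_mono power_increasing) auto
  finally show "dw z ^ k * norm ((deriv ^^ k) (\<lambda>x. F x * G x) z) \<le> 6 * 2 ^ n * C * D * mob_B a c z k"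
    by (simp add: A_def mult_ac)
qed

text \<open>Order 0 is |phi_a| < 1; for higher orders the explicit derivative is k! |a|^(k-1) times
  the summand of \<open>mob_B\<close> for a, and the power of |a| is discarded. The point
  \<open>c\<close> is left free so that the bound can be multiplied with one for an atom.\<close>

lemma mob_bounded_mob:
  assumes a: "norm a < 1" and c: "norm c < 1" and z: "norm z < 1"
  shows "mob_bounded n a c z (fact n) (mob a)"
  unfolding mob_bounded_def
proof (intro conjI allI impI)
  show "mob a holomorphic_on ball 0 1" using a by (rule mob_holomorphic)
  fix k assume k: "k \<le> n"
  define A N where "A = 1 - (norm z)\<^sup>2" and "N = norm (1 - cnj a * z)"
  have A: "0 \<le> A" using z by (simp add: A_def abs_square_le_1)
  have N: "0 < N" using one_minus_cnj_mult_bounds(3)[OF a z] by (simp add: N_def)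
  show "dw z ^ k * norm ((deriv ^^ k) (mob a) z) \<le> fact n * mob_B a c z k"
  proof (cases k)
    case 0
    then show ?thesis
      using order.trans[OF less_imp_le[OF mob_norm_less_one[OF a z]] fact_ge_1[of n]] by simp
  next
    case (Suc l)
    have eq: "mob a = (\<lambda>x. (a + (-1) * x) / (1 - cnj a * x))"
      by (auto simp: mob_def fun_eq_iff)
    have "(deriv ^^ Suc l) (mob a) z = (-1 + a * cnj a) * fact (Suc l) * cnj a ^ l / (1 - cnj a * z) ^ (l + 2)"
      unfolding eq by (rule higher_deriv_linear_fractional) (use a z in auto)
    moreover have "norm (-1 + a * cnj a) = 1 - (norm a)\<^sup>2"
    proof -
      have "-1 + a * cnj a = of_real ((norm a)\<^sup>2 - 1)" by (simp only: of_real_diff of_real_1 complex_norm_square) simp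
      then have "norm (-1 + a * cnj a) = \<bar>(norm a)\<^sup>2 - 1\<bar>" by (simp only: norm_of_real)
      then show ?thesis using a by (simp add: abs_square_le_1 abs_of_nonpos)
    qed
    ultimately have "A ^ k * norm ((deriv ^^ k) (mob a) z)
        = fact k * norm a ^ l * (A ^ k * (dw a) / N ^ (k + 1))"
      using Suc by (simp add: norm_mult norm_divide norm_power norm_fact N_def mult_ac del: fact_Suc)
    also have "\<dots> = fact k * norm a ^ l * (mob_X a z ^ k * mob_e a z)"
      by (simp add: mob_X_def mob_e_def A_def N_def power_divide)
    also have "\<dots> \<le> fact n * 1 * mob_B a c z k"
      using Suc k a mob_X_e_bounds[OF a z] mob_X_e_bounds[OF c z]
      by (intro mult_mono fact_mono) (auto simp: mob_B_def power_le_one intro!: mult_nonneg_nonneg)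
    finally show ?thesis by (simp add: A_def)
  qed
qed

text \<open>With c = phi_a(w) and M = 1 - cnj w a, the product of 1 - cnj w phi_a(x) and 1 - cnj a x
  is M (1 - cnj c x). The composed atom is thus linear fractional in x with pole parameter c, and
  its determinant has modulus |w| (1 - |c|^2).\<close>

lemma mob_bounded_kernel:
  assumes a: "norm a < 1" and w: "norm w < 1" and z: "norm z < 1"
  shows "mob_bounded n a (mob a w) z (2 * fact n) (\<lambda>x. of_real (dw w) / (1 - cnj w * mob a x))"
    (is "mob_bounded _ _ _ _ _ ?E")
  unfolding mob_bounded_def
proof (intro conjI allI impI)
  have nz: "1 - cnj w * mob a x \<noteq> 0" if "norm x < 1" for x
    using one_minus_cnj_mult_bounds(3)[OF w mob_norm_less_one[OF a that]] .
  then show holo: "?E holomorphic_on ball 0 1"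
    by (intro holomorphic_intros mob_holomorphic a) auto
  define c where "c = mob a w"
  have c: "norm c < 1" unfolding c_def by (rule mob_norm_less_one[OF a w])
  define W where "W = complex_of_real (dw w)"
  have nW: "norm W = 1 - (norm w)\<^sup>2"
    using w by (simp add: W_def abs_square_le_1 del: of_real_diff)
  define M where "M = 1 - cnj w * a"
  have M: "M \<noteq> 0" unfolding M_def by (rule one_minus_cnj_mult_bounds(3)[OF w a])
  have cc: "cnj c = (cnj a - cnj w) / M"
    by (simp add: c_def mob_def M_def mult.commute)
  have E_eq: "?E x = (W / M + (- (W / M) * cnj a) * x) / (1 - cnj c * x)" if x: "norm x < 1" for x
  proof -
    have n1: "1 - cnj a * x \<noteq> 0" by (rule one_minus_cnj_mult_bounds(3)[OF a x])
    have n2: "1 - cnj c * x \<noteq> 0" by (rule one_minus_cnj_mult_bounds(3)[OF c x])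
    have "(1 - cnj w * mob a x) * (1 - cnj a * x) = M * (1 - cnj c * x)"
      using n1 M by (simp add: mob_def cc M_def field_simps)
    then have "1 - cnj w * mob a x = M * (1 - cnj c * x) / (1 - cnj a * x)"
      using n1 by (simp add: field_simps)
    then have "?E x = W * (1 - cnj a * x) / (M * (1 - cnj c * x))"
      using n1 by (simp add: W_def)
    also have "\<dots> = (W / M + (- (W / M) * cnj a) * x) / (1 - cnj c * x)"
      using M n2 by (simp add: field_simps)
    finally show ?thesis .
  qed
  fix k assume k: "k \<le> n"
  define A N where "A = 1 - (norm z)\<^sup>2" and "N = norm (1 - cnj c * z)"
  have A: "0 \<le> A" using z by (simp add: A_def abs_square_le_1)
  have N: "0 < N" using one_minus_cnj_mult_bounds(3)[OF c z] by (simp add: N_def)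
  have "dw z ^ k * norm ((deriv ^^ k) ?E z) \<le> 2 * fact n * mob_B a c z k"
  proof (cases k)
    case 0
    have m: "norm (mob a z) < 1" by (rule mob_norm_less_one[OF a z])
    have "norm (?E z) = mob_e w (mob a z)"
      unfolding mob_e_def nW[symmetric] W_def[symmetric] by (simp add: norm_divide)
    also have "\<dots> \<le> 2 * 1" using mob_X_e_bounds[OF w m] by simp
    also have "\<dots> \<le> 2 * fact n" using fact_ge_1[of n, where 'a = real] by (intro mult_left_mono) auto
    finally show ?thesis using 0 by (simp add: mob_B_def)
  next
    case (Suc l)
    have "(deriv ^^ k) ?E z = (deriv ^^ k) (\<lambda>x. (W / M + (- (W / M) * cnj a) * x) / (1 - cnj c * x)) z"
    proof (rule higher_deriv_transform_within_open[OF holo])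
      show "(\<lambda>x. (W / M + (- (W / M) * cnj a) * x) / (1 - cnj c * x)) holomorphic_on ball 0 1"
        using one_minus_cnj_mult_bounds(3)[OF c] by (intro holomorphic_intros) auto
    qed (use z E_eq in auto)
    also have "\<dots> = (- (W / M) * cnj a + W / M * cnj c) * fact (Suc l) * cnj c ^ l / (1 - cnj c * z) ^ (l + 2)"
      unfolding Suc by (rule higher_deriv_linear_fractional) (use c z in auto)
    also have "- (W / M) * cnj a + W / M * cnj c = - (cnj w * (W * of_real (dw a) / M\<^sup>2))"
    proof -
      have r1: "of_real (dw a) = 1 - a * cnj a"
        by (simp only: of_real_diff of_real_1 complex_norm_square)
      have r2: "cnj c - cnj a = - cnj w * (1 - a * cnj a) / M"
        using M by (simp add: cc field_simps M_def)
      have "- (W / M) * cnj a + W / M * cnj c = W / M * (cnj c - cnj a)"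
        by (simp add: algebra_simps)
      also have "\<dots> = - (cnj w * (W * of_real (dw a) / M\<^sup>2))"
        unfolding r1 r2 by (simp add: power2_eq_square)
      finally show ?thesis .
    qed
    finally have D: "(deriv ^^ k) ?E z = - (cnj w * (W * of_real (dw a) / M\<^sup>2)) * fact (Suc l) * cnj c ^ l / (1 - cnj c * z) ^ (l + 2)" .
    define Q where "Q = W * of_real (dw a) / M\<^sup>2"
    have nQ: "norm Q = 1 - (norm c)\<^sup>2"
    proof -
      have "norm M = norm (1 - cnj a * w)"
        unfolding M_def by (metis complex_cnj_cnj complex_cnj_diff complex_cnj_mult complex_cnj_one complex_mod_cnj mult.commute)
      moreover have "norm (complex_of_real (dw a)) = 1 - (norm a)\<^sup>2"
        using a by (simp only: norm_of_real) (simp add: abs_square_le_1)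
      ultimately show ?thesis
        unfolding Q_def c_def one_minus_mob_sq[OF a w] norm_divide norm_mult nW norm_power by (simp only: mult.commute)
    qed
    then have "A ^ k * norm ((deriv ^^ k) ?E z)
        = fact k * (norm w * norm c ^ l) * (A ^ k * (dw c) / N ^ (k + 1))"
      unfolding D Q_def[symmetric] nQ[symmetric] using Suc by (simp add: norm_mult norm_divide norm_power norm_fact N_def mult_ac del: fact_Suc)
    also have "\<dots> = fact k * (norm w * norm c ^ l) * (mob_X c z ^ k * mob_e c z)"
      by (simp add: mob_X_def mob_e_def A_def N_def power_divide)
    also have "\<dots> \<le> fact n * 1 * mob_B a c z k"
      using Suc k w c mob_X_e_bounds[OF a z] mob_X_e_bounds[OF c z]
      by (intro mult_mono fact_mono) (auto simp: mob_B_def power_le_one intro!: mult_nonneg_nonneg mult_le_one)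
    also have "\<dots> \<le> 2 * fact n * mob_B a c z k"
      using mob_B_nonneg[OF a c z, of k] by (intro mult_right_mono) auto
    finally show ?thesis by (simp add: A_def)
  qed
  then show "dw z ^ k * norm ((deriv ^^ k) ?E z) \<le> 2 * fact n * mob_B a (mob a w) z k"
    by (simp add: c_def)
qed

lemma mob_bounded_mob_power:
  "\<exists>C\<ge>0. \<forall>a c z. norm a < 1 \<longrightarrow> norm c < 1 \<longrightarrow> norm z < 1 \<longrightarrow> mob_bounded n a c z C (\<lambda>x. mob a x ^ m)"
proof (induction m)
    case 0
    have "mob_bounded n a c z 1 (\<lambda>x. 1)" if "norm a < 1" "norm c < 1" "norm z < 1" for a c z
      by (auto simp: mob_bounded_def mob_B_nonneg[OF that])
    then show ?case by (intro exI[of _ 1]) simp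
  next
    case (Suc m)
    then obtain C where C: "C \<ge> 0" "\<forall>a c z. norm a < 1 \<longrightarrow> norm c < 1 \<longrightarrow> norm z < 1 \<longrightarrow> mob_bounded n a c z C (\<lambda>x. mob a x ^ m)"
      by (elim exE conjE)
    have "mob_bounded n a c z (6 * 2 ^ n * fact n * C) (\<lambda>x. mob a x ^ Suc m)"
      if "norm a < 1" "norm c < 1" "norm z < 1" for a c z
      using mob_bounded_mult[OF that mob_bounded_mob[OF that, of n] C(2)[rule_format, OF that]] C(1) by simp
    then show ?case using C(1) by (intro exI[of _ "6 * 2 ^ n * fact n * C"]) simp
qed

section \<open>Uniform integral bounds\<close>

lemma nn_integral_powr_to_inf:
  assumes "s > 1" "(a::real) > 0"
  shows "(\<integral>\<^sup>+x. ennreal (x powr - s) * indicator {a..} x \<partial>lborel) = ennreal (a powr (1 - s) / (s - 1))"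
proof -
  have "((\<lambda>x. x powr - s) has_integral -(a powr (- s + 1)) / (- s + 1)) {a..}"
    using assms by (intro has_integral_powr_to_inf) auto
  also have "-(a powr (- s + 1)) / (- s + 1) = a powr (1 - s) / (s - 1)"
    using assms by (simp add: divide_simps) (simp add: algebra_simps)
  finally show ?thesis by (rule nn_integral_has_integral_lebesgue'[rotated]) simp
qed

lemma nn_integral_powr_from_0:
  assumes "\<alpha> > -1" "(c::real) \<ge> 0"
  shows "(\<integral>\<^sup>+x. ennreal (x powr \<alpha>) * indicator {0..c} x \<partial>lborel) = ennreal (c powr (\<alpha> + 1) / (\<alpha> + 1))"
  by (rule nn_integral_has_integral_lebesgue'[OF _ has_integral_powr_from_0[OF assms]]) simp

text \<open>Taylor's formula with remainder x^3 / 6, where x^2 <= 4 because pi / 2 < 2.\<close>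

lemma sin_ge_third:
  assumes "0 \<le> x" "x \<le> pi / 2" shows "x / 3 \<le> sin (x::real)"
proof -
  have "\<bar>sin x - (\<Sum>m<3. sin_coeff m * x ^ m)\<bar> \<le> inverse (fact 3) * \<bar>x\<bar> ^ 3"
    by (rule Maclaurin_sin_bound)
  moreover have "(\<Sum>m<3. sin_coeff m * x ^ m) = x"
    by (simp add: numeral_3_eq_3 sin_coeff_def)
  ultimately have "\<bar>sin x - x\<bar> \<le> x ^ 3 / 6"
    using assms by (simp add: fact_numeral)
  then have "x - x ^ 3 / 6 \<le> sin x"
    by (simp only: abs_le_iff) linarith
  moreover have "x ^ 3 \<le> 4 * x"
  proof -
    have "x * x \<le> 2 * 2" using assms pi_less_4 by (intro mult_mono) linarith+
    then have "x * (x * x) \<le> x * 4" using assms by (intro mult_left_mono) auto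
    then show ?thesis by (simp add: power3_eq_cube mult_ac)
  qed
  ultimately show ?thesis by linarith
qed

text \<open>For r < 1/2 the modulus is at least 1/2 while 1 - r + |t| <= 5. Otherwise |1 - r cis
  t|^2 = (1 - r)^2 + 4 r sin^2(t/2) with 4 r >= 2, and sin(|t|/2) >= |t|/6 produces the term t^2 /
  18.\<close>

lemma one_minus_cis_lower_bound:
  assumes r: "0 \<le> r" "r < 1" and t: "\<bar>t\<bar> \<le> pi"
  shows "(1 - r + \<bar>t\<bar>) / 10 \<le> norm (1 - of_real r * cis t)"
proof (cases "r < 1 / 2")
  case True
  have "1 - r \<le> norm (1 - of_real r * cis t)"
    using norm_triangle_ineq2[of 1 "of_real r * cis t"] r by (simp add: norm_mult)
  moreover have "1 - r + \<bar>t\<bar> \<le> 5" using r t pi_less_4 by linarith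
  moreover have "1 / 2 \<le> 1 - r" using True by simp
  ultimately have "1 - r + \<bar>t\<bar> \<le> norm (1 - of_real r * cis t) * 10" by linarith
  then show ?thesis by simp
next
  case False
  have "(norm (1 - of_real r * cis t))\<^sup>2 = (1 - r * cos t)\<^sup>2 + (r * sin t)\<^sup>2"
    by (simp add: cmod_power2)
  also have "\<dots> = (1 - r)\<^sup>2 + 2 * r * (1 - cos t)"
  proof -
    have "(1 - r * cos t)\<^sup>2 + (r * sin t)\<^sup>2 = 1 - 2 * r * cos t + r\<^sup>2 * ((sin t)\<^sup>2 + (cos t)\<^sup>2)"
      by algebra
    then show ?thesis by (simp only: sin_cos_squared_add) (simp add: power2_eq_square algebra_simps)
  qed
  also have "1 - cos t = 2 * (sin (\<bar>t\<bar> / 2))\<^sup>2"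
  proof -
    have "cos t = cos (2 * (\<bar>t\<bar> / 2))" by simp
    then show ?thesis by (simp only: cos_double_sin)
  qed
  finally have eq: "(norm (1 - of_real r * cis t))\<^sup>2 = (1 - r)\<^sup>2 + 4 * r * (sin (\<bar>t\<bar> / 2))\<^sup>2" by simp
  have "(\<bar>t\<bar> / 2 / 3)\<^sup>2 \<le> (sin (\<bar>t\<bar> / 2))\<^sup>2"
    using t by (intro power_mono sin_ge_third) auto
  moreover have "2 * (sin (\<bar>t\<bar> / 2))\<^sup>2 \<le> 4 * r * (sin (\<bar>t\<bar> / 2))\<^sup>2"
    using False by (intro mult_right_mono) auto
  ultimately have ge: "(1 - r)\<^sup>2 + t\<^sup>2 / 18 \<le> (norm (1 - of_real r * cis t))\<^sup>2"
    unfolding eq by (simp add: power_divide)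
  have "((1 - r + \<bar>t\<bar>) / 10)\<^sup>2 \<le> (1 - r)\<^sup>2 + t\<^sup>2 / 18"
  proof -
    have "0 \<le> (1 - r - \<bar>t\<bar>)\<^sup>2" by simp
    then have "(1 - r + \<bar>t\<bar>)\<^sup>2 \<le> 2 * (1 - r)\<^sup>2 + 2 * \<bar>t\<bar>\<^sup>2"
      by (simp add: power2_eq_square algebra_simps)
    then have "((1 - r + \<bar>t\<bar>) / 10)\<^sup>2 \<le> (2 * (1 - r)\<^sup>2 + 2 * t\<^sup>2) / 100"
      by (simp add: power_divide)
    also have "\<dots> \<le> (1 - r)\<^sup>2 + t\<^sup>2 / 18"
      using zero_le_power2[of "1 - r"] zero_le_power2[of t] by argo
    finally show ?thesis .
  qed
  then have "((1 - r + \<bar>t\<bar>) / 10)\<^sup>2 \<le> (norm (1 - of_real r * cis t))\<^sup>2"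
    using ge by linarith
  then show ?thesis by (rule power2_le_imp_le) simp
qed

text \<open>The interval \<open>[\<tau> - \<pi>, \<tau> + \<pi>]\<close> is covered by three translates of \<open>[-\<pi>, \<pi>]\<close>, which makes the
  bound independent of the argument \<open>\<tau>\<close> of \<open>\<zeta>\<close>.\<close>

lemma circle_integral_bound:
  fixes \<zeta> :: complex
  assumes s: "s > 1" and z: "norm \<zeta> < 1"
  shows "(\<integral>\<^sup>+t. ennreal (norm (1 - cis t * \<zeta>) powr - s) * indicator {-pi..pi} t \<partial>lborel)
    \<le> ennreal (6 * 10 powr s / (s - 1) * (1 - norm \<zeta>) powr (1 - s))"
proof -
  define r \<tau> where "r = norm \<zeta>" and "\<tau> = Arg \<zeta>"
  define h where "h t = norm (1 - of_real r * cis t) powr - s" for t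
  have r: "0 \<le> r" "r < 1" using z by (simp_all add: r_def)
  have zeta: "\<zeta> = of_real r * cis \<tau>"
    by (metis r_def \<tau>_def rcis_cmod_Arg rcis_def)
  have [measurable]: "h \<in> borel_measurable borel"
  proof -
    have "(\<lambda>t. norm (1 - of_real r * cis t)) \<in> borel_measurable borel"
      by (intro borel_measurable_continuous_onI continuous_intros)
    then show ?thesis unfolding h_def by simp
  qed
  have tau: "\<bar>\<tau>\<bar> \<le> pi" using Arg_bounded[of \<zeta>] by (auto simp: \<tau>_def)
  have per: "h (t + 2 * pi) = h t" "h (t - 2 * pi) = h t" for t
    unfolding h_def by (simp_all flip: cis_mult cis_divide)
  define k where "k t = ennreal (h t) * indicator {-pi..pi} t" for t
  have [measurable]: "k \<in> borel_measurable borel" unfolding k_def by measurable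
  have "(\<integral>\<^sup>+t. ennreal (norm (1 - cis t * \<zeta>) powr - s) * indicator {-pi..pi} t \<partial>lborel)
      = (\<integral>\<^sup>+t. ennreal (h (\<tau> + t)) * indicator {-pi..pi} t \<partial>lborel)"
    by (intro nn_integral_cong) (simp add: h_def zeta cis_mult mult_ac add.commute flip: cis_mult)
  also have "\<dots> \<le> (\<integral>\<^sup>+t. k (\<tau> + t) + k ((\<tau> + 2 * pi) + t) + k ((\<tau> - 2 * pi) + t) \<partial>lborel)"
  proof (rule nn_integral_mono)
    fix t
    show "ennreal (h (\<tau> + t)) * indicator {-pi..pi} t \<le> k (\<tau> + t) + k ((\<tau> + 2 * pi) + t) + k ((\<tau> - 2 * pi) + t)"
    proof (cases "t \<in> {-pi..pi}")
      case True
      have h1: "h (\<tau> + 2 * pi + t) = h (\<tau> + t)" "h (\<tau> - 2 * pi + t) = h (\<tau> + t)"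
        using per[of "\<tau> + t"] by (simp_all add: algebra_simps)
      \<comment> \<open>Since |\<tau> + t| <= 2 pi, one of the three translates lands in [-pi, pi],
        and by periodicity \<open>h\<close> has the same value there.\<close>
      consider "\<tau> + t \<in> {-pi..pi}" | "\<tau> + 2 * pi + t \<in> {-pi..pi}" | "\<tau> - 2 * pi + t \<in> {-pi..pi}"
        using True tau by (auto simp: abs_le_iff) linarith
      then show ?thesis
        using True by cases (auto simp: k_def h1 add_increasing add_increasing2 indicator_def)
    qed simp
  qed
  also have "\<dots> = (\<integral>\<^sup>+t. k (\<tau> + t) \<partial>lborel) + (\<integral>\<^sup>+t. k ((\<tau> + 2 * pi) + t) \<partial>lborel) + (\<integral>\<^sup>+t. k ((\<tau> - 2 * pi) + t) \<partial>lborel)"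
    by (simp add: nn_integral_add)
  also have "\<dots> = 3 * (\<integral>\<^sup>+t. k t \<partial>lborel)"
  proof -
    have "3 * x = (1 + 1 + 1) * x" for x :: ennreal by simp
    then have "3 * x = x + x + x" for x :: ennreal by (simp only: distrib_right mult_1_left)
    then show ?thesis by (simp only: nn_integral_lborel_translation \<open>k \<in> borel_measurable borel\<close>)
  qed
  also have "(\<integral>\<^sup>+t. k t \<partial>lborel) \<le> ennreal (2 * 10 powr s / (s - 1) * (1 - r) powr (1 - s))"
  proof -
    \<comment> \<open>For t >= 0 the quantity 1 - r + |t| is the argument of the translate of
      \<open>m\<close>, for t < 0 that of the reflected copy; each integrates to the tail of x^(-s)
      from 1 - r on.\<close>
    define m where "m x = ennreal (x powr - s) * indicator {1 - r..} x" for x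
    have [measurable]: "m \<in> borel_measurable borel" unfolding m_def by measurable
    have m: "(\<integral>\<^sup>+x. m x \<partial>lborel) = ennreal ((1 - r) powr (1 - s) / (s - 1))"
      unfolding m_def using s r by (intro nn_integral_powr_to_inf) auto
    have "(\<integral>\<^sup>+t. k t \<partial>lborel) \<le> (\<integral>\<^sup>+t. ennreal (10 powr s) * (m ((1 - r) + t) + m ((1 - r) - t)) \<partial>lborel)"
    proof (rule nn_integral_mono)
      fix t
      show "k t \<le> ennreal (10 powr s) * (m ((1 - r) + t) + m ((1 - r) - t))"
      proof (cases "t \<in> {-pi..pi}")
        case True
        have "h t \<le> ((1 - r + \<bar>t\<bar>) / 10) powr - s"
          unfolding h_def using r s True one_minus_cis_lower_bound[OF r, of t]
          by (intro powr_mono2') (auto simp: abs_le_iff)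
        also have "\<dots> = 10 powr s * (1 - r + \<bar>t\<bar>) powr - s"
          using r by (simp add: powr_divide powr_minus_divide)
        finally have "k t \<le> ennreal (10 powr s) * ennreal ((1 - r + \<bar>t\<bar>) powr - s)"
          using True by (simp add: k_def ennreal_leI flip: ennreal_mult')
        also have "\<dots> \<le> ennreal (10 powr s) * (m ((1 - r) + t) + m ((1 - r) - t))"
        proof (intro mult_left_mono)
          show "ennreal ((1 - r + \<bar>t\<bar>) powr - s) \<le> m ((1 - r) + t) + m ((1 - r) - t)"
            by (cases "t \<ge> 0") (auto simp: m_def add_increasing add_increasing2)
        qed simp
        finally show ?thesis .
      qed (simp add: k_def)
    qed
    also have "\<dots> = ennreal (10 powr s) * ((\<integral>\<^sup>+t. m ((1 - r) + t) \<partial>lborel) + (\<integral>\<^sup>+t. m ((1 - r) - t) \<partial>lborel))"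
      by (simp add: nn_integral_cmult nn_integral_add)
    also have "\<dots> = ennreal (10 powr s) * (ennreal ((1 - r) powr (1 - s) / (s - 1)) + ennreal ((1 - r) powr (1 - s) / (s - 1)))"
      by (simp only: nn_integral_lborel_translation nn_integral_lborel_reflection \<open>m \<in> borel_measurable borel\<close> m)
    also have "\<dots> = ennreal (2 * 10 powr s / (s - 1) * (1 - r) powr (1 - s))"
      using s by (simp add: mult_ac flip: ennreal_plus ennreal_mult')
    finally show ?thesis .
  qed
  also have "3 * ennreal (2 * 10 powr s / (s - 1) * (1 - r) powr (1 - s)) = ennreal (6 * 10 powr s / (s - 1) * (1 - r) powr (1 - s))"
    using s by (simp add: ennreal_mult'[symmetric] flip: ennreal_numeral)
  finally show ?thesis by (simp add: r_def mult_left_mono)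
qed

text \<open>Split at 1 - t = d. Where 1 - t <= d the sum d + (1 - t) is replaced by d, elsewhere by
  1 - t; both pieces are of order d^(-p), the one because \<alpha> > -1, the other because p >
  0.\<close>

lemma radial_weight_integral_bound:
  assumes a: "\<alpha> > -1" and p: "p > 0" and d: "0 < d" "d \<le> 1"
  shows "(\<integral>\<^sup>+t. ennreal ((1 - t) powr \<alpha> * (d + (1 - t)) powr - (\<alpha> + 1 + p)) * indicator {0..<1} t \<partial>lborel)
    \<le> ennreal ((1 / (\<alpha> + 1) + 1 / p) * d powr - p)"
proof -
  define m1 where "m1 x = ennreal (d powr - (\<alpha> + 1 + p)) * (ennreal (x powr \<alpha>) * indicator {0..d} x)" for x
  define m2 where "m2 x = ennreal (x powr - (1 + p)) * indicator {d..} x" for x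
  have m: "m1 \<in> borel_measurable borel" "m2 \<in> borel_measurable borel"
    unfolding m1_def m2_def by measurable
  have "(\<integral>\<^sup>+t. ennreal ((1 - t) powr \<alpha> * (d + (1 - t)) powr - (\<alpha> + 1 + p)) * indicator {0..<1} t \<partial>lborel)
    \<le> (\<integral>\<^sup>+t. m1 (1 - t) + m2 (1 - t) \<partial>lborel)"
  proof (rule nn_integral_mono)
    fix t
    show "ennreal ((1 - t) powr \<alpha> * (d + (1 - t)) powr - (\<alpha> + 1 + p)) * indicator {0..<1} t \<le> m1 (1 - t) + m2 (1 - t)"
    proof (cases "t \<in> {0..<1}")
      case True
      define x where "x = 1 - t"
      have x: "x > 0" using True by (simp add: x_def)
      have "ennreal (x powr \<alpha> * (d + x) powr - (\<alpha> + 1 + p)) \<le> m1 x + m2 x"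
      proof (cases "x \<le> d")
        case True
        have "(d + x) powr - (\<alpha> + 1 + p) \<le> d powr - (\<alpha> + 1 + p)"
          using d x a p by (intro powr_mono2') auto
        then have "x powr \<alpha> * (d + x) powr - (\<alpha> + 1 + p) \<le> d powr - (\<alpha> + 1 + p) * x powr \<alpha>"
          by (subst mult.commute) (intro mult_right_mono, auto)
        then have "ennreal (x powr \<alpha> * (d + x) powr - (\<alpha> + 1 + p)) \<le> m1 x"
          using True x by (simp add: m1_def ennreal_leI flip: ennreal_mult')
        then show ?thesis by (simp add: add_increasing2)
      next
        case False
        have "(d + x) powr - (\<alpha> + 1 + p) \<le> x powr - (\<alpha> + 1 + p)"
          using d x a p by (intro powr_mono2') auto
        then have "x powr \<alpha> * (d + x) powr - (\<alpha> + 1 + p) \<le> x powr \<alpha> * x powr - (\<alpha> + 1 + p)"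
          by (intro mult_left_mono) auto
        also have "\<dots> = x powr - (1 + p)" by (simp flip: powr_add)
        finally have "ennreal (x powr \<alpha> * (d + x) powr - (\<alpha> + 1 + p)) \<le> m2 x"
          using False by (simp add: m2_def ennreal_leI)
        then show ?thesis by (simp add: add_increasing)
      qed
      then show ?thesis using True by (simp add: x_def)
    qed simp
  qed
  also have "\<dots> = (\<integral>\<^sup>+t. m1 (1 - t) \<partial>lborel) + (\<integral>\<^sup>+t. m2 (1 - t) \<partial>lborel)"
    using m by (intro nn_integral_add) auto
  also have "\<dots> = (\<integral>\<^sup>+x. m1 x \<partial>lborel) + (\<integral>\<^sup>+x. m2 x \<partial>lborel)"
    by (simp only: nn_integral_lborel_reflection m)
  also have "(\<integral>\<^sup>+x. m1 x \<partial>lborel) = ennreal (d powr - (\<alpha> + 1 + p)) * ennreal (d powr (\<alpha> + 1) / (\<alpha> + 1))"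
    unfolding m1_def using d by (subst nn_integral_cmult) (auto simp: nn_integral_powr_from_0[OF a])
  also have "\<dots> = ennreal (1 / (\<alpha> + 1) * d powr - p)"
  proof -
    have "d powr - (\<alpha> + 1 + p) * d powr (\<alpha> + 1) = d powr - p" by (simp flip: powr_add)
    then show ?thesis using a by (simp flip: ennreal_mult')
  qed
  also have "(\<integral>\<^sup>+x. m2 x \<partial>lborel) = ennreal (1 / p * d powr - p)"
    unfolding m2_def using d p by (subst nn_integral_powr_to_inf) auto
  also have "ennreal (1 / (\<alpha> + 1) * d powr - p) + ennreal (1 / p * d powr - p) = ennreal ((1 / (\<alpha> + 1) + 1 / p) * d powr - p)"
    using a p by (simp add: distrib_right flip: ennreal_plus)
  finally show ?thesis .
qed

lemma mob_X_mob_e_measurable [measurable]: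
  "mob_X c \<in> borel_measurable borel" "mob_e c \<in> borel_measurable borel"
proof -
  have "(\<lambda>z. norm (1 - cnj c * z)) \<in> borel_measurable borel"
    by (intro borel_measurable_continuous_onI continuous_intros)
  then show "mob_X c \<in> borel_measurable borel" "mob_e c \<in> borel_measurable borel"
    unfolding mob_X_def mob_e_def by measurable
qed

lemma finite_measure_disc_area: "finite_measure disc_area"
proof -
  have "emeasure disc_area (UNIV \<inter> ball 0 1) \<noteq> \<infinity>"
    by (subst emeasure_disc_area)
      (simp_all add: emeasure_ball unit_ball_vol_2 divide_ennreal_def ennreal_mult_eq_top_iff)
  then show ?thesis by (intro finite_measureI) simp
qed

text \<open>Rotation invariance and Tonelli stand in for polar coordinates: the integrand may be
  averaged over all rotations of z, so that an estimate on circles can be applied before the radial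
  one.\<close>

lemma nn_integral_disc_area_circle_average:
  fixes F :: "complex \<Rightarrow> ennreal"
  assumes F: "F \<in> borel_measurable borel"
  shows "ennreal (2 * pi) * (\<integral>\<^sup>+z. F z \<partial>disc_area)
    = (\<integral>\<^sup>+z. \<integral>\<^sup>+t. F (cis t * z) * indicator {-pi..pi} t \<partial>lborel \<partial>disc_area)"
proof -
  interpret A: finite_measure disc_area by (rule finite_measure_disc_area)
  interpret P: pair_sigma_finite lborel disc_area ..
  have "ennreal (2 * pi) * (\<integral>\<^sup>+z. F z \<partial>disc_area) = (\<integral>\<^sup>+t. (\<integral>\<^sup>+z. F z \<partial>disc_area) * indicator {-pi..pi} t \<partial>lborel)"
    by (subst nn_integral_cmult_indicator) (auto simp: mult.commute)
  also have "\<dots> = (\<integral>\<^sup>+t. \<integral>\<^sup>+z. F (cis t * z) * indicator {-pi..pi} t \<partial>disc_area \<partial>lborel)"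
  proof (rule nn_integral_cong)
    fix t
    have "(\<integral>\<^sup>+z. F (cis t * z) \<partial>disc_area) = (\<integral>\<^sup>+z. F z \<partial>disc_area)"
      using F by (intro nn_integral_disc_area_rotation borel_measurable_discI) auto
    then show "(\<integral>\<^sup>+z. F z \<partial>disc_area) * indicator {-pi..pi} t = (\<integral>\<^sup>+z. F (cis t * z) * indicator {-pi..pi} t \<partial>disc_area)"
      by (cases "t \<in> {-pi..pi}") simp_all
  qed
  also have "\<dots> = (\<integral>\<^sup>+z. \<integral>\<^sup>+t. F (cis t * z) * indicator {-pi..pi} t \<partial>lborel \<partial>disc_area)"
  proof (rule P.Fubini'[symmetric])
    have id: "(\<lambda>z. z) \<in> disc_area \<rightarrow>\<^sub>M (borel :: complex measure)"
      unfolding measurable_disc by (rule measurable_restrict_space1) simp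
    have "(\<lambda>x. (fst x, snd x)) \<in> lborel \<Otimes>\<^sub>M disc_area \<rightarrow>\<^sub>M borel \<Otimes>\<^sub>M borel"
      by (intro measurable_Pair measurable_compose[OF measurable_snd id]) simp
    moreover have "(\<lambda>x. cis (fst x) * snd x) \<in> borel_measurable (borel \<Otimes>\<^sub>M borel)"
      unfolding borel_prod by (intro borel_measurable_continuous_onI continuous_intros)
    ultimately have "(\<lambda>x. cis (fst x) * snd x) \<in> borel_measurable (lborel \<Otimes>\<^sub>M disc_area)"
      by (auto dest: measurable_compose)
    then have [measurable]: "(\<lambda>x. F (cis (fst x) * snd x)) \<in> borel_measurable (lborel \<Otimes>\<^sub>M disc_area)"
      by (rule measurable_compose[OF _ F])
    show "(\<lambda>(t, z). F (cis t * z) * indicator {-pi..pi} t) \<in> borel_measurable (lborel \<Otimes>\<^sub>M disc_area)"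
      unfolding case_prod_beta by measurable
  qed
  finally show ?thesis .
qed

text \<open>An estimate of Forelli-Rudin type for (1 - |c|^2)^p (1 - |z|^2)^\<alpha> / |1 - cnj c
  z|^s. Averaging over circles leaves the power 1 - s of 1 - |c| |z|; the radial integral gives
  d^(-p) with d = 1 - |c|^2, which cancels the factor d^p and makes the bound uniform in c.\<close>

lemma mob_integral_bound:
  assumes p: "p > 0" and np: "real n * p > 1"
  shows "\<exists>C\<ge>0. \<forall>c. norm c < 1 \<longrightarrow>
    (\<integral>\<^sup>+z. ennreal ((mob_X c z ^ n * mob_e c z) powr p) \<partial>disc_lambda) \<le> ennreal C"
proof -
  \<comment> \<open>The weight has exponent n p, less 2 from the density of \<lambda>; the
    denominator collects n p from \<open>mob_X\<close> and p from \<open>mob_e\<close>. The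
    condition n p > 1 is exactly \<alpha> > -1, integrability at the circle.\<close>
  define \<alpha> s where "\<alpha> = real n * p - 2" and "s = \<alpha> + 2 + p"
  have a: "\<alpha> > -1" and s: "s > 1" using p np by (simp_all add: \<alpha>_def s_def)
  have sn: "s = (real n + 1) * p" by (simp add: s_def \<alpha>_def algebra_simps)
  define K1 where "K1 = 6 * 10 powr s / (s - 1)"
  define K2 where "K2 = 1 / (\<alpha> + 1) + 1 / p"
  have K: "K1 \<ge> 0" "K2 \<ge> 0" using s a p by (simp_all add: K1_def K2_def)
  show ?thesis
  proof (intro exI[of _ "K1 * 4 powr (s - 1) * K2"] conjI allI impI)
    show "K1 * 4 powr (s - 1) * K2 \<ge> 0" using K by simp
    fix c :: complex assume c: "norm c < 1"
    define d where "d = dw c"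
    have d: "0 < d" "d \<le> 1" using c by (simp_all add: d_def abs_square_less_1)
    define F where "F z = ennreal (d powr p * dw z powr \<alpha>) * ennreal (norm (1 - cnj c * z) powr - s)" for z
    have [measurable]: "(\<lambda>z. norm (1 - cnj c * z)) \<in> borel_measurable borel"
      by (intro borel_measurable_continuous_onI continuous_intros)
    have F_meas: "F \<in> borel_measurable borel" unfolding F_def by measurable
    have pt: "ennreal (1 / (dw z)\<^sup>2) * ennreal ((mob_X c z ^ n * mob_e c z) powr p) = F z"
      if z: "norm z < 1" for z
    proof -
      define A N where "A = 1 - (norm z)\<^sup>2" and "N = norm (1 - cnj c * z)"
      have A: "0 < A" using z by (simp add: A_def abs_square_less_1)
      have N: "0 < N" using one_minus_cnj_mult_bounds(3)[OF c z] by (simp add: N_def)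
      have "mob_X c z ^ n * mob_e c z = (A / N) powr real n * (d / N)"
        using A N by (simp add: mob_X_def mob_e_def A_def N_def d_def powr_realpow)
      then have "(mob_X c z ^ n * mob_e c z) powr p = A powr (real n * p) * d powr p / N powr s"
        using A N d by (simp add: powr_mult powr_divide powr_powr sn distrib_right powr_add)
      also have "A powr (real n * p) = A\<^sup>2 * A powr \<alpha>"
        using A by (simp add: \<alpha>_def powr_diff powr_numeral)
      finally have "(1 / A\<^sup>2) * (mob_X c z ^ n * mob_e c z) powr p = d powr p * A powr \<alpha> * N powr - s"
        using A N by (simp add: powr_minus_divide)
      then show ?thesis
        by (simp add: F_def A_def N_def flip: ennreal_mult')
    qed
    have "(\<integral>\<^sup>+z. ennreal ((mob_X c z ^ n * mob_e c z) powr p) \<partial>disc_lambda)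
      = (\<integral>\<^sup>+z. ennreal (1 / (dw z)\<^sup>2) * ennreal ((mob_X c z ^ n * mob_e c z) powr p) \<partial>disc_area)"
      by (intro nn_integral_disc_lambda borel_measurable_discI) measurable
    also have "\<dots> = (\<integral>\<^sup>+z. F z \<partial>disc_area)"
      by (intro nn_integral_cong pt) simp
    finally have eqF: "(\<integral>\<^sup>+z. ennreal ((mob_X c z ^ n * mob_e c z) powr p) \<partial>disc_lambda) = (\<integral>\<^sup>+z. F z \<partial>disc_area)" .
    define K3 where "K3 = K1 * 4 powr (s - 1) * d powr p"
    have K3: "0 \<le> K3" using K by (simp add: K3_def)
    define T where "T t = ennreal ((1 - t) powr \<alpha> * (d + (1 - t)) powr - (\<alpha> + 1 + p))" for t
    have T_meas: "T \<in> borel_measurable borel"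
      unfolding T_def by measurable
    have inner: "(\<integral>\<^sup>+t. F (cis t * z) * indicator {-pi..pi} t \<partial>lborel) \<le> ennreal K3 * T ((norm z)\<^sup>2)"
      if z: "norm z < 1" for z
    proof -
      define x where "x = norm c * norm z"
      define Y where "Y = d + dw z"
      define D where "D = d powr p * dw z powr \<alpha>"
      have "x \<le> norm z" unfolding x_def using c by (intro mult_left_le_one_le) simp_all
      then have x: "0 \<le> x" "x < 1" using z by (simp_all add: x_def)
      have Y: "0 < Y" using d z by (simp add: Y_def add_pos_nonneg abs_square_le_1)
      have "(\<integral>\<^sup>+t. F (cis t * z) * indicator {-pi..pi} t \<partial>lborel)
        = (\<integral>\<^sup>+t. ennreal D * (ennreal (norm (1 - cis t * (cnj c * z)) powr - s) * indicator {-pi..pi} t) \<partial>lborel)"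
        by (intro nn_integral_cong) (simp add: F_def D_def norm_mult mult_ac)
      also have "\<dots> = ennreal D * (\<integral>\<^sup>+t. ennreal (norm (1 - cis t * (cnj c * z)) powr - s) * indicator {-pi..pi} t \<partial>lborel)"
      proof (rule nn_integral_cmult)
        have [measurable]: "(\<lambda>t. norm (1 - cis t * (cnj c * z))) \<in> borel_measurable borel"
          by (intro borel_measurable_continuous_onI continuous_intros)
        show "(\<lambda>t. ennreal (norm (1 - cis t * (cnj c * z)) powr - s) * indicator {-pi..pi} t) \<in> borel_measurable lborel"
          by measurable
      qed
      also have "\<dots> \<le> ennreal D * ennreal (K1 * (1 - x) powr (1 - s))"
        unfolding K1_def using circle_integral_bound[OF s, of "cnj c * z"] x
        by (intro mult_left_mono) (simp_all add: x_def norm_mult)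
      also have "\<dots> \<le> ennreal D * ennreal (K1 * (4 powr (s - 1) * Y powr (1 - s)))"
      proof (intro mult_left_mono ennreal_leI K)
        \<comment> \<open>1 - x^2 is at least 1 - |c|^2 and at least 1 - |z|^2, hence at least Y /
          2; passing from 1 - x^2 to 1 - x costs another factor 2.\<close>
        have x2: "x\<^sup>2 \<le> (norm c)\<^sup>2" "x\<^sup>2 \<le> (norm z)\<^sup>2"
          using c z by (auto simp: x_def intro!: power_mono mult_left_le_one_le mult_right_le_one_le)
        have "1 - x\<^sup>2 = (1 - x) * (1 + x)" by (simp add: power2_eq_square algebra_simps)
        also have "\<dots> \<le> (1 - x) * 2" using x by (intro mult_left_mono) auto
        finally have "Y / 4 \<le> 1 - x" using x2 unfolding Y_def d_def by argo
        then have "(1 - x) powr (1 - s) \<le> (Y / 4) powr (1 - s)"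
          using s Y by (intro powr_mono2') auto
        also have "\<dots> = 4 powr (s - 1) * Y powr (1 - s)"
          using powr_minus_divide[of 4 "1 - s"] Y by (simp add: powr_divide)
        finally show "(1 - x) powr (1 - s) \<le> 4 powr (s - 1) * Y powr (1 - s)" .
      qed simp
      also have "\<dots> = ennreal (D * (K1 * (4 powr (s - 1) * Y powr (1 - s))))"
        using K by (intro ennreal_mult[symmetric]) (auto simp: D_def)
      also have "D * (K1 * (4 powr (s - 1) * Y powr (1 - s))) = K3 * (dw z powr \<alpha> * Y powr (1 - s))"
        by (simp only: D_def K3_def mult_ac)
      also have "ennreal \<dots> = ennreal K3 * ennreal (dw z powr \<alpha> * Y powr (1 - s))"
        using K3 by (intro ennreal_mult) auto
      also have "1 - s = - (\<alpha> + 1 + p)" by (simp add: s_def)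
      finally show ?thesis by (simp only: T_def Y_def)
    qed
    have "(\<integral>\<^sup>+z. F z \<partial>disc_area) \<le> ennreal (2 * pi) * (\<integral>\<^sup>+z. F z \<partial>disc_area)"
    proof -
      have "ennreal 1 * (\<integral>\<^sup>+z. F z \<partial>disc_area) \<le> ennreal (2 * pi) * (\<integral>\<^sup>+z. F z \<partial>disc_area)"
        using pi_gt3 by (intro mult_right_mono ennreal_leI) auto
      then show ?thesis by simp
    qed
    also have "\<dots> \<le> (\<integral>\<^sup>+z. ennreal K3 * T ((norm z)\<^sup>2) \<partial>disc_area)"
      unfolding nn_integral_disc_area_circle_average[OF F_meas]
      by (rule nn_integral_mono) (use inner in simp)
    also have "\<dots> = (\<integral>\<^sup>+t. (ennreal K3 * T t) * indicator {0..<1} t \<partial>lborel)"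
      using T_meas by (intro nn_integral_disc_area_radial) simp
    also have "\<dots> = ennreal K3 * (\<integral>\<^sup>+t. T t * indicator {0..<1} t \<partial>lborel)"
      unfolding mult.assoc using T_meas by (intro nn_integral_cmult) simp
    also have "\<dots> \<le> ennreal K3 * ennreal (K2 * d powr - p)"
      unfolding K2_def T_def by (intro mult_left_mono radial_weight_integral_bound[OF a p d]) simp
    also have "\<dots> = ennreal (K1 * 4 powr (s - 1) * K2)"
    proof -
      have "d powr p * d powr - p = 1" using d by (simp flip: powr_add)
      then have "K3 * (K2 * d powr - p) = K1 * 4 powr (s - 1) * K2"
        by (simp add: K3_def mult_ac)
      then show ?thesis by (simp only: ennreal_mult'[OF K3, symmetric])
    qed
    finally show "(\<integral>\<^sup>+z. ennreal ((mob_X c z ^ n * mob_e c z) powr p) \<partial>disc_lambda) \<le> ennreal (K1 * 4 powr (s - 1) * K2)"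
      unfolding eqF .
  qed
qed

section \<open>Boundedness and Moebius estimates on the disc\<close>

text \<open>Since p - 1 <= 0, the power (s + t)^(p-1) is at most s^(p-1) and at most t^(p-1). This
  takes the place of the triangle inequality for the exponent p.\<close>

lemma powr_add_le_add_powr:
  fixes s t :: real
  assumes "0 \<le> s" "0 \<le> t" "0 < p" "p \<le> 1"
  shows "(s + t) powr p \<le> s powr p + t powr p"
proof (cases "s = 0 \<or> t = 0")
  case False
  then have st: "s > 0" "t > 0" using assms by auto
  have "(s + t) powr p = (s + t) * (s + t) powr (p - 1)"
    using st by (simp add: powr_diff)
  also have "\<dots> \<le> s * s powr (p - 1) + t * t powr (p - 1)"
    unfolding distrib_right using st assms by (intro add_mono mult_left_mono powr_mono2') auto
  also have "\<dots> = s powr p + t powr p" using st by (simp add: powr_diff)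
  finally show ?thesis .
qed auto

lemma sigma_finite_disc_lambda: "sigma_finite_measure disc_lambda"
proof -
  interpret finite_measure disc_area by (rule finite_measure_disc_area)
  have "(\<lambda>z::complex. ennreal (1 / (dw z)\<^sup>2)) \<in> borel_measurable disc_area"
    by simp
  then show ?thesis
    unfolding disc_lambda_def by (subst sigma_finite_iff_density_finite) auto
qed

text \<open>If the integral were infinite, every real x would lie below it, and x^p would be
  bounded.\<close>

lemma weighted_integral_finite:
  assumes p: "0 < p" "p \<le> 1" and H: "H holomorphic_on ball 0 1"
    and fin: "besov_integral p k H < \<infinity>"
  shows "weighted_integral k H < \<infinity>"
proof (rule ccontr)
  assume "\<not> ?thesis"
  then have top: "weighted_integral k H = \<infinity>"
    by (simp add: not_less top_unique)
  from powr_integral_le_integral_powr[OF p, of k] obtain C where C: "C > 0" "\<forall>H x. H holomorphic_on ball 0 1 \<longrightarrow> 0 \<le> x \<longrightarrow>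
    ennreal x \<le> weighted_integral k H \<longrightarrow>
    ennreal (x powr p)
    \<le> ennreal C * besov_integral p k H"
    by (elim exE conjE) (rule that)
  define T where "T = besov_integral p k H"
  have "T < top" using fin by (simp add: T_def)
  then obtain N where N: "T = ennreal N" "N \<ge> 0"
    by (cases T) auto
  define x where "x = (C * N + 1) powr (1 / p)"
  have "ennreal (x powr p) \<le> ennreal C * ennreal N"
    using C(2)[rule_format, OF H, of x] unfolding T_def[symmetric] N(1) top by (simp add: x_def)
  then have "ennreal (x powr p) \<le> ennreal (C * N)" using C N by (simp add: ennreal_mult)
  then have "x powr p \<le> C * N" using C N by (subst (asm) ennreal_le_iff) auto
  moreover have "0 \<le> C * N" using C N by simp
  then have "x powr p = C * N + 1" using p by (simp add: x_def powr_powr)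
  ultimately show False by simp
qed

text \<open>The reproducing formula with derivatives of order m = q + 1 carries the weight exponent
  q + 2 = m + 1, one more than the seminorm.\<close>

lemma weighted_integral_Suc_finite:
  assumes p: "0 < p" "p \<le> 1" and H: "H holomorphic_on ball 0 1" and fin: "besov_integral p k H < \<infinity>"
  shows "weighted_integral (Suc k) H < \<infinity>"
proof (rule le_less_trans[OF nn_integral_mono weighted_integral_finite[OF p H fin]])
  fix w :: complex assume "w \<in> space disc_lambda"
  then have "dw w ^ Suc k \<le> dw w ^ k" by (intro power_decreasing) (auto simp: abs_square_le_1)
  then show "ennreal (dw w ^ Suc k * norm (H w)) \<le> ennreal (dw w ^ k * norm (H w))"
    by (intro ennreal_leI mult_right_mono) auto
qed

text \<open>The factor \<open>dw w\<close> turns the kernel into a power of phi_a times an atom; it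
  is the one power of the weight beyond the m that go with the derivative of f.\<close>

lemma mob_bounded_reproducing_kernel:
  assumes n: "n > 0"
  shows "\<exists>C\<ge>0. \<forall>a w z. norm a < 1 \<longrightarrow> norm w < 1 \<longrightarrow> norm z < 1 \<longrightarrow>
    dw z ^ n * (dw w * norm ((deriv ^^ n) (\<lambda>x. mob a x ^ m / (1 - cnj w * mob a x)) z))
    \<le> C * (mob_X a z ^ n * mob_e a z + mob_X (mob a w) z ^ n * mob_e (mob a w) z)"
proof -
  from mob_bounded_mob_power[of n m] obtain C where C: "C \<ge> 0"
    "\<forall>a c z. norm a < 1 \<longrightarrow> norm c < 1 \<longrightarrow> norm z < 1 \<longrightarrow> mob_bounded n a c z C (\<lambda>x. mob a x ^ m)"
    by (elim exE conjE) (rule that)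
  show ?thesis
  proof (intro exI[of _ "6 * 2 ^ n * C * (2 * fact n)"] conjI allI impI)
    show "6 * 2 ^ n * C * (2 * fact n) \<ge> 0" using C by simp
    fix a w z :: complex assume a: "norm a < 1" and w: "norm w < 1" and z: "norm z < 1"
    have c: "norm (mob a w) < 1" by (rule mob_norm_less_one[OF a w])
    have "mob_bounded n a (mob a w) z (6 * 2 ^ n * C * (2 * fact n))
      (\<lambda>x. mob a x ^ m * (of_real (dw w) / (1 - cnj w * mob a x)))"
      using C by (intro mob_bounded_mult[OF a c z] mob_bounded_kernel[OF a w z]) (auto simp: a c z)
    then have "dw z ^ n * norm ((deriv ^^ n) (\<lambda>x. mob a x ^ m * (of_real (dw w) / (1 - cnj w * mob a x))) z)
      \<le> 6 * 2 ^ n * C * (2 * fact n) * mob_B a (mob a w) z n"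
      by (simp add: mob_bounded_def)
    also have "(\<lambda>x. mob a x ^ m * (of_real (dw w) / (1 - cnj w * mob a x)))
      = (\<lambda>x. of_real (dw w) * (mob a x ^ m / (1 - cnj w * mob a x)))"
      by (simp add: fun_eq_iff)
    also have "(deriv ^^ n) (\<lambda>x. of_real (dw w) * (mob a x ^ m / (1 - cnj w * mob a x))) z
      = of_real (dw w) * (deriv ^^ n) (\<lambda>x. mob a x ^ m / (1 - cnj w * mob a x)) z"
    proof (rule higher_deriv_cmult)
      have "1 - cnj w * mob a x \<noteq> 0" if "norm x < 1" for x
        using one_minus_cnj_mult_bounds(3)[OF w mob_norm_less_one[OF a that]] .
      then show "(\<lambda>x. mob a x ^ m / (1 - cnj w * mob a x)) holomorphic_on ball 0 1"
        by (intro holomorphic_intros mob_holomorphic a) auto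
    qed (use z in auto)
    also have "norm (of_real (dw w) * (deriv ^^ n) (\<lambda>x. mob a x ^ m / (1 - cnj w * mob a x)) z)
      = (dw w) * norm ((deriv ^^ n) (\<lambda>x. mob a x ^ m / (1 - cnj w * mob a x)) z)"
      unfolding norm_mult norm_of_real using w by (simp add: abs_square_le_1)
    finally show "dw z ^ n * (dw w * norm ((deriv ^^ n) (\<lambda>x. mob a x ^ m / (1 - cnj w * mob a x)) z))
    \<le> 6 * 2 ^ n * C * (2 * fact n) * (mob_X a z ^ n * mob_e a z + mob_X (mob a w) z ^ n * mob_e (mob a w) z)"
      using n by (simp add: mob_B_def)
  qed
qed

text \<open>Handles the Taylor polynomial in the reproducing formula; \<open>r\<close> will be the
  moduli of the Taylor coefficients of f.\<close>

lemma mob_bounded_polynomial: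
  assumes n: "n > 0"
  shows "\<exists>C\<ge>0. \<forall>a z. norm a < 1 \<longrightarrow> norm z < 1 \<longrightarrow>
    dw z ^ n * (\<Sum>k<m. r k * norm ((deriv ^^ n) (\<lambda>x. mob a x ^ k) z))
    \<le> C * (mob_X a z ^ n * mob_e a z)"
proof (induction m)
  case 0
  show ?case by (intro exI[of _ 0]) simp
next
  case (Suc m)
  then obtain C where C: "C \<ge> 0" "\<forall>a z. norm a < 1 \<longrightarrow> norm z < 1 \<longrightarrow>
    dw z ^ n * (\<Sum>k<m. r k * norm ((deriv ^^ n) (\<lambda>x. mob a x ^ k) z))
    \<le> C * (mob_X a z ^ n * mob_e a z)"
    by (elim exE conjE) (rule that)
  from mob_bounded_mob_power[of n m] obtain D where D: "D \<ge> 0"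
    "\<forall>a c z. norm a < 1 \<longrightarrow> norm c < 1 \<longrightarrow> norm z < 1 \<longrightarrow> mob_bounded n a c z D (\<lambda>x. mob a x ^ m)"
    by (elim exE conjE) (rule that)
  show ?case
  proof (intro exI[of _ "C + \<bar>r m\<bar> * (D * 2)"] conjI allI impI)
    show "C + \<bar>r m\<bar> * (D * 2) \<ge> 0" using C D by simp
    fix a z :: complex assume a: "norm a < 1" and z: "norm z < 1"
    define A where "A = dw z"
    have A: "0 \<le> A" using z by (simp add: A_def abs_square_le_1)
    \<comment> \<open>Only powers of phi_a occur, so c = a is taken; the two summands of
      \<open>mob_B\<close> coincide, whence the factor 2.\<close>
    have "mob_bounded n a a z D (\<lambda>x. mob a x ^ m)" using D a z by blast
    then have "A ^ n * norm ((deriv ^^ n) (\<lambda>x. mob a x ^ m) z) \<le> D * mob_B a a z n"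
      by (simp add: mob_bounded_def A_def)
    then have "\<bar>r m\<bar> * (A ^ n * norm ((deriv ^^ n) (\<lambda>x. mob a x ^ m) z)) \<le> \<bar>r m\<bar> * (D * (2 * (mob_X a z ^ n * mob_e a z)))"
      using n by (intro mult_left_mono) (simp_all add: mob_B_def mult_ac)
    moreover have "A ^ n * (r m * norm ((deriv ^^ n) (\<lambda>x. mob a x ^ m) z)) \<le> \<bar>r m\<bar> * (A ^ n * norm ((deriv ^^ n) (\<lambda>x. mob a x ^ m) z))"
      using A by (subst mult.left_commute) (intro mult_right_mono, auto)
    moreover have "A ^ n * (\<Sum>k<m. r k * norm ((deriv ^^ n) (\<lambda>x. mob a x ^ k) z)) \<le> C * (mob_X a z ^ n * mob_e a z)"
      using C(2) a z by (simp add: A_def)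
    ultimately show "dw z ^ n * (\<Sum>k<Suc m. r k * norm ((deriv ^^ n) (\<lambda>x. mob a x ^ k) z))
      \<le> (C + \<bar>r m\<bar> * (D * 2)) * (mob_X a z ^ n * mob_e a z)"
      unfolding A_def[symmetric] by (simp add: distrib_left distrib_right mult_ac)
  qed
qed

text \<open>The reproducing formula with n = 0 and \<phi> the identity: the kernel times one power
  of the weight is at most \<open>mob_e w z\<close>, hence at most 2, which leaves the finite
  weighted integral of the m-th derivative.\<close>

lemma besov_norm_bounded:
  assumes p: "0 < p" "p \<le> 1" and f: "f holomorphic_on ball 0 1" and m: "real m * p > 1"
    and fin: "besov_integral p m ((deriv ^^ m) f) < \<infinity>"
  shows "\<exists>B. \<forall>z. norm z < 1 \<longrightarrow> norm (f z) \<le> B"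
proof -
  obtain q where q: "m = Suc q" using m by (cases m) auto
  define g where "g = (deriv ^^ m) f"
  have g: "g holomorphic_on ball 0 1" unfolding g_def by (intro holomorphic_higher_deriv f) auto
  define I where "I = weighted_integral m g"
  have I: "I < \<infinity>"
    unfolding I_def using weighted_integral_finite[OF p g] fin by (simp add: g_def)
  have int: "weighted_integral (q + 2) ((deriv ^^ Suc q) f) < \<infinity>"
    using weighted_integral_Suc_finite[OF p g] fin by (simp only: g_def q add_2_eq_Suc')
  define S where "S = (\<Sum>k<Suc q. norm ((deriv ^^ k) f 0 / fact k))"
  show ?thesis
  proof (intro exI[of _ "S + 2 * enn2real I"] allI impI)
    fix z :: complex assume z: "norm z < 1"
    have zb: "z \<in> ball 0 1" using z by simp
    have id: "(\<lambda>x::complex. x) holomorphic_on ball 0 1" "(\<lambda>x::complex. x) ` ball 0 1 \<subseteq> ball 0 1"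
      by (auto intro: holomorphic_intros)
    from higher_deriv_comp_reproducing[OF f int id zb, where n = 0]
    obtain E x where E: "E holomorphic_on ball 0 1" and x: "0 \<le> x"
      and nE: "\<forall>w\<in>ball 0 1. norm (E w) = norm ((deriv ^^ 0) (\<lambda>x. x ^ Suc q / (1 - cnj w * x)) z)"
      and xle: "ennreal x \<le> weighted_integral (q + 2) (\<lambda>w. (deriv ^^ Suc q) f w * E w)"
      and fle: "norm ((deriv ^^ 0) (\<lambda>x. f x) z)
        \<le> (\<Sum>k<Suc q. norm ((deriv ^^ k) f 0 / fact k) * norm ((deriv ^^ 0) (\<lambda>x. x ^ k) z)) + x"
      by (elim exE conjE) (rule that)
    note xle
    also have "weighted_integral (q + 2) (\<lambda>w. (deriv ^^ Suc q) f w * E w)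
      \<le> (\<integral>\<^sup>+w. 2 * ennreal (dw w ^ m * norm (g w)) \<partial>disc_lambda)"
    proof (rule nn_integral_mono)
      fix w :: complex assume "w \<in> space disc_lambda"
      then have w: "norm w < 1" by simp
      define A where "A = dw w"
      have A: "0 \<le> A" using w by (simp add: A_def abs_square_le_1)
      have "norm (E w) = norm z ^ Suc q / norm (1 - cnj w * z)"
        using nE w by (simp add: norm_divide norm_power norm_mult del: power_Suc)
      also have "\<dots> \<le> 1 / norm (1 - cnj w * z)"
        using z by (intro divide_right_mono power_le_one) auto
      finally have "A * norm (E w) \<le> A * (1 / norm (1 - cnj w * z))"
        using A by (intro mult_left_mono)
      also have "\<dots> = mob_e w z" by (simp add: mob_e_def A_def)
      also have "\<dots> \<le> 2" by (rule mob_X_e_bounds(4)[OF w z])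
      finally have "A ^ m * norm (g w) * (A * norm (E w)) \<le> A ^ m * norm (g w) * 2"
        using A by (intro mult_left_mono) auto
      then have "A ^ (q + 2) * norm (g w * E w) \<le> 2 * (A ^ m * norm (g w))"
        by (simp add: q norm_mult mult_ac)
      then show "ennreal (dw w ^ (q + 2) * norm ((deriv ^^ Suc q) f w * E w)) \<le> 2 * ennreal (dw w ^ m * norm (g w))"
        unfolding g_def q A_def[symmetric] by (metis ennreal_leI ennreal_mult' ennreal_numeral zero_le_numeral)
    qed
    also have "\<dots> = 2 * I"
    proof -
      note [measurable] = holomorphic_norm_measurable_disc[OF g]
      show ?thesis unfolding I_def by (intro nn_integral_cmult) simp
    qed
    also have "\<dots> = ennreal (2 * enn2real I)"
      using I by (simp add: ennreal_mult ennreal_enn2real)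
    finally have "x \<le> 2 * enn2real I"
      by (subst (asm) ennreal_le_iff) auto
    moreover have "(\<Sum>k<Suc q. norm ((deriv ^^ k) f 0 / fact k) * norm ((deriv ^^ 0) (\<lambda>x. x ^ k) z)) \<le> S"
      unfolding S_def using z by (intro sum_mono mult_left_le) (auto simp: norm_power power_le_one)
    ultimately show "norm (f z) \<le> S + 2 * enn2real I"
      using fle by simp
  qed
qed

lemma cnj_borel_measurable: "cnj \<in> borel_measurable borel"
  by (intro borel_measurable_continuous_onI continuous_intros)

lemma mob_comp_kernel_measurable:
  "(\<lambda>x. mob_X (mob a (snd x)) (fst x) ^ n * mob_e (mob a (snd x)) (fst x)) \<in> borel_measurable (disc_lambda \<Otimes>\<^sub>M disc_lambda)"
proof -
  note [measurable] = cnj_borel_measurable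
  have m: "(\<lambda>x. mob_X (mob a (snd x)) (fst x) ^ n * mob_e (mob a (snd x)) (fst x)) \<in> borel_measurable (borel \<Otimes>\<^sub>M borel)"
    unfolding mob_X_def mob_e_def mob_def by measurable
  have id: "(\<lambda>z. z) \<in> disc_lambda \<rightarrow>\<^sub>M (borel :: complex measure)"
    unfolding measurable_disc by (rule measurable_restrict_space1) simp
  have "(\<lambda>x. (fst x, snd x)) \<in> disc_lambda \<Otimes>\<^sub>M disc_lambda \<rightarrow>\<^sub>M borel \<Otimes>\<^sub>M (borel :: complex measure)"
    by (intro measurable_Pair measurable_compose[OF measurable_fst id] measurable_compose[OF measurable_snd id])
  from measurable_compose[OF this m] show ?thesis by simp
qed

text \<open>The p-th power of the reproducing formula is bounded by a polynomial part and an
  integral over w of \<open>U w\<close> times the p-th powers of the kernel bounds at a and at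
  phi_a(w). Integrating in z for fixed w gives at most \<open>2 * C4\<close>, whatever a and w are,
  so the total is controlled by the seminorm of f.\<close>

lemma besov_mob_bounded:
  assumes p: "0 < p" "p \<le> 1" and f: "f holomorphic_on ball 0 1" and m: "real m * p > 1"
    and fin: "besov_integral p m ((deriv ^^ m) f) < \<infinity>"
    and n: "real n * p > 1"
  shows "\<exists>K. \<forall>a. norm a < 1 \<longrightarrow>
    besov_integral p n ((deriv ^^ n) (\<lambda>x. f (mob a x))) \<le> ennreal K"
proof -
  obtain q where q: "m = Suc q" using m by (cases m) auto
  have n0: "n > 0" using n by (cases n) auto
  define g where "g = (deriv ^^ m) f"
  have g: "g holomorphic_on ball 0 1" unfolding g_def by (intro holomorphic_higher_deriv f) auto
  note [measurable] = holomorphic_norm_measurable_disc[OF g]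
  have int: "weighted_integral (q + 2) ((deriv ^^ Suc q) f) < \<infinity>"
    using weighted_integral_Suc_finite[OF p g] fin by (simp only: g_def q add_2_eq_Suc')
  define U where "U w = (dw w ^ m * norm (g w)) powr p" for w
  have U_meas [measurable]: "(\<lambda>w. ennreal (U w)) \<in> borel_measurable (disc_borel)"
    unfolding U_def by measurable
  define N where "N = (\<integral>\<^sup>+w. ennreal (U w) \<partial>disc_lambda)"
  have N: "N < \<infinity>" using fin by (simp add: N_def U_def g_def)
  define B where "B c z = mob_X c z ^ n * mob_e c z" for c z
  have B_meas: "B c \<in> borel_measurable borel" for c unfolding B_def by measurable
  have B0: "0 \<le> B c z" if "norm c < 1" "norm z < 1" for c z
    using mob_X_e_bounds[OF that] by (simp add: B_def)
  define h where "h a z w = ennreal (U w) * (ennreal (B a z powr p) + ennreal (B (mob a w) z powr p))" for a z w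
  define J where "J a z = (\<integral>\<^sup>+w. h a z w \<partial>disc_lambda)" for a z
  from powr_integral_le_integral_powr[OF p, of "q + 2"] obtain C1 where C1: "C1 > 0" "\<forall>H x. H holomorphic_on ball 0 1 \<longrightarrow> 0 \<le> x \<longrightarrow>
    ennreal x \<le> weighted_integral (q + 2) H \<longrightarrow>
    ennreal (x powr p)
    \<le> ennreal C1 * besov_integral p (q + 2) H"
    by (elim exE conjE) (rule that)
  from mob_bounded_reproducing_kernel[OF n0, of m] obtain C2 where C2: "C2 \<ge> 0"
    "\<forall>a w z. norm a < 1 \<longrightarrow> norm w < 1 \<longrightarrow> norm z < 1 \<longrightarrow>
    dw z ^ n * (dw w * norm ((deriv ^^ n) (\<lambda>x. mob a x ^ m / (1 - cnj w * mob a x)) z))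
    \<le> C2 * (mob_X a z ^ n * mob_e a z + mob_X (mob a w) z ^ n * mob_e (mob a w) z)"
    by (elim exE conjE) (rule that)
  from mob_bounded_polynomial[OF n0, where m = m and r = "\<lambda>k. norm ((deriv ^^ k) f 0 / fact k)"] obtain C3 where C3: "C3 \<ge> 0"
    "\<forall>a z. norm a < 1 \<longrightarrow> norm z < 1 \<longrightarrow>
    dw z ^ n * (\<Sum>k<m. norm ((deriv ^^ k) f 0 / fact k) * norm ((deriv ^^ n) (\<lambda>x. mob a x ^ k) z))
    \<le> C3 * (mob_X a z ^ n * mob_e a z)"
    by (elim exE conjE) (rule that)
  from mob_integral_bound[OF p(1) n, folded B_def] obtain C4 where C4: "C4 \<ge> 0" "\<forall>c. norm c < 1 \<longrightarrow>
    (\<integral>\<^sup>+z. ennreal (B c z powr p) \<partial>disc_lambda) \<le> ennreal C4"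
    by (elim exE conjE) (rule that)
  have pt: "ennreal ((dw z ^ n * norm ((deriv ^^ n) (\<lambda>x. f (mob a x)) z)) powr p)
    \<le> ennreal (C3 powr p) * ennreal (B a z powr p) + ennreal (C1 * C2 powr p) * J a z"
    if a: "norm a < 1" and z: "norm z < 1" for a z
  proof -
    have zb: "z \<in> ball 0 1" using z by simp
    have phi: "mob a holomorphic_on ball 0 1" "mob a ` ball 0 1 \<subseteq> ball 0 1"
      using mob_holomorphic[OF a] mob_norm_less_one[OF a] by auto
    define A where "A = dw z"
    have A: "0 \<le> A" using z by (simp add: A_def abs_square_le_1)
    from higher_deriv_comp_reproducing[OF f int phi zb, where n = n]
    obtain E x where E: "E holomorphic_on ball 0 1" and x: "0 \<le> x"
      and nE: "\<forall>w\<in>ball 0 1. norm (E w) = norm ((deriv ^^ n) (\<lambda>x. mob a x ^ Suc q / (1 - cnj w * mob a x)) z)"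
      and xle: "ennreal x \<le> weighted_integral (q + 2) (\<lambda>w. (deriv ^^ Suc q) f w * E w)"
      and fle: "norm ((deriv ^^ n) (\<lambda>x. f (mob a x)) z)
        \<le> (\<Sum>k<Suc q. norm ((deriv ^^ k) f 0 / fact k) * norm ((deriv ^^ n) (\<lambda>x. mob a x ^ k) z)) + x"
      by (elim exE conjE) (rule that)
    have "A ^ n * norm ((deriv ^^ n) (\<lambda>x. f (mob a x)) z)
      \<le> A ^ n * ((\<Sum>k<m. norm ((deriv ^^ k) f 0 / fact k) * norm ((deriv ^^ n) (\<lambda>x. mob a x ^ k) z)) + x)"
      using fle A unfolding q by (intro mult_left_mono) auto
    also have "\<dots> \<le> C3 * B a z + A ^ n * x"
      using C3(2)[rule_format, OF a z] unfolding distrib_left A_def B_def by simp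
    finally have "(A ^ n * norm ((deriv ^^ n) (\<lambda>x. f (mob a x)) z)) powr p \<le> (C3 * B a z + A ^ n * x) powr p"
      using A p by (intro powr_mono2) auto
    also have "\<dots> \<le> (C3 * B a z) powr p + (A ^ n * x) powr p"
      using p C3(1) B0[OF a z] A x by (intro powr_add_le_add_powr) auto
    finally have le1: "(A ^ n * norm ((deriv ^^ n) (\<lambda>x. f (mob a x)) z)) powr p
      \<le> C3 powr p * B a z powr p + (A ^ n) powr p * x powr p"
      using C3(1) B0[OF a z] A x by (simp add: powr_mult)
    \<comment> \<open>A product of two holomorphic functions of w with the modulus that the
      integrand has apart from its weight; this is what allows the exponent p to be brought
      inside.\<close>
    define H where "H w = g w * E w" for w
    have H: "H holomorphic_on ball 0 1" unfolding H_def by (intro holomorphic_intros g E)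
    note [measurable] = holomorphic_norm_measurable_disc[OF H]
    have "ennreal (x powr p) \<le> ennreal C1 * besov_integral p (q + 2) H"
      using C1(2) H x xle unfolding H_def g_def q by blast
    then have "ennreal ((A ^ n) powr p) * ennreal (x powr p)
      \<le> ennreal ((A ^ n) powr p) * (ennreal C1 * besov_integral p (q + 2) H)"
      by (rule mult_left_mono) simp
    also have "\<dots> = ennreal C1 * (\<integral>\<^sup>+w. ennreal ((A ^ n) powr p) * ennreal ((dw w ^ (q + 2) * norm (H w)) powr p) \<partial>disc_lambda)"
      by (subst nn_integral_cmult) (simp_all add: mult.left_commute)
    also have "(\<integral>\<^sup>+w. ennreal ((A ^ n) powr p) * ennreal ((dw w ^ (q + 2) * norm (H w)) powr p) \<partial>disc_lambda)
      \<le> (\<integral>\<^sup>+w. ennreal (C2 powr p) * (h a z w) \<partial>disc_lambda)"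
    proof (rule nn_integral_mono)
      fix w :: complex assume "w \<in> space disc_lambda"
      then have w: "norm w < 1" by simp
      have c: "norm (mob a w) < 1" by (rule mob_norm_less_one[OF a w])
      define W where "W = dw w"
      have W: "0 \<le> W" using w by (simp add: W_def abs_square_le_1)
      \<comment> \<open>Of the q + 2 = m + 1 powers of the weight, m stay with \<open>g\<close> to
        form \<open>U\<close> and one goes to the kernel.\<close>
      have "A ^ n * (W ^ (q + 2) * norm (H w)) = (W ^ m * norm (g w)) * (A ^ n * (W * norm (E w)))"
        by (simp add: H_def q norm_mult mult_ac)
      also have "\<dots> \<le> (W ^ m * norm (g w)) * (C2 * (B a z + B (mob a w) z))"
        using C2(2)[rule_format, OF a w z] bspec[OF nE, of w] w W
        by (intro mult_left_mono) (auto simp: A_def W_def B_def q)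
      finally have "(A ^ n * (W ^ (q + 2) * norm (H w))) powr p \<le> ((W ^ m * norm (g w)) * (C2 * (B a z + B (mob a w) z))) powr p"
        using A W p by (intro powr_mono2) auto
      also have "\<dots> = C2 powr p * (U w * (B a z + B (mob a w) z) powr p)"
        using W C2(1) B0[OF a z] B0[OF c z] by (simp add: powr_mult U_def W_def)
      also have "\<dots> \<le> C2 powr p * (U w * (B a z powr p + B (mob a w) z powr p))"
        using B0[OF a z] B0[OF c z] p by (intro mult_left_mono powr_add_le_add_powr) (auto simp: U_def)
      finally have "(A ^ n) powr p * (W ^ (q + 2) * norm (H w)) powr p \<le> C2 powr p * (U w * (B a z powr p + B (mob a w) z powr p))"
        using A W by (simp add: powr_mult)
      then have "ennreal ((A ^ n) powr p * (W ^ (q + 2) * norm (H w)) powr p) \<le> ennreal (C2 powr p * (U w * (B a z powr p + B (mob a w) z powr p)))"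
        by (rule ennreal_leI)
      then show "ennreal ((A ^ n) powr p) * ennreal ((dw w ^ (q + 2) * norm (H w)) powr p)
        \<le> ennreal (C2 powr p) * (h a z w)"
        unfolding W_def[symmetric] h_def by (simp add: ennreal_mult U_def)
    qed
    also have "\<dots> = ennreal (C2 powr p) * J a z"
      unfolding J_def
    proof (rule nn_integral_cmult)
      note [measurable] = cnj_borel_measurable
      have "(\<lambda>w. B (mob a w) z) \<in> borel_measurable borel"
        unfolding B_def mob_X_def mob_e_def mob_def by measurable
      then have "(\<lambda>w. B (mob a w) z) \<in> borel_measurable (disc_borel)"
        by (rule borel_measurable_discI)
      then show "(\<lambda>w. h a z w) \<in> borel_measurable disc_lambda"
        unfolding h_def by simp
    qed
    finally have le2: "ennreal ((A ^ n) powr p) * ennreal (x powr p) \<le> ennreal C1 * (ennreal (C2 powr p) * J a z)"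
      by (simp add: mult_left_mono)
    have "ennreal ((A ^ n * norm ((deriv ^^ n) (\<lambda>x. f (mob a x)) z)) powr p)
      \<le> ennreal (C3 powr p) * ennreal (B a z powr p) + ennreal ((A ^ n) powr p) * ennreal (x powr p)"
      using ennreal_leI[OF le1] by (simp add: ennreal_mult)
    also have "\<dots> \<le> ennreal (C3 powr p) * ennreal (B a z powr p) + ennreal C1 * (ennreal (C2 powr p) * J a z)"
      by (intro add_left_mono le2)
    also have "ennreal C1 * (ennreal (C2 powr p) * J a z)
      = ennreal (C1 * C2 powr p) * J a z"
      using C1(1) by (simp add: ennreal_mult mult.assoc)
    finally show ?thesis unfolding A_def .
  qed
  define K where "K = C3 powr p * C4 + C1 * C2 powr p * (enn2real N * (2 * C4))"
  show ?thesis
  proof (intro exI[of _ K] allI impI)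
    fix a :: complex assume a: "norm a < 1"
    interpret L: sigma_finite_measure disc_lambda by (rule sigma_finite_disc_lambda)
    interpret LL: pair_sigma_finite disc_lambda disc_lambda ..
    have h_meas: "case_prod (h a) \<in> borel_measurable (disc_lambda \<Otimes>\<^sub>M disc_lambda)"
    proof -
      have 1: "(\<lambda>x. ennreal (U (snd x))) \<in> borel_measurable (disc_lambda \<Otimes>\<^sub>M disc_lambda)"
        by (rule measurable_compose[OF measurable_snd]) simp
      have 2: "(\<lambda>x. B a (fst x)) \<in> borel_measurable (disc_lambda \<Otimes>\<^sub>M disc_lambda)"
        by (rule measurable_compose[OF measurable_fst]) (simp add: borel_measurable_discI[OF B_meas])
      have 3: "(\<lambda>x. B (mob a (snd x)) (fst x)) \<in> borel_measurable (disc_lambda \<Otimes>\<^sub>M disc_lambda)"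
        unfolding B_def by (rule mob_comp_kernel_measurable)
      show ?thesis unfolding h_def case_prod_beta using 1 2 3
        by (intro borel_measurable_times_ennreal borel_measurable_add) simp_all
    qed
    have Bp_meas: "(\<lambda>z. ennreal (B c z powr p)) \<in> borel_measurable disc_lambda" for c
      using borel_measurable_discI[OF B_meas, of c] by simp
    have "(\<integral>\<^sup>+z. J a z \<partial>disc_lambda) = (\<integral>\<^sup>+w. \<integral>\<^sup>+z. h a z w \<partial>disc_lambda \<partial>disc_lambda)"
      unfolding J_def by (rule LL.Fubini'[OF h_meas, symmetric])
    also have "\<dots> \<le> (\<integral>\<^sup>+w. ennreal (U w) * ennreal (2 * C4) \<partial>disc_lambda)"
    proof (rule nn_integral_mono)
      fix w assume w: "w \<in> space disc_lambda"
      have c: "norm (mob a w) < 1" using w by (intro mob_norm_less_one[OF a]) simp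
      have "(\<integral>\<^sup>+z. h a z w \<partial>disc_lambda) = ennreal (U w) * (\<integral>\<^sup>+z. ennreal (B a z powr p) + ennreal (B (mob a w) z powr p) \<partial>disc_lambda)"
        unfolding h_def by (rule nn_integral_cmult) (intro borel_measurable_add Bp_meas)
      also have "(\<integral>\<^sup>+z. ennreal (B a z powr p) + ennreal (B (mob a w) z powr p) \<partial>disc_lambda)
        = (\<integral>\<^sup>+z. ennreal (B a z powr p) \<partial>disc_lambda) + (\<integral>\<^sup>+z. ennreal (B (mob a w) z powr p) \<partial>disc_lambda)"
        by (rule nn_integral_add) (rule Bp_meas)+
      finally have e: "(\<integral>\<^sup>+z. h a z w \<partial>disc_lambda) = ennreal (U w) * ((\<integral>\<^sup>+z. ennreal (B a z powr p) \<partial>disc_lambda) + (\<integral>\<^sup>+z. ennreal (B (mob a w) z powr p) \<partial>disc_lambda))" .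
      have "(\<integral>\<^sup>+z. ennreal (B a z powr p) \<partial>disc_lambda) + (\<integral>\<^sup>+z. ennreal (B (mob a w) z powr p) \<partial>disc_lambda) \<le> ennreal C4 + ennreal C4"
        using C4(2) a c by (intro add_mono) blast+
      also have "\<dots> = ennreal (2 * C4)" using C4(1) by (simp flip: ennreal_plus)
      finally show "(\<integral>\<^sup>+z. h a z w \<partial>disc_lambda) \<le> ennreal (U w) * ennreal (2 * C4)"
        unfolding e by (rule mult_left_mono) simp
    qed
    also have "\<dots> = N * ennreal (2 * C4)"
      unfolding N_def by (rule nn_integral_multc) simp
    also have "\<dots> = ennreal (enn2real N * (2 * C4))"
      using N C4(1) by (simp add: ennreal_mult ennreal_enn2real)
    finally have hle: "(\<integral>\<^sup>+z. J a z \<partial>disc_lambda) \<le> ennreal (enn2real N * (2 * C4))" .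
    have hint_meas: "(\<lambda>z. J a z) \<in> borel_measurable disc_lambda"
      using L.borel_measurable_nn_integral[OF h_meas] by (simp add: J_def)
    have "besov_integral p n ((deriv ^^ n) (\<lambda>x. f (mob a x)))
      \<le> (\<integral>\<^sup>+z. ennreal (C3 powr p) * ennreal (B a z powr p) + ennreal (C1 * C2 powr p) * J a z \<partial>disc_lambda)"
      by (rule nn_integral_mono) (use pt[OF a] in simp)
    also have "\<dots> = ennreal (C3 powr p) * (\<integral>\<^sup>+z. ennreal (B a z powr p) \<partial>disc_lambda)
        + ennreal (C1 * C2 powr p) * (\<integral>\<^sup>+z. J a z \<partial>disc_lambda)"
      by (subst nn_integral_add) (intro borel_measurable_times_ennreal borel_measurable_const Bp_meas hint_meas
        | simp only: nn_integral_cmult[OF Bp_meas] nn_integral_cmult[OF hint_meas])+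
    also have "\<dots> \<le> ennreal (C3 powr p) * ennreal C4 + ennreal (C1 * C2 powr p) * ennreal (enn2real N * (2 * C4))"
      using C4(2) a by (intro add_mono mult_left_mono hle) auto
    also have "\<dots> = ennreal K"
      using C1(1) C4(1) by (simp add: K_def ennreal_plus ennreal_mult)
    finally show "besov_integral p n ((deriv ^^ n) (\<lambda>x. f (mob a x))) \<le> ennreal K" .
  qed
qed

section \<open>Slices and components\<close>

locale orthogonal_units =
  fixes i j :: quat
  assumes i: "i \<in> imag_units" and j: "j \<in> imag_units" and ij: "inner i j = 0"
begin

abbreviation emb :: "complex \<Rightarrow> quat" where "emb \<equiv> slice_emb i"

definition emb2 :: "complex \<Rightarrow> complex \<Rightarrow> quat" where
  "emb2 a b = emb a + emb b * j"

text \<open>Together with \<open>proj2\<close> these are the coordinates for the orthonormal basis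
  1, i, j, i j. Written with inner products they are bounded linear by construction, which the
  description by unique existence in \<open>slice_split\<close> does not show.\<close>

definition proj1 :: "quat \<Rightarrow> complex" where
  "proj1 q = of_real (inner q 1) + \<i> * of_real (inner q i)"

definition proj2 :: "quat \<Rightarrow> complex" where
  "proj2 q = of_real (inner q j) + \<i> * of_real (inner q (i * j))"

lemma emb_scaleR: "emb z = Re z *\<^sub>R 1 + Im z *\<^sub>R i"
  by (simp add: slice_emb_def of_real_def)

lemma emb2_scaleR: "emb2 a b = Re a *\<^sub>R 1 + Im a *\<^sub>R i + Re b *\<^sub>R j + Im b *\<^sub>R (i * j)"
  by (simp add: emb2_def emb_scaleR distrib_right)

lemma units:
  "inner 1 (1::quat) = 1" "inner i i = 1" "inner j j = 1" "inner (i * j) (i * j) = 1"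
  "inner 1 i = 0" "inner 1 j = 0" "inner 1 (i * j) = 0" "inner i j = 0" "inner i (i * j) = 0" "inner j (i * j) = 0"
  "inner i 1 = 0" "inner j 1 = 0" "inner (i * j) 1 = 0" "inner j i = 0" "inner (i * j) i = 0" "inner (i * j) j = 0"
proof -
  have re: "qre i = 0" "qre j = 0" and n: "norm i = 1" "norm j = 1"
    using i j by (auto simp: imag_units_def)
  have nij: "norm (i * j) = 1" using n by (simp add: norm_mult)
  show "inner 1 (1::quat) = 1" by (simp add: inner_quat_def)
  show "inner i i = 1" "inner j j = 1" "inner (i * j) (i * j) = 1"
    using n nij by (simp_all add: dot_square_norm)
  show 1: "inner 1 i = 0" "inner 1 j = 0" using re by (simp_all add: inner_quat_def)
  show 2: "inner 1 (i * j) = 0" using ij re by (simp add: inner_quat_def)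
  show "inner i j = 0" by (rule ij)
  show 3: "inner i (i * j) = 0" "inner j (i * j) = 0"
    using re by (simp_all add: inner_quat_def algebra_simps)
  show "inner i 1 = 0" "inner j 1 = 0" "inner (i * j) 1 = 0" "inner j i = 0" "inner (i * j) i = 0" "inner (i * j) j = 0"
    using 1 2 3 ij by (simp_all only: inner_commute)
qed

lemma proj_emb2 [simp]: "proj1 (emb2 a b) = a" "proj2 (emb2 a b) = b"
  by (simp_all add: proj1_def proj2_def emb2_scaleR inner_add_left units complex_eq_iff)

lemma emb2_proj: "emb2 (proj1 q) (proj2 q) = q"
proof -
  from slice_split_ex1[OF i j ij, of q] obtain a b where "a \<in> slice i" "b \<in> slice i" "q = a + b * j"
    by (elim ex1E) auto
  then obtain x y where "q = emb2 x y" by (auto simp: slice_def emb2_def)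
  then show ?thesis by simp
qed

lemma slice_split_emb2: "slice_split i j (emb2 a b) = (emb a, emb b)"
  unfolding slice_split_def
proof (rule the1_equality)
  show "\<exists>!(x, y). x \<in> slice i \<and> y \<in> slice i \<and> emb2 a b = x + y * j"
    by (rule slice_split_ex1[OF i j ij])
  show "case (emb a, emb b) of (x, y) \<Rightarrow> x \<in> slice i \<and> y \<in> slice i \<and> emb2 a b = x + y * j"
    by (simp add: slice_def emb2_def)
qed

lemma norm_emb2: "norm (emb2 a b) = norm (a, b)"
proof -
  have "(norm (emb2 a b))\<^sup>2 = (Re a)\<^sup>2 + (Im a)\<^sup>2 + ((Re b)\<^sup>2 + (Im b)\<^sup>2)"
    unfolding power2_norm_eq_inner emb2_scaleR
    by (simp add: inner_add_left inner_add_right units power2_eq_square)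
  also have "\<dots> = (norm (a, b))\<^sup>2"
    by (simp add: norm_Pair cmod_power2)
  finally show ?thesis by (simp add: power2_eq_iff_nonneg)
qed

lemma norm_emb: "norm (emb z) = norm z"
  using norm_emb2[of z 0] by (simp add: emb2_def emb_scaleR norm_Pair)

lemma emb_add: "emb (z + w) = emb z + emb w"
  by (simp add: emb_scaleR scaleR_add_left)

lemma emb_of_real: "emb (of_real r) = of_real r"
  by (simp add: slice_emb_def)

lemma emb_0_1 [simp]: "emb 0 = 0" "emb 1 = 1"
  by (simp_all add: emb_scaleR)

lemma emb_diff: "emb (z - w) = emb z - emb w"
  by (simp add: emb_scaleR scaleR_diff_left)

lemma emb_mult: "emb (z * w) = emb z * emb w"
  by (simp add: emb_scaleR imag_units_sq[OF i] algebra_simps)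

lemma emb_power: "emb (z ^ n) = emb z ^ n"
  by (induction n) (simp_all add: emb_mult)

lemma qcnj_emb: "qcnj (emb z) = emb (cnj z)"
  using i by (simp add: emb_scaleR quat_eq_iff imag_units_def)

lemma bounded_linear_emb: "bounded_linear emb"
proof (rule bounded_linear_intro[of _ 1])
  show "emb (r *\<^sub>R x) = r *\<^sub>R emb x" for r x
    by (simp add: emb_scaleR algebra_simps)
qed (simp_all add: emb_add norm_emb)

lemma bounded_linear_proj: "bounded_linear proj1" "bounded_linear proj2"
  unfolding proj1_def proj2_def
  by (intro bounded_linear_add bounded_linear_compose[OF bounded_linear_of_real]
    bounded_linear_compose[OF bounded_linear_mult_right] bounded_linear_inner_left)+

text \<open>Left multiplication by an element of the slice is complex multiplication in both
  components; hence a left Cauchy-Riemann equation splits into one for each component.\<close>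

lemma proj_emb_mult: "proj1 (emb h * q) = h * proj1 q" "proj2 (emb h * q) = h * proj2 q"
proof -
  have "emb h * emb2 a b = emb2 (h * a) (h * b)" for a b
    by (simp add: emb2_def emb_mult distrib_left mult.assoc)
  from this[of "proj1 q" "proj2 q"] have "emb h * q = emb2 (h * proj1 q) (h * proj2 q)"
    by (simp only: emb2_proj)
  then show "proj1 (emb h * q) = h * proj1 q" "proj2 (emb h * q) = h * proj2 q"
    by simp_all
qed

lemma slice_ball_eq: "slice_ball i = emb ` ball 0 1"
  by (auto simp: slice_ball_def slice_def norm_emb)

text \<open>On the slice the real differential satisfies \<open>D (emb h) = emb h * D 1\<close>, and
  the projections turn this into complex differentiability of each component.\<close>

lemma slice_regular_components:
  assumes f: "f \<in> slice_regular"
  shows "(\<lambda>z. proj1 (f (emb z))) holomorphic_on ball 0 1" "(\<lambda>z. proj2 (f (emb z))) holomorphic_on ball 0 1"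
proof -
  have "\<exists>d1 d2. ((\<lambda>z. proj1 (f (emb z))) has_field_derivative d1) (at z) \<and>
      ((\<lambda>z. proj2 (f (emb z))) has_field_derivative d2) (at z)" if z: "z \<in> ball 0 1" for z
  proof -
    have zb: "emb z \<in> ball 0 1" using z by (simp add: norm_emb)
    then have "f differentiable (at (emb z))"
      using f unfolding slice_regular_def by blast
    then obtain D where D: "(f has_derivative D) (at (emb z))"
      unfolding differentiable_def by blast
    interpret D: bounded_linear D using D by (rule has_derivative_bounded_linear)
    have fD: "((\<lambda>z. f (emb z)) has_derivative (\<lambda>h. D (emb h))) (at z)"
      using has_derivative_compose[OF bounded_linear_imp_has_derivative[OF bounded_linear_emb] D] by simp
    have ln: "((\<lambda>s. f (q + s *\<^sub>R v)) has_vector_derivative D v) (at s)" if "q + s *\<^sub>R v = emb z" for q v s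
    proof -
      have "((\<lambda>s. q + s *\<^sub>R v) has_derivative (\<lambda>h. h *\<^sub>R v)) (at s)"
        by (auto intro!: derivative_eq_intros)
      from has_derivative_compose[OF this, of f D] D that
      have "((\<lambda>s. f (q + s *\<^sub>R v)) has_derivative (\<lambda>h. D (h *\<^sub>R v))) (at s)" by simp
      then show ?thesis by (simp add: has_vector_derivative_def D.scaleR)
    qed
    have "vector_derivative (\<lambda>s. f (of_real s + i * of_real (Im z))) (at (Re z)) = D 1"
      using ln[of "Im z *\<^sub>R i" "Re z" 1]
      by (intro vector_derivative_at) (simp add: of_real_def emb_scaleR add.commute)
    moreover have "vector_derivative (\<lambda>t. f (of_real (Re z) + i * of_real t)) (at (Im z)) = D i"
      using ln[of "Re z *\<^sub>R 1" "Im z" i]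
      by (intro vector_derivative_at) (simp add: of_real_def emb_scaleR)
    moreover have "vector_derivative (\<lambda>s. f (of_real s + i * of_real (Im z))) (at (Re z))
        + i * vector_derivative (\<lambda>t. f (of_real (Re z) + i * of_real t)) (at (Im z)) = 0"
      using f i zb unfolding slice_regular_def slice_emb_def by blast
    ultimately have CR: "D 1 + i * D i = 0"
      by simp
    \<comment> \<open>Left multiplication of the Cauchy-Riemann equation by i solves it for
      \<open>D i\<close>.\<close>
    have "i * (D 1 + i * D i) = i * D 1 - D i"
      by (simp add: distrib_left imag_units_sq[OF i] flip: mult.assoc)
    then have Di: "D i = i * D 1" using CR by simp
    have De: "D (emb h) = emb h * D 1" for h
      by (simp add: emb_scaleR D.add D.scaleR Di distrib_right)
    have "((\<lambda>z. proj1 (f (emb z))) has_derivative (\<lambda>h. proj1 (D (emb h)))) (at z)"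
      "((\<lambda>z. proj2 (f (emb z))) has_derivative (\<lambda>h. proj2 (D (emb h)))) (at z)"
      using fD by (rule bounded_linear.has_derivative[OF bounded_linear_proj(1)]
        bounded_linear.has_derivative[OF bounded_linear_proj(2)])+
    then have "((\<lambda>z. proj1 (f (emb z))) has_field_derivative proj1 (D 1)) (at z)"
      "((\<lambda>z. proj2 (f (emb z))) has_field_derivative proj2 (D 1)) (at z)"
      unfolding De proj_emb_mult has_field_derivative_def by (simp_all add: mult.commute[of _ "_ (D 1)"])
    then show ?thesis by blast
  qed
  then show "(\<lambda>z. proj1 (f (emb z))) holomorphic_on ball 0 1" "(\<lambda>z. proj2 (f (emb z))) holomorphic_on ball 0 1"
    unfolding holomorphic_on_open[OF open_ball] by blast+
qed

text \<open>Only values on the slice are recorded. This suffices because \<open>real_partial\<close>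
  moves along the real direction, which lies in the slice, and the integrals and suprema of the
  functional range over the slice.\<close>

definition splits :: "(quat \<Rightarrow> quat) \<Rightarrow> (complex \<Rightarrow> complex) \<Rightarrow> (complex \<Rightarrow> complex) \<Rightarrow> bool" where
  "splits f F1 F2 \<longleftrightarrow> F1 holomorphic_on ball 0 1 \<and> F2 holomorphic_on ball 0 1 \<and>
    (\<forall>z\<in>ball 0 1. f (emb z) = emb2 (F1 z) (F2 z))"

lemma slice_regular_splits:
  "f \<in> slice_regular \<Longrightarrow> splits f (\<lambda>z. proj1 (f (emb z))) (\<lambda>z. proj2 (f (emb z)))"
  by (simp add: splits_def slice_regular_components emb2_proj)

lemma splits_real_partial:
  assumes "splits f F1 F2"
  shows "splits (real_partial f) (deriv F1) (deriv F2)"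
proof -
  have F: "F1 holomorphic_on ball 0 1" "F2 holomorphic_on ball 0 1"
    and eq: "\<And>z. z \<in> ball 0 1 \<Longrightarrow> f (emb z) = emb2 (F1 z) (F2 z)"
    using assms by (auto simp: splits_def)
  have "real_partial f (emb z) = emb2 (deriv F1 z) (deriv F2 z)" if z: "z \<in> ball 0 1" for z
    unfolding real_partial_def
  proof (rule vector_derivative_at)
    have d: "((\<lambda>t. F (z + of_real t)) has_vector_derivative deriv F z) (at 0)"
      if "F holomorphic_on ball 0 1" for F
    proof -
      have "(F has_field_derivative deriv F z) (at (z + of_real 0))"
        using holomorphic_derivI[OF that open_ball z] by simp
      moreover have "((\<lambda>t. z + of_real t) has_vector_derivative 1) (at 0)"
        by (auto intro!: derivative_eq_intros)
      ultimately have "(F \<circ> (\<lambda>t. z + of_real t) has_vector_derivative 1 * deriv F z) (at 0)"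
        by (intro field_vector_diff_chain_at)
      then show ?thesis by (simp add: o_def)
    qed
    have e: "((\<lambda>t. emb (F (z + of_real t))) has_vector_derivative emb (deriv F z)) (at 0)"
      if "F holomorphic_on ball 0 1" for F
      by (rule bounded_linear.has_vector_derivative[OF bounded_linear_emb d[OF that]])
    have "((\<lambda>t. emb2 (F1 (z + of_real t)) (F2 (z + of_real t))) has_vector_derivative emb2 (deriv F1 z) (deriv F2 z)) (at 0)"
      unfolding emb2_def
      by (intro has_vector_derivative_add e F
        bounded_linear.has_vector_derivative[OF bounded_linear_mult_left e[OF F(2)]])
    then show "((\<lambda>t. f (emb z + of_real t)) has_vector_derivative emb2 (deriv F1 z) (deriv F2 z)) (at 0)"
    proof (rule has_vector_derivative_transform_within_open)
      show "open ((\<lambda>t. z + of_real t) -` ball 0 1)"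
        by (intro open_vimage continuous_intros open_ball)
      show "0 \<in> (\<lambda>t. z + of_real t) -` ball 0 1" using z by simp
      fix t :: real assume "t \<in> (\<lambda>t. z + of_real t) -` ball 0 1"
      then show "emb2 (F1 (z + of_real t)) (F2 (z + of_real t)) = f (emb z + of_real t)"
        using eq[of "z + of_real t"] by (simp add: emb_add emb_of_real)
    qed
  qed
  then show ?thesis
    unfolding splits_def using F by (auto intro: holomorphic_deriv)
qed

lemma splits_real_partial_funpow:
  "splits f F1 F2 \<Longrightarrow> splits ((real_partial ^^ n) f) ((deriv ^^ n) F1) ((deriv ^^ n) F2)"
  by (induction n) (simp_all add: splits_real_partial)

text \<open>All coefficients lie in the slice of i, where they commute with the variable, so the
  star product becomes the ordinary product of a geometric series and a - z.\<close>

lemma slice_moebius_emb: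
  assumes a: "norm a < 1" and z: "norm z < 1"
  shows "slice_moebius (emb a) (emb z) = emb (mob a z)"
proof -
  define c where "c n = cnj a ^ n * a - (if n = 0 then 0 else cnj a ^ (n - 1))" for n
  have "norm (cnj a * z) < 1"
    using a z by (simp add: norm_mult) (metis mult_less_cancel_right2 norm_ge_zero mult_left_le_one_le order_less_imp_le le_less_trans)
  then have "(\<lambda>n. (cnj a * z) ^ n) sums (1 / (1 - cnj a * z))" by (rule geometric_sums)
  then have s1: "(\<lambda>n. (cnj a * z) ^ n * a) sums (1 / (1 - cnj a * z) * a)"
    and s2: "(\<lambda>n. (cnj a * z) ^ n * z) sums (1 / (1 - cnj a * z) * z)"
    by (rule sums_mult2)+
  define t where "t n = (if n = 0 then 0 else (cnj a * z) ^ (n - 1) * z)" for n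
  have "(\<lambda>n. t (Suc n)) sums (1 / (1 - cnj a * z) * z)" using s2 by (simp add: t_def)
  moreover have t0: "t 0 = 0" by (simp add: t_def)
  ultimately have "t sums (1 / (1 - cnj a * z) * z)" by (simp only: sums_Suc_iff t0 add_0_right)
  from sums_diff[OF s1 this] have "(\<lambda>n. (cnj a * z) ^ n * a - t n) sums mob a z"
    by (simp add: mob_def diff_divide_distrib)
  moreover have "(cnj a * z) ^ n * a - t n = z ^ n * c n" for n
    by (cases n) (simp_all add: t_def c_def power_mult_distrib algebra_simps)
  ultimately have "(\<lambda>n. z ^ n * c n) sums mob a z" by simp
  then have "(\<lambda>n. emb (z ^ n * c n)) sums emb (mob a z)"
    by (rule bounded_linear.sums[OF bounded_linear_emb])
  moreover have "emb (z ^ n * c n) = emb z ^ n * fps_nth (Abs_fps (\<lambda>n. qcnj (emb a) ^ n) * (fps_const (emb a) - fps_X)) n" for n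
    by (simp add: right_diff_distrib c_def emb_mult emb_power emb_diff qcnj_emb)
  ultimately show ?thesis
    unfolding slice_moebius_def slice_series_def by (simp add: sums_iff)
qed

text \<open>For Im z > 0 the unit direction I is i, so 1 + I i = 0 and 1 - I i = 2; for Im z < 0 it
  is -i and the roles are exchanged. For real z the direction is 0 and both terms are evaluated at
  the same point.\<close>

lemma slice_extension_emb: "slice_extension i g (emb z) = g (emb z)"
proof -
  have re: "qre (emb z) = Re z" using i by (simp add: emb_scaleR imag_units_def)
  have n: "norm i = 1" using i by (simp add: imag_units_def)
  have d: "emb z - of_real (Re z) = Im z *\<^sub>R i" by (simp add: emb_scaleR of_real_def)
  have ii: "i * i = -1" by (rule imag_units_sq[OF i])
  have e: "emb z = of_real (Re z) + of_real (Im z) * i"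
    by (simp add: slice_emb_def of_real_quat_commute)
  consider "Im z > 0" | "Im z < 0" | "Im z = 0" by linarith
  then show ?thesis
  proof cases
    case 1
    then show ?thesis
      unfolding slice_extension_def qimag_dir_def re d Let_def
      by (simp add: n sgn_div_norm ii e flip: scaleR_2)
  next
    case 2
    then show ?thesis
      unfolding slice_extension_def qimag_dir_def re d Let_def
      by (simp add: n sgn_div_norm ii e flip: scaleR_2)
  next
    case 3
    then show ?thesis
      unfolding slice_extension_def qimag_dir_def re d Let_def
      by (simp add: e flip: scaleR_2)
  qed
qed

lemma splits_moebius_comp:
  assumes s: "splits f F1 F2" and a: "norm a < 1"
  shows "splits (moebius_comp i j f (emb a)) (\<lambda>z. F1 (mob a z)) (\<lambda>z. F2 (mob a z))"
proof -
  have holo: "(\<lambda>z. F (mob a z)) holomorphic_on ball 0 1" if "F holomorphic_on ball 0 1" for F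
    using mob_norm_less_one[OF a] mob_holomorphic[OF a]
    by (intro holomorphic_on_compose_gen[OF _ that, unfolded o_def]) auto
  have "moebius_comp i j f (emb a) (emb z) = emb2 (F1 (mob a z)) (F2 (mob a z))" if "z \<in> ball 0 1" for z
  proof -
    have z: "norm z < 1" using that by simp
    have "f (emb (mob a z)) = emb2 (F1 (mob a z)) (F2 (mob a z))"
      using s mob_norm_less_one[OF a z] by (simp add: splits_def)
    then show ?thesis
      unfolding moebius_comp_def Let_def slice_extension_emb o_def slice_moebius_emb[OF a z]
      by (simp add: slice_split_emb2) (simp add: emb2_def)
  qed
  then show ?thesis using s holo by (simp add: splits_def)
qed

end

section \<open>The invariant functional on the disc\<close>

text \<open>Expanding the left side by 1 - cnj b z and dividing by M = 1 - cnj a b exhibits both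
  sides as the same quotient. The constant in front of z is -cnj M / M, which has modulus 1.\<close>

lemma mob_mob:
  assumes a: "norm a < 1" and b: "norm b < 1" and z: "norm z < 1"
  shows "mob a (mob b z) = mob (mob a b) (- (1 - a * cnj b) / (1 - cnj a * b) * z)"
proof -
  define M where "M = 1 - cnj a * b"
  have M: "M \<noteq> 0" using one_minus_cnj_mult_bounds(3)[OF a b] by (simp add: M_def)
  have cM: "1 - a * cnj b = cnj M" by (simp add: M_def)
  define S where "S = M - (cnj b - cnj a) * z"
  have n1: "1 - cnj b * z \<noteq> 0" by (rule one_minus_cnj_mult_bounds(3)[OF b z])
  have n2: "1 - cnj a * mob b z \<noteq> 0" by (rule one_minus_cnj_mult_bounds(3)[OF a mob_norm_less_one[OF b z]])
  have e1: "(1 - cnj a * mob b z) * (1 - cnj b * z) = S"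
    using n1 by (simp add: mob_def S_def M_def field_simps)
  have e2: "(a - mob b z) * (1 - cnj b * z) = (a - b) + cnj M * z"
    using n1 by (simp add: mob_def M_def field_simps)
  have S: "S \<noteq> 0" using e1 n1 n2 by auto
  have "mob a (mob b z) = ((a - mob b z) * (1 - cnj b * z)) / ((1 - cnj a * mob b z) * (1 - cnj b * z))"
    using n1 by (simp add: mob_def)
  also have "\<dots> = ((a - b) + cnj M * z) / S" unfolding e1 e2 ..
  also have "\<dots> = mob (mob a b) (- cnj M / M * z)"
  proof -
    have mab: "mob a b = (a - b) / M" by (simp add: mob_def M_def)
    have "mob a b - (- cnj M / M * z) = ((a - b) + cnj M * z) / M"
      by (simp add: mab add_divide_distrib)
    moreover have "1 - cnj (mob a b) * (- cnj M / M * z) = S / M"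
      using M by (simp add: mab S_def field_simps)
    ultimately show ?thesis using M by (simp add: mob_def)
  qed
  finally show ?thesis by (simp only: cM M_def[symmetric])
qed

text \<open>The case b = a of the composition law: phi_a(a) = 0, the rotation is multiplication by
  -1, and so is phi_0.\<close>

lemma mob_involution:
  assumes a: "norm a < 1" and z: "norm z < 1"
  shows "mob a (mob a z) = z"
proof -
  have n: "1 - a * cnj a \<noteq> 0" using one_minus_cnj_mult_bounds(3)[OF a a] by (simp add: mult.commute)
  have u: "- (1 - a * cnj a) / (1 - cnj a * a) = - 1"
    by (simp only: mult.commute[of "cnj a" a] minus_divide_left[symmetric] divide_self[OF n])
  show ?thesis unfolding mob_mob[OF a a z] u by (simp add: mob_def)
qed

lemma mob_image_ball:
  assumes a: "norm a < 1" shows "mob a ` ball 0 1 = ball 0 1"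
proof
  show "mob a ` ball 0 1 \<subseteq> ball 0 1" using mob_norm_less_one[OF a] by auto
  show "ball 0 1 \<subseteq> mob a ` ball 0 1"
  proof
    fix z :: complex assume "z \<in> ball 0 1"
    then show "z \<in> mob a ` ball 0 1"
      using mob_involution[OF a, of z] mob_norm_less_one[OF a, of z] by (intro image_eqI[of _ _ "mob a z"]) auto
  qed
qed

lemma holomorphic_comp_mob:
  assumes "norm a < 1" "F holomorphic_on ball 0 1"
  shows "(\<lambda>z. F (mob a z)) holomorphic_on ball 0 1"
  using mob_norm_less_one[OF assms(1)] mob_holomorphic[OF assms(1)]
  by (intro holomorphic_on_compose_gen[OF _ assms(2), unfolded o_def]) auto

text \<open>The modulus of the quaternion a + b j is the norm of the pair (a, b), so the functional
  sees the two components only through this norm.\<close>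

definition rho_integrand :: "real \<Rightarrow> nat \<Rightarrow> (complex \<Rightarrow> complex) \<Rightarrow> (complex \<Rightarrow> complex) \<Rightarrow> complex \<Rightarrow> ennreal" where
  "rho_integrand p n F1 F2 z = ennreal (dw z powr (real n * p) * norm ((deriv ^^ n) F1 z, (deriv ^^ n) F2 z) powr p)"

abbreviation rho_integral :: "real \<Rightarrow> nat \<Rightarrow> (complex \<Rightarrow> complex) \<Rightarrow> (complex \<Rightarrow> complex) \<Rightarrow> complex \<Rightarrow> ennreal" where
  "rho_integral p n F1 F2 a \<equiv> (\<integral>\<^sup>+z. rho_integrand p n (\<lambda>x. F1 (mob a x)) (\<lambda>x. F2 (mob a x)) z \<partial>disc_lambda)"

definition disc_rho :: "real \<Rightarrow> nat \<Rightarrow> (complex \<Rightarrow> complex) \<Rightarrow> (complex \<Rightarrow> complex) \<Rightarrow> ennreal" where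
  "disc_rho p n F1 F2 = (SUP z\<in>ball 0 1. ennreal (norm (F1 z, F2 z))) +
    (SUP a\<in>ball 0 1. ennreal_powr (rho_integral p n F1 F2 a) (1 / p))"

lemma rho_integrand_measurable:
  assumes F: "F1 holomorphic_on ball 0 1" "F2 holomorphic_on ball 0 1"
  shows "rho_integrand p n F1 F2 \<in> borel_measurable (disc_borel)"
proof -
  have "continuous_on (ball 0 1) (\<lambda>z. norm ((deriv ^^ n) F1 z, (deriv ^^ n) F2 z))"
    by (intro continuous_intros holomorphic_on_imp_continuous_on holomorphic_higher_deriv F open_ball)
  then have [measurable]: "(\<lambda>z. norm ((deriv ^^ n) F1 z, (deriv ^^ n) F2 z)) \<in> borel_measurable (disc_borel)"
    by (rule borel_measurable_continuous_on_restrict)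
  show ?thesis unfolding rho_integrand_def by measurable
qed

text \<open>The chain rule contributes u^n, of modulus 1, and \<lambda> is rotation invariant.
  \<open>G1\<close> and \<open>G2\<close> are prescribed on the disc only, because the composition
  law is available only there.\<close>

lemma rho_integral_rotation:
  assumes F: "F1 holomorphic_on ball 0 1" "F2 holomorphic_on ball 0 1"
    and eq: "\<And>z. norm z < 1 \<Longrightarrow> G1 z = F1 (u * z)" "\<And>z. norm z < 1 \<Longrightarrow> G2 z = F2 (u * z)" and u: "norm u = 1"
  shows "(\<integral>\<^sup>+z. rho_integrand p n G1 G2 z \<partial>disc_lambda) = (\<integral>\<^sup>+z. rho_integrand p n F1 F2 z \<partial>disc_lambda)"
proof -
  have d: "(deriv ^^ n) G z = u ^ n * (deriv ^^ n) F (u * z)"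
    if FG: "F holomorphic_on ball 0 1" "\<And>z. norm z < 1 \<Longrightarrow> G z = F (u * z)" and z: "norm z < 1" for F G z
  proof -
    have ub: "u * w \<in> ball 0 1" if "w \<in> ball 0 1" for w using that u by (simp add: norm_mult)
    have holo: "(\<lambda>w. F (u * w)) holomorphic_on ball 0 1"
      using ub by (intro holomorphic_on_compose_gen[OF _ FG(1), unfolded o_def]) (auto intro!: holomorphic_intros)
    have "G holomorphic_on ball 0 1"
      using FG(2) by (intro holomorphic_transform[OF holo]) auto
    then have "(deriv ^^ n) G z = (deriv ^^ n) (\<lambda>w. F (u * w)) z"
      using FG(2) z by (intro higher_deriv_transform_within_open[OF _ holo open_ball]) auto
    also have "\<dots> = u ^ n * (deriv ^^ n) F (u * z)"
      using z ub by (intro higher_deriv_compose_linear[OF FG(1) open_ball[of 0 1] open_ball]) auto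
    finally show ?thesis .
  qed
  have "rho_integrand p n G1 G2 z = rho_integrand p n F1 F2 (u * z)" if z: "norm z < 1" for z
  proof -
    have "(deriv ^^ n) G1 z = u ^ n * (deriv ^^ n) F1 (u * z)" "(deriv ^^ n) G2 z = u ^ n * (deriv ^^ n) F2 (u * z)"
      by (rule d; use F eq z in simp)+
    then show ?thesis
      using u by (simp add: rho_integrand_def norm_Pair norm_mult norm_power)
  qed
  then have "(\<integral>\<^sup>+z. rho_integrand p n G1 G2 z \<partial>disc_lambda) = (\<integral>\<^sup>+z. rho_integrand p n F1 F2 (u * z) \<partial>disc_lambda)"
    by (intro nn_integral_cong) simp
  also have "\<dots> = (\<integral>\<^sup>+z. rho_integrand p n F1 F2 z \<partial>disc_lambda)"
    by (rule nn_integral_disc_lambda_rotation[OF rho_integrand_measurable[OF F] u])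
  finally show ?thesis .
qed

text \<open>Composing with phi_a replaces the parameter b in the supremum by phi_a(b), up to a
  rotation that does not affect the integral. Since phi_a permutes the disc, neither supremum
  changes.\<close>

lemma disc_rho_mob:
  assumes F: "F1 holomorphic_on ball 0 1" "F2 holomorphic_on ball 0 1" and a: "norm a < 1"
  shows "disc_rho p n (\<lambda>z. F1 (mob a z)) (\<lambda>z. F2 (mob a z)) = disc_rho p n F1 F2"
proof -
  define J where "J a = ennreal_powr (rho_integral p n F1 F2 a) (1 / p)" for a
  have "ennreal_powr (\<integral>\<^sup>+z. rho_integrand p n (\<lambda>x. F1 (mob a (mob b x))) (\<lambda>x. F2 (mob a (mob b x))) z \<partial>disc_lambda) (1 / p) = J (mob a b)"
    if b: "b \<in> ball 0 1" for b
  proof -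
    define u where "u = - (1 - a * cnj b) / (1 - cnj a * b)"
    have b': "norm b < 1" using b by simp
    have "norm (1 - a * cnj b) = norm (1 - cnj a * b)"
      by (metis complex_cnj_cnj complex_cnj_diff complex_cnj_mult complex_cnj_one complex_mod_cnj)
    then have u: "norm u = 1"
      using one_minus_cnj_mult_bounds(3)[OF a b'] 
      unfolding u_def norm_divide norm_minus_cancel by simp
    have c: "norm (mob a b) < 1" by (rule mob_norm_less_one[OF a b'])
    show ?thesis
      unfolding J_def
      by (rule arg_cong[where f = "\<lambda>x. ennreal_powr x (1 / p)"],
        rule rho_integral_rotation[OF holomorphic_comp_mob[OF c F(1)] holomorphic_comp_mob[OF c F(2)] _ _ u])
        (simp_all only: mob_mob[OF a b'] u_def)
  qed
  then have "(SUP b\<in>ball 0 1. ennreal_powr (\<integral>\<^sup>+z. rho_integrand p n (\<lambda>x. F1 (mob a (mob b x))) (\<lambda>x. F2 (mob a (mob b x))) z \<partial>disc_lambda) (1 / p))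
    = (SUP b\<in>ball 0 1. J (mob a b))"
    by (intro SUP_cong refl)
  also have "\<dots> = (SUP c\<in>mob a ` ball 0 1. J c)" by (simp add: image_image)
  finally have 2: "(SUP b\<in>ball 0 1. ennreal_powr (\<integral>\<^sup>+z. rho_integrand p n (\<lambda>x. F1 (mob a (mob b x))) (\<lambda>x. F2 (mob a (mob b x))) z \<partial>disc_lambda) (1 / p))
    = (SUP c\<in>ball 0 1. J c)" unfolding mob_image_ball[OF a] .
  have "(SUP z\<in>ball 0 1. ennreal (norm (F1 (mob a z), F2 (mob a z)))) = (SUP z\<in>mob a ` ball 0 1. ennreal (norm (F1 z, F2 z)))"
    by (simp add: image_image)
  also have "\<dots> = (SUP z\<in>ball 0 1. ennreal (norm (F1 z, F2 z)))" unfolding mob_image_ball[OF a] ..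
  finally show ?thesis
    using 2 unfolding disc_rho_def J_def by simp
qed

text \<open>The pair norm is at most the sum of the component norms, and subadditivity of x^p
  reduces the integral to the two components, whose bounds are uniform in a. Here m comes from
  membership in the space and n from the functional.\<close>

lemma disc_rho_finite:
  assumes p: "0 < p" "p \<le> 1" and n: "real n * p > 1" and m: "real m * p > 1"
    and F: "F1 holomorphic_on ball 0 1" "F2 holomorphic_on ball 0 1"
    and fin: "besov_integral p m ((deriv ^^ m) F1) < \<infinity>"
      "besov_integral p m ((deriv ^^ m) F2) < \<infinity>"
  shows "disc_rho p n F1 F2 < \<infinity>"
proof -
  from besov_norm_bounded[OF p F(1) m fin(1)] obtain B1 where B1: "\<forall>z. norm z < 1 \<longrightarrow> norm (F1 z) \<le> B1" ..
  from besov_norm_bounded[OF p F(2) m fin(2)] obtain B2 where B2: "\<forall>z. norm z < 1 \<longrightarrow> norm (F2 z) \<le> B2" ..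
  have "(SUP z\<in>ball 0 1. ennreal (norm (F1 z, F2 z))) \<le> ennreal (B1 + B2)"
  proof (intro SUP_least ennreal_leI)
    fix z :: complex assume "z \<in> ball 0 1"
    then have "norm (F1 z) + norm (F2 z) \<le> B1 + B2" using B1 B2 by (intro add_mono) auto
    then show "norm (F1 z, F2 z) \<le> B1 + B2" using norm_Pair_le[of "F1 z" "F2 z"] by linarith
  qed
  then have 1: "(SUP z\<in>ball 0 1. ennreal (norm (F1 z, F2 z))) < \<infinity>"
    by (simp add: le_less_trans)
  from besov_mob_bounded[OF p F(1) m fin(1) n] obtain K1 where K1: "\<forall>a. norm a < 1 \<longrightarrow>
    besov_integral p n ((deriv ^^ n) (\<lambda>x. F1 (mob a x))) \<le> ennreal K1" ..
  from besov_mob_bounded[OF p F(2) m fin(2) n] obtain K2 where K2: "\<forall>a. norm a < 1 \<longrightarrow>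
    besov_integral p n ((deriv ^^ n) (\<lambda>x. F2 (mob a x))) \<le> ennreal K2" ..
  define K where "K = (ennreal K1 + ennreal K2)"
  have K: "K < top" by (simp add: K_def)
  have "ennreal_powr (rho_integral p n F1 F2 a) (1 / p)
      \<le> ennreal (enn2real K powr (1 / p))" if a: "a \<in> ball 0 1" for a
  proof -
    have a': "norm a < 1" using a by simp
    define D1 where "D1 = (deriv ^^ n) (\<lambda>x. F1 (mob a x))"
    define D2 where "D2 = (deriv ^^ n) (\<lambda>x. F2 (mob a x))"
    have D: "D1 holomorphic_on ball 0 1" "D2 holomorphic_on ball 0 1"
      unfolding D1_def D2_def by (intro holomorphic_higher_deriv holomorphic_comp_mob a' F open_ball)+
    note [measurable] = holomorphic_norm_measurable_disc[OF D(1)] holomorphic_norm_measurable_disc[OF D(2)]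
    have "rho_integral p n F1 F2 a
      \<le> (\<integral>\<^sup>+z. ennreal ((dw z ^ n * norm (D1 z)) powr p) + ennreal ((dw z ^ n * norm (D2 z)) powr p) \<partial>disc_lambda)"
    proof (rule nn_integral_mono)
      fix z :: complex assume "z \<in> space disc_lambda"
      then have z: "norm z < 1" by simp
      define A where "A = dw z"
      have A: "A > 0" using z by (simp add: A_def abs_square_less_1)
      have "A powr (real n * p) * norm (D1 z, D2 z) powr p = (A ^ n * norm (D1 z, D2 z)) powr p"
        using A by (simp add: powr_mult powr_powr flip: powr_realpow)
      also have "\<dots> \<le> (A ^ n * norm (D1 z) + A ^ n * norm (D2 z)) powr p"
        using A p norm_Pair_le[of "D1 z" "D2 z"]
        by (intro powr_mono2) (auto simp flip: distrib_left)
      also have "\<dots> \<le> (A ^ n * norm (D1 z)) powr p + (A ^ n * norm (D2 z)) powr p"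
        using A p by (intro powr_add_le_add_powr) auto
      finally have "ennreal (A powr (real n * p) * norm (D1 z, D2 z) powr p)
        \<le> ennreal ((A ^ n * norm (D1 z)) powr p + (A ^ n * norm (D2 z)) powr p)"
        by (rule ennreal_leI)
      then show "rho_integrand p n (\<lambda>x. F1 (mob a x)) (\<lambda>x. F2 (mob a x)) z
        \<le> ennreal ((dw z ^ n * norm (D1 z)) powr p) + ennreal ((dw z ^ n * norm (D2 z)) powr p)"
        unfolding rho_integrand_def D1_def[symmetric] D2_def[symmetric] A_def[symmetric] by simp
    qed
    also have "\<dots> = besov_integral p n D1
        + (besov_integral p n D2)"
      by (rule nn_integral_add) simp_all
    also have "\<dots> \<le> K"
      unfolding K_def D1_def D2_def using K1 K2 a' by (intro add_mono) blast+
    finally have le: "rho_integral p n F1 F2 a \<le> K" (is "?I \<le> K") .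
    then have "?I < top" using K by (rule le_less_trans)
    then have "ennreal_powr ?I (1 / p) = ennreal (enn2real ?I powr (1 / p))"
      by (simp add: ennreal_powr_def)
    also have "\<dots> \<le> ennreal (enn2real K powr (1 / p))"
      using p enn2real_mono[OF le K] by (intro ennreal_leI powr_mono2) auto
    finally show ?thesis .
  qed
  then have "(SUP a\<in>ball 0 1. ennreal_powr (rho_integral p n F1 F2 a) (1 / p))
    \<le> ennreal (enn2real K powr (1 / p))"
    by (rule SUP_least)
  then have 2: "(SUP a\<in>ball 0 1. ennreal_powr (rho_integral p n F1 F2 a) (1 / p)) < \<infinity>"
    by (rule le_less_trans) simp
  show ?thesis unfolding disc_rho_def using 1 2 by simp
qed

section \<open>Return to the quaternionic functional\<close>

context orthogonal_units
begin

lemma besov_rho_eq_disc_rho: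
  assumes s: "splits f F1 F2"
  shows "besov_rho p n i j f = disc_rho p n F1 F2"
proof -
  have 1: "(SUP z\<in>slice_ball i. ennreal (norm (f z))) = (SUP z\<in>ball 0 1. ennreal (norm (F1 z, F2 z)))"
    unfolding slice_ball_eq image_image
    using s by (intro SUP_cong refl) (simp add: splits_def norm_emb2)
  have "slice_lambda_integral i (\<lambda>z. ennreal ((1 - (norm z)\<^sup>2) powr (real n * p)
      * norm ((real_partial ^^ n) (moebius_comp i j f (emb a)) z) powr p))
    = rho_integral p n F1 F2 a"
    if a: "a \<in> ball 0 1" for a
  proof -
    have "splits ((real_partial ^^ n) (moebius_comp i j f (emb a)))
      ((deriv ^^ n) (\<lambda>x. F1 (mob a x))) ((deriv ^^ n) (\<lambda>x. F2 (mob a x)))"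
      using a by (intro splits_real_partial_funpow splits_moebius_comp s) simp
    then have "(real_partial ^^ n) (moebius_comp i j f (emb a)) (emb z)
      = emb2 ((deriv ^^ n) (\<lambda>x. F1 (mob a x)) z) ((deriv ^^ n) (\<lambda>x. F2 (mob a x)) z)" if "z \<in> ball 0 1" for z
      using that unfolding splits_def by blast
    then show ?thesis
      unfolding slice_lambda_integral_def rho_integrand_def
      by (intro nn_integral_cong) (simp add: norm_emb2 norm_emb)
  qed
  then have 2: "(SUP a\<in>slice_ball i. ennreal_powr
      (slice_lambda_integral i (\<lambda>z. ennreal ((1 - (norm z)\<^sup>2) powr (real n * p)
         * norm ((real_partial ^^ n) (moebius_comp i j f a) z) powr p))) (1 / p))
    = (SUP a\<in>ball 0 1. ennreal_powr (rho_integral p n F1 F2 a) (1 / p))"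
    unfolding slice_ball_eq image_image by (intro SUP_cong refl) simp
  show ?thesis unfolding besov_rho_def disc_rho_def 1 2 ..
qed

text \<open>Each component is dominated by the norm of the pair, which is the quaternionic
  norm.\<close>

lemma besov_component_integrals:
  assumes p: "0 < p" and s: "splits f F1 F2"
    and fin: "slice_lambda_integral i
       (\<lambda>q. ennreal (norm ((1 - (norm q)\<^sup>2) ^ m *\<^sub>R (real_partial ^^ m) f q) powr p)) < \<infinity>"
  shows "besov_integral p m ((deriv ^^ m) F1) < \<infinity>"
    "besov_integral p m ((deriv ^^ m) F2) < \<infinity>"
proof -
  have eq: "(real_partial ^^ m) f (emb z) = emb2 ((deriv ^^ m) F1 z) ((deriv ^^ m) F2 z)" if "z \<in> ball 0 1" for z
    using splits_real_partial_funpow[OF s, of m] that unfolding splits_def by blast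
  have "besov_integral p m F < \<infinity>"
    if F: "\<And>z. z \<in> ball 0 1 \<Longrightarrow> norm (F z) \<le> norm ((deriv ^^ m) F1 z, (deriv ^^ m) F2 z)" for F :: "complex \<Rightarrow> complex"
  proof (rule le_less_trans[OF _ fin])
    show "besov_integral p m F
      \<le> slice_lambda_integral i (\<lambda>q. ennreal (norm ((1 - (norm q)\<^sup>2) ^ m *\<^sub>R (real_partial ^^ m) f q) powr p))"
      unfolding slice_lambda_integral_def
    proof (rule nn_integral_mono)
      fix z :: complex assume "z \<in> space disc_lambda"
      then have z: "z \<in> ball 0 1" by simp
      then have A: "0 \<le> 1 - (norm z)\<^sup>2" by (simp add: abs_square_le_1)
      have "(dw z ^ m * norm (F z)) powr p \<le> (dw z ^ m * norm ((deriv ^^ m) F1 z, (deriv ^^ m) F2 z)) powr p"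
        using p A F[OF z] by (intro powr_mono2 mult_left_mono) auto
      then show "ennreal ((dw z ^ m * norm (F z)) powr p)
        \<le> ennreal (norm ((1 - (norm (emb z))\<^sup>2) ^ m *\<^sub>R (real_partial ^^ m) f (emb z)) powr p)"
        unfolding eq[OF z] norm_scaleR norm_emb2 norm_emb using A by (intro ennreal_leI) simp
    qed
  qed
  then show "besov_integral p m ((deriv ^^ m) F1) < \<infinity>"
    "besov_integral p m ((deriv ^^ m) F2) < \<infinity>"
    using norm_fst_le norm_snd_le by blast+
qed

end

theorem proposition4p14:
  fixes i j :: quat and p :: real and n :: nat
  assumes "i \<in> imag_units" and "j \<in> imag_units" and "inner i j = 0"
    and "0 < p" and "p \<le> 1" and "real n * p > 1"
  shows "(\<forall>f\<in>besov p i. besov_rho p n i j f < \<infinity>) \<and>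
    (\<forall>f\<in>besov p i. \<forall>a\<in>slice_ball i.
       besov_rho p n i j (moebius_comp i j f a) = besov_rho p n i j f)"
proof -
  interpret orthogonal_units i j by standard (rule assms)+
  show ?thesis
  proof (intro conjI ballI)
    fix f assume f: "f \<in> besov p i"
    define F1 F2 where "F1 z = proj1 (f (emb z))" and "F2 z = proj2 (f (emb z))" for z
    have s: "splits f F1 F2"
      using f slice_regular_splits unfolding F1_def F2_def besov_def by blast
    then have F: "F1 holomorphic_on ball 0 1" "F2 holomorphic_on ball 0 1" by (auto simp: splits_def)
    from f obtain m :: nat where m: "real m * p > 1" and fin: "slice_lambda_integral i
       (\<lambda>q. ennreal (norm ((1 - (norm q)\<^sup>2) ^ m *\<^sub>R (real_partial ^^ m) f q) powr p)) < \<infinity>"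
      unfolding besov_def by blast
    show "besov_rho p n i j f < \<infinity>"
      unfolding besov_rho_eq_disc_rho[OF s]
      by (rule disc_rho_finite[OF assms(4-6) m F besov_component_integrals[OF assms(4) s fin]])
    fix a assume "a \<in> slice_ball i"
    then obtain \<alpha> where \<alpha>: "norm \<alpha> < 1" "a = emb \<alpha>" by (auto simp: slice_ball_eq)
    \<comment> \<open>The composed function splits into the two components composed with
      phi_\<alpha>, so both sides are values of \<open>disc_rho\<close>.\<close>
    show "besov_rho p n i j (moebius_comp i j f a) = besov_rho p n i j f"
      unfolding \<alpha>(2) besov_rho_eq_disc_rho[OF s] besov_rho_eq_disc_rho[OF splits_moebius_comp[OF s \<alpha>(1)]]
      by (rule disc_rho_mob[OF F \<alpha>(1)])
  qed
qed

end
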